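(* Let $D$ be a graded ring of generalized polynomials over a field $\mathcal{F}$ in the indeterminates $X=\{x_1,\dots,x_m\}$, let $F=\bigoplus_{i=1}^n D f_i$ be the free graded left $D$-module with generators $f_1,\dots,f_n$, and let $\Sigma\subset F$ be a system of homogeneous $D$-equations (a set of homogeneous elements of $F$). Let $e_1,\dots,e_n\in\mathbb{N}_0$ be such that $\operatorname{ord}_{f_j}h\le e_j$ for all $h\in\Sigma$ and all $j=1,\dots,n$. Let $d$ be the generalized type of $\Sigma$ and $\tau_d(\Sigma)$ its typical dimension. Then: (1) if the codimension of $\Sigma$ is $0$, then $\tau_d(\Sigma)\le n$; (2) if the codimension of $\Sigma$ is $1$, then $\tau_d(\Sigma)\le e_1+\dots+e_n$; (3) if the codimension of $\Sigma$ is $2$, then $$\tau_d(\Sigma)\le (e_1+\dots+e_n)\max_{1\le i\le n}e_i+\sum_{1\le i<j\le n}e_ie_j\le (e_1+\dots+e_n)^2 .$$ Moreover, this bound (the one in codimension $2$) is achieved: there is an example attaining it.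
   Context: Monomials: $T=T(X)$ is the free commutative semigroup with unity, written multiplicatively, generated by $X=\{x_1,\dots,x_m\}$. The order of $\theta=x_1^{i_1}\cdots x_m^{i_m}$ is $\operatorname{ord}\theta=i_1+\dots+i_m$. A ranking on $T$ is a linear order with $1\le\theta$ for all $\theta\in T$ and such that $\theta_1<\theta_2$ implies $\theta\theta_1<\theta\theta_2$. It is orderly if $\operatorname{ord}\theta_1<\operatorname{ord}\theta_2$ implies $\theta_1<\theta_2$. Ring of generalized polynomials: fix a ranking on $T$ and let $D$ be the (left) $\mathcal{F}$-vector space with basis $T$. For $0\ne g=\sum_\theta a_\theta\theta\in D$, the leader $u_g$ is the largest $\theta$ with $a_\theta\ne0$. $D$ is a ring of generalized polynomials in the indeterminates $X$ over $\mathcal{F}$ if it carries an associative unital ring structure extending the left $\mathcal{F}$-vector space structure such that $u_{AB}=u_Au_B$ for all nonzero $A,B\in D$, and such that the product in $D$ of monomials $\theta_1,\theta_2\in T$ is the monomial $\theta_1\theta_2$ (so $x_1,\dots,x_m$ commute pairwise). $\mathcal{F}$ need not be central in $D$; for instance, rings of differential operators over a differential field are rings of generalized polynomials. Graded: let the ranking be orderly and, for $s\in\mathbb{N}_0$, let $D_s$ be the $\mathcal{F}$-span of the monomials of order $s$. $D$ is graded if $D=\bigoplus_{s\ge0}D_s$ and $D_sD_r\subseteq D_{s+r}$ for all $s,r\in\mathbb{N}_0$. The free left module $F$ with generators $f_1,\dots,f_n$ is graded by $F_s=\bigoplus_{i=1}^nD_sf_i$; elements of $F_s$ are homogeneous of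 degree $s$. For $g\in D$, $\operatorname{ord}g$ is the maximal order of a monomial occurring in $g$ with nonzero coefficient ($-\infty$ for $g=0$). For $f=\sum_j g_jf_j\in F$ with $g_j\in D$, put $\operatorname{ord}_{f_j}f=\operatorname{ord}g_j$. Characteristic polynomial: for a system $\Sigma\subset F$ of homogeneous elements, let $H$ be the left $D$-submodule of $F$ generated by $\Sigma$, with $H_s=H\cap F_s$ and $(F/H)_s=F_s/H_s$. For all sufficiently large $s$, $\dim_{\mathcal{F}}(F/H)_s$ equals the value at $s$ of a numerical polynomial $\omega_{[\Sigma]}(s)$, the characteristic polynomial of $\Sigma$. Its degree $d$ is the (generalized) type of $\Sigma$, and $m-1-d$ is the (generalized) codimension of $\Sigma$. Writing $\omega_{[\Sigma]}(s)=\sum_{i=0}^d a_i\binom{s+i}{i}$ with $a_i\in\mathbb{Z}$ and $a_d\ne0$, the (generalized) typical dimension is $\tau_d(\Sigma)=a_d$. *)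

theory Defs
  imports
    "HOL-Library.Poly_Mapping"
    "HOL-Library.Extended_Real"
    "HOL-Computational_Algebra.Polynomial"
    "HOL-Algebra.Ring"
begin

text \<open>
  Monomials are exponent vectors with support in the index set \<open>{..<m}\<close>; the product of
  monomials is the sum of exponent vectors and the monomial 1 is \<open>0\<close>.
\<close>

type_synonym mon = "nat \<Rightarrow>\<^sub>0 nat"

type_synonym 'a gpol = "mon \<Rightarrow>\<^sub>0 'a"

definition monomials :: "nat \<Rightarrow> mon set" where
  "monomials m = {t. Poly_Mapping.keys t \<subseteq> {..<m}}"

definition mon_ord :: "mon \<Rightarrow> nat" where
  "mon_ord t = (\<Sum>i\<in>Poly_Mapping.keys t. Poly_Mapping.lookup t i)"

text \<open>\<open>(s, t) \<in> r\<close> means \<open>s \<le> t\<close>.\<close>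

definition ranking :: "nat \<Rightarrow> mon rel \<Rightarrow> bool" where
  "ranking m r \<longleftrightarrow> linear_order_on (monomials m) r \<and>
     (\<forall>t\<in>monomials m. (0, t) \<in> r) \<and>
     (\<forall>t\<in>monomials m. \<forall>t1\<in>monomials m. \<forall>t2\<in>monomials m.
        (t1, t2) \<in> r \<and> t1 \<noteq> t2 \<longrightarrow> (t + t1, t + t2) \<in> r \<and> t + t1 \<noteq> t + t2)"

definition orderly :: "nat \<Rightarrow> mon rel \<Rightarrow> bool" where
  "orderly m r \<longleftrightarrow> (\<forall>t1\<in>monomials m. \<forall>t2\<in>monomials m.
     mon_ord t1 < mon_ord t2 \<longrightarrow> (t1, t2) \<in> r \<and> t1 \<noteq> t2)"

definition gpols :: "nat \<Rightarrow> ('a::field) gpol set" where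
  "gpols m = {p. Poly_Mapping.keys p \<subseteq> monomials m}"

definition leader :: "mon rel \<Rightarrow> ('a::field) gpol \<Rightarrow> mon" where
  "leader r g = (THE t. t \<in> Poly_Mapping.keys g \<and> (\<forall>t'\<in>Poly_Mapping.keys g. (t', t) \<in> r))"

text \<open>The order of the zero element is \<open>-\<infinity>\<close>.\<close>

definition gpol_ord :: "('a::field) gpol \<Rightarrow> ereal" where
  "gpol_ord g = (SUP t\<in>Poly_Mapping.keys g. ereal (real (mon_ord t)))"

definition gscale :: "'a::field \<Rightarrow> 'a gpol \<Rightarrow> 'a gpol" where
  "gscale c = Poly_Mapping.map ((*) c)"

text \<open>
  The underlying left vector space is the one with basis \<open>monomials m\<close>. The multiplication
  is the one of the record \<open>D\<close>, not the commutative convolution product on the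
  type of finitely supported functions. Only left scalars are required to be compatible with it.
\<close>

locale gen_poly_ring =
  fixes m :: nat and r :: "mon rel" and D :: "('a::field) gpol ring"
  assumes ranking: "ranking m r"
    and ring: "ring D"
    and carrier: "carrier D = gpols m"
    and add: "add D = (+)"
    and zero: "\<zero>\<^bsub>D\<^esub> = 0"
    and scale_mult: "\<And>c A B. A \<in> gpols m \<Longrightarrow> B \<in> gpols m \<Longrightarrow>
      gscale c A \<otimes>\<^bsub>D\<^esub> B = gscale c (A \<otimes>\<^bsub>D\<^esub> B)"
    and leader_mult: "\<And>A B. A \<in> gpols m \<Longrightarrow> B \<in> gpols m \<Longrightarrow> A \<noteq> 0 \<Longrightarrow> B \<noteq> 0 \<Longrightarrow>
      A \<otimes>\<^bsub>D\<^esub> B \<noteq> 0 \<and> leader r (A \<otimes>\<^bsub>D\<^esub> B) = leader r A + leader r B"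
    and mon_mult: "\<And>s t. s \<in> monomials m \<Longrightarrow> t \<in> monomials m \<Longrightarrow>
      Poly_Mapping.single s 1 \<otimes>\<^bsub>D\<^esub> Poly_Mapping.single t 1 = Poly_Mapping.single (s + t) 1"

definition gpols_of_ord :: "nat \<Rightarrow> nat \<Rightarrow> ('a::field) gpol set" where
  "gpols_of_ord m s = {p \<in> gpols m. \<forall>t\<in>Poly_Mapping.keys p. mon_ord t = s}"

text \<open>
  The components \<open>gpols_of_ord m s\<close> are spanned by disjoint parts of the basis covering all of
  it, so their sum is direct and equal to the whole space without further assumptions.
\<close>

locale graded_gen_poly_ring = gen_poly_ring m r D
  for m :: nat and r :: "mon rel" and D :: "('a::field) gpol ring" +
  assumes orderly: "orderly m r"
    and graded: "\<And>s s' A B. A \<in> gpols_of_ord m s \<Longrightarrow> B \<in> gpols_of_ord m s' \<Longrightarrow>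
      A \<otimes>\<^bsub>D\<^esub> B \<in> gpols_of_ord m (s + s')"

text \<open>
  An element of the free module with generators indexed by \<open>{..<n}\<close> is given by its
  coordinates.
\<close>

type_synonym 'a fmod = "nat \<Rightarrow>\<^sub>0 'a gpol"

definition free_mod :: "nat \<Rightarrow> nat \<Rightarrow> ('a::field) fmod set" where
  "free_mod m n = {f. Poly_Mapping.keys f \<subseteq> {..<n} \<and> (\<forall>j<n. Poly_Mapping.lookup f j \<in> gpols m)}"

definition free_mod_deg :: "nat \<Rightarrow> nat \<Rightarrow> nat \<Rightarrow> ('a::field) fmod set" where
  "free_mod_deg m n s =
     {f \<in> free_mod m n. \<forall>j<n. Poly_Mapping.lookup f j \<in> gpols_of_ord m s}"

definition homogeneous :: "nat \<Rightarrow> nat \<Rightarrow> ('a::field) fmod \<Rightarrow> bool" where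
  "homogeneous m n f \<longleftrightarrow> (\<exists>s. f \<in> free_mod_deg m n s)"

definition ord_at :: "nat \<Rightarrow> ('a::field) fmod \<Rightarrow> ereal" where
  "ord_at j f = gpol_ord (Poly_Mapping.lookup f j)"

definition fscale :: "'a::field \<Rightarrow> 'a fmod \<Rightarrow> 'a fmod" where
  "fscale c = Poly_Mapping.map (gscale c)"

definition act :: "('a::field) gpol ring \<Rightarrow> 'a gpol \<Rightarrow> 'a fmod \<Rightarrow> 'a fmod" where
  "act D g = Poly_Mapping.map (\<lambda>q. g \<otimes>\<^bsub>D\<^esub> q)"

definition left_submodule :: "nat \<Rightarrow> nat \<Rightarrow> ('a::field) gpol ring \<Rightarrow> 'a fmod set \<Rightarrow> bool" where
  "left_submodule m n D N \<longleftrightarrow> N \<subseteq> free_mod m n \<and> 0 \<in> N \<and>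
     (\<forall>x\<in>N. \<forall>y\<in>N. x + y \<in> N) \<and> (\<forall>g\<in>carrier D. \<forall>x\<in>N. act D g x \<in> N)"

definition submodule_gen :: "nat \<Rightarrow> nat \<Rightarrow> ('a::field) gpol ring \<Rightarrow> 'a fmod set \<Rightarrow> 'a fmod set"
  where "submodule_gen m n D S = left_submodule m n D hull S"

text \<open>
  \<open>B\<close> is a set of representatives, one for each element, of a basis of the quotient space
  \<open>V / W\<close>.
\<close>

definition quotient_basis ::
  "('a::field \<Rightarrow> 'v::ab_group_add \<Rightarrow> 'v) \<Rightarrow> 'v set \<Rightarrow> 'v set \<Rightarrow> 'v set \<Rightarrow> bool" where
  "quotient_basis scale V W B \<longleftrightarrow> B \<subseteq> V \<and>
     (\<forall>S c. finite S \<and> S \<subseteq> B \<and> (\<Sum>b\<in>S. scale (c b) b) \<in> W \<longrightarrow> (\<forall>b\<in>S. c b = 0)) \<and>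
     (\<forall>v\<in>V. \<exists>S c. finite S \<and> S \<subseteq> B \<and> v - (\<Sum>b\<in>S. scale (c b) b) \<in> W)"

definition quotient_dim ::
  "('a::field \<Rightarrow> 'v::ab_group_add \<Rightarrow> 'v) \<Rightarrow> 'v set \<Rightarrow> 'v set \<Rightarrow> nat" where
  "quotient_dim scale V W = card (SOME B. quotient_basis scale V W B)"

definition characteristic_poly ::
  "nat \<Rightarrow> nat \<Rightarrow> ('a::field) gpol ring \<Rightarrow> 'a fmod set \<Rightarrow> rat poly" where
  "characteristic_poly m n D S = (THE w. \<forall>\<^sub>F s in sequentially. poly w (of_nat s) =
     of_nat (quotient_dim fscale (free_mod_deg m n s)
       (submodule_gen m n D S \<inter> free_mod_deg m n s)))"

text \<open>
  The degree of the zero polynomial is taken to be \<open>-1\<close>; the typical dimension is \<open>0\<close> in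
  that case.
\<close>

definition gen_type :: "nat \<Rightarrow> nat \<Rightarrow> ('a::field) gpol ring \<Rightarrow> 'a fmod set \<Rightarrow> int" where
  "gen_type m n D S = (let w = characteristic_poly m n D S
     in if w = 0 then -1 else int (Polynomial.degree w))"

definition gen_codim :: "nat \<Rightarrow> nat \<Rightarrow> ('a::field) gpol ring \<Rightarrow> 'a fmod set \<Rightarrow> int" where
  "gen_codim m n D S = int m - 1 - gen_type m n D S"

definition typical_dim :: "nat \<Rightarrow> nat \<Rightarrow> ('a::field) gpol ring \<Rightarrow> 'a fmod set \<Rightarrow> int" where
  "typical_dim m n D S = (let w = characteristic_poly m n D S; d = Polynomial.degree w
     in THE k. \<exists>a :: nat \<Rightarrow> int. a d = k \<and>
       (\<forall>s. poly w (of_nat s) = (\<Sum>i\<le>d. of_int (a i) * of_nat ((s + i) choose i))))"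

text \<open>
  For \<open>n = 0\<close> the unspecified value of \<open>Max {}\<close> is multiplied by an empty sum.
\<close>

definition codim2_bound :: "nat \<Rightarrow> (nat \<Rightarrow> nat) \<Rightarrow> nat" where
  "codim2_bound n e =
     (\<Sum>i<n. e i) * Max (e ` {..<n}) + (\<Sum>j<n. \<Sum>i<j. e i * e j)"

end

theory Submission imports Defs begin

text \<open>
  Let \<open>P s\<close> be the number of monomials of order \<open>s\<close>. The submodule \<open>H\<close> generated by the
  system is built up by adding homogeneous generators one at a time. If \<open>N\<close> is a graded
  submodule and \<open>h\<close> is homogeneous of degree \<open>d\<close>, then \<open>C \<mapsto> C h\<close> is linear over the field of
  left scalars and induces an injection of \<open>D / K\<close> into \<open>F / N\<close> with cokernel
  \<open>F / (N + D h)\<close>, where \<open>K = {C. C h \<in> N}\<close> is a graded left ideal. So passing from \<open>N\<close> to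
  \<open>N + D h\<close> lowers the Hilbert function in degree \<open>s\<close> by the dimension of \<open>(D / K)\<close> in degree
  \<open>s - d\<close>. Since leaders multiply, the leaders of \<open>K\<close> form an up-closed set \<open>E\<close> of monomials,
  and that dimension counts the monomials outside \<open>E\<close>. There are two possibilities. Either
  \<open>K = 0\<close> and the count is \<open>P (s - d)\<close>, so the rank drops; or \<open>E\<close> has a greatest common
  divisor, of order \<open>t\<close> say, and the count is \<open>P (s - d) - P (s - d - t)\<close> plus a nonnegative
  error \<open>u\<close> that for large \<open>s\<close> is a polynomial of degree at most \<open>m - 3\<close>, or zero if \<open>m < 3\<close>
  (\<open>hcount_gcd\<close>).

  The degrees of the generators are bounded by the numbers \<open>e j\<close>, and each \<open>F\<^sub>d\<close> has finite
  dimension, so finitely many generators suffice. Summing up (\<open>hilbert_fun_formula\<close>), for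
  large \<open>s\<close> the Hilbert function of \<open>F / H\<close> is
  \<open>n P(s) - (\<Sum>j\<in>J. P(s - d j)) - (\<Sum>(\<delta>, t). P(s - \<delta>) - P(s - \<delta> - t)) - u(s)\<close>,
  where \<open>J\<close> records the rank drops. The generators are added in order of decreasing degree. A
  rank drop in degree \<open>d\<close> can then be charged to a column \<open>j\<close> that is not yet in \<open>J\<close> and has
  \<open>d \<le> e j\<close>: all generators added so far only involve columns with \<open>d \<le> e j\<close>, and the number
  of these columns bounds the rank of the submodule they generate. This gives \<open>d j \<le> e j\<close>.

  The typical dimension is the leading coefficient in the binomial basis. In codimension 0 it
  is \<open>n - card J\<close>. In higher codimension that coefficient vanishes, so \<open>J\<close> consists of all
  columns, and the next coefficient is \<open>(\<Sum>j. d j) - (\<Sum>t)\<close>, which is the bound in codimension 1.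
  In codimension 2 this vanishes as well. With \<open>S = (\<Sum>j. d j) = (\<Sum>t)\<close>, twice the next coefficient
  is at most \<open>(\<Sum>(\<delta>, t). 2 \<delta> t + t\<^sup>2) - (\<Sum>j. (d j)\<^sup>2)\<close>. As \<open>\<delta>\<close> is at most the maximum \<open>M\<close> of the
  \<open>e j\<close> and \<open>(\<Sum>t\<^sup>2) \<le> S\<^sup>2\<close>, this is at most \<open>2 M S\<close> plus twice the sum of the products
  \<open>d i * d j\<close> over \<open>i < j\<close>, and both terms are monotone in the \<open>d j\<close>.

  Leading coefficients are extracted by iterated forward differences of integer-valued
  functions. The bound in codimension 2 is attained by two of the three variables of a
  polynomial ring.
\<close>

section \<open>Numerical polynomials via finite differences\<close>

definition fdiff :: "(nat \<Rightarrow> int) \<Rightarrow> nat \<Rightarrow> int" where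
  "fdiff f s = f (Suc s) - f s"

text \<open>
  A function is eventually a numerical polynomial of degree less than \<open>d\<close> exactly if its
  \<open>d\<close>-th difference is eventually zero. This form makes closure under sums, shifts and
  partial sums immediate and does not mention coefficients.
\<close>

definition numpoly :: "nat \<Rightarrow> (nat \<Rightarrow> int) \<Rightarrow> bool" where
  "numpoly d f \<longleftrightarrow> (\<forall>\<^sub>F s in sequentially. (fdiff ^^ d) f s = 0)"

lemma funpow_split: "a + b = k \<Longrightarrow> (f ^^ k) x = (f ^^ a) ((f ^^ b) x)"
  by (auto simp: funpow_add)

lemma fdiff_pow_add: "(fdiff ^^ k) (\<lambda>s. f s + g s) s = (fdiff ^^ k) f s + (fdiff ^^ k) g s"
  by (induction k arbitrary: s) (simp_all add: fdiff_def)

lemma fdiff_pow_diff: "(fdiff ^^ k) (\<lambda>s. f s - g s) s = (fdiff ^^ k) f s - (fdiff ^^ k) g s"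
  by (induction k arbitrary: s) (simp_all add: fdiff_def)

lemma fdiff_pow_cmult: "(fdiff ^^ k) (\<lambda>s. c * f s) s = c * (fdiff ^^ k) f s"
  by (induction k arbitrary: s) (simp_all add: fdiff_def algebra_simps)

lemma fdiff_pow_zero: "(fdiff ^^ k) (\<lambda>s. 0) s = 0"
  by (induction k arbitrary: s) (simp_all add: fdiff_def)

lemma fdiff_pow_sum: "(fdiff ^^ k) (\<lambda>s. \<Sum>i\<in>A. f i s) s = (\<Sum>i\<in>A. (fdiff ^^ k) (f i) s)"
  by (induction k arbitrary: s) (simp_all add: fdiff_def sum_subtractf)

lemma fdiff_pow_sum_list:
  "(fdiff ^^ k) (\<lambda>s. \<Sum>x\<leftarrow>xs. f x s) s = (\<Sum>x\<leftarrow>xs. (fdiff ^^ k) (f x) s)"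
  by (induction k arbitrary: s) (simp_all add: fdiff_def sum_list_subtractf)

lemma fdiff_pow_shift: "(fdiff ^^ k) (\<lambda>s. f (s + a)) s = (fdiff ^^ k) f (s + a)"
  by (induction k arbitrary: s) (simp_all add: fdiff_def)

lemma fdiff_pow_shift_back:
  "s \<ge> a \<Longrightarrow> (fdiff ^^ k) (\<lambda>s. f (s - a)) s = (fdiff ^^ k) f (s - a)"
  by (induction k arbitrary: s) (simp_all add: fdiff_def Suc_diff_le)

lemma fdiff_pow_cong:
  assumes "\<forall>\<^sub>F s in sequentially. f s = g s"
  shows "\<forall>\<^sub>F s in sequentially. (fdiff ^^ k) f s = (fdiff ^^ k) g s"
proof -
  obtain N where N: "\<And>s. s \<ge> N \<Longrightarrow> f s = g s"
    using assms by (auto simp: eventually_sequentially)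
  have "s \<ge> N \<Longrightarrow> (fdiff ^^ k) f s = (fdiff ^^ k) g s" for s
    by (induction k arbitrary: s) (simp_all add: fdiff_def N)
  then show ?thesis by (auto simp: eventually_sequentially)
qed

lemma eventually_shift_back:
  assumes "\<forall>\<^sub>F s in sequentially. P s"
  shows "\<forall>\<^sub>F s in sequentially. P (s - a :: nat)"
proof -
  obtain N where N: "\<And>s. s \<ge> N \<Longrightarrow> P s"
    using assms by (auto simp: eventually_sequentially)
  have "P (s - a)" if "s \<ge> N + a" for s using N[of "s - a"] that by simp
  then show ?thesis unfolding eventually_sequentially by blast
qed

lemma numpoly_cong:
  assumes "\<forall>\<^sub>F s in sequentially. f s = g s" "numpoly d g"
  shows "numpoly d f"
  using fdiff_pow_cong[OF assms(1), of d] assms(2) unfolding numpoly_def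
  by eventually_elim simp

lemma numpoly_mono:
  assumes "numpoly d f" "d \<le> d'"
  shows "numpoly d' f"
proof -
  have "\<forall>\<^sub>F s in sequentially. (fdiff ^^ d) f s = (\<lambda>s. 0) s"
    using assms(1) unfolding numpoly_def by simp
  from fdiff_pow_cong[OF this, of "d' - d"] assms(2) show ?thesis
    unfolding numpoly_def fdiff_pow_zero by (simp flip: funpow_split[of "d' - d" d])
qed

lemma numpoly_zero: "numpoly d (\<lambda>s. 0)"
  by (simp add: numpoly_def fdiff_pow_zero)

lemma numpoly_add: "numpoly d f \<Longrightarrow> numpoly d g \<Longrightarrow> numpoly d (\<lambda>s. f s + g s)"
  unfolding numpoly_def fdiff_pow_add by (erule (1) eventually_elim2) simp

lemma numpoly_diff: "numpoly d f \<Longrightarrow> numpoly d g \<Longrightarrow> numpoly d (\<lambda>s. f s - g s)"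
  unfolding numpoly_def fdiff_pow_diff by (erule (1) eventually_elim2) simp

lemma numpoly_sum: "(\<And>i. i \<in> A \<Longrightarrow> numpoly d (f i)) \<Longrightarrow> numpoly d (\<lambda>s. \<Sum>i\<in>A. f i s)"
  by (induction A rule: infinite_finite_induct) (auto simp: numpoly_zero intro: numpoly_add)

lemma numpoly_shift_back:
  assumes "numpoly d f"
  shows "numpoly d (\<lambda>s. f (s - a))"
  unfolding numpoly_def
  using eventually_shift_back[OF assms[unfolded numpoly_def], of a] eventually_ge_at_top[of a]
  by eventually_elim (simp add: fdiff_pow_shift_back)

lemma numpoly_fdiff: "numpoly d (fdiff f) \<Longrightarrow> numpoly (Suc d) f"
  by (simp add: numpoly_def funpow_Suc_right del: funpow.simps)

lemma numpoly_partial_sums: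
  assumes "numpoly d f"
  shows "numpoly (Suc d) (\<lambda>s. \<Sum>k\<le>s. f k)"
proof (rule numpoly_fdiff)
  have "fdiff (\<lambda>s. \<Sum>k\<le>s. f k) = (\<lambda>s. f (s + 1))" by (auto simp: fdiff_def)
  moreover have "\<forall>\<^sub>F s in sequentially. (fdiff ^^ d) f (Suc s) = 0"
    using assms unfolding numpoly_def eventually_sequentially by (meson le_SucI)
  ultimately show "numpoly d (fdiff (\<lambda>s. \<Sum>k\<le>s. f k))"
    by (simp add: numpoly_def fdiff_pow_shift del: One_nat_def) (simp)
qed

text \<open>
  A function with some iterated difference at most \<open>-1\<close> tends to minus infinity. This replaces
  the comparison of leading coefficients of polynomials.
\<close>

lemma fdiff_pow_neg:
  assumes "\<forall>\<^sub>F s in sequentially. (fdiff ^^ k) h s \<le> -1"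
  shows "\<forall>\<^sub>F s in sequentially. h s \<le> -1"
  using assms
proof (induction k arbitrary: h)
  case 0
  then show ?case by simp
next
  case (Suc k)
  then have "\<forall>\<^sub>F s in sequentially. fdiff h s \<le> -1"
    by (simp add: funpow_Suc_right del: funpow.simps)
  then obtain N where N: "\<And>s. s \<ge> N \<Longrightarrow> h (Suc s) - h s \<le> -1"
    by (auto simp: eventually_sequentially fdiff_def)
  have "h (N + i) \<le> h N - int i" for i
  proof (induction i)
    case (Suc i)
    then show ?case using N[of "N + i"] by simp
  qed simp
  note decr = this
  have "h s \<le> -1" if "s \<ge> N + nat (h N + 1)" for s
    using decr[of "s - N"] that by simp
  then show ?case unfolding eventually_sequentially by blast
qed

lemma fdiff_pow_nonneg:
  assumes "\<forall>\<^sub>F s in sequentially. h s \<ge> 0" "\<forall>\<^sub>F s in sequentially. (fdiff ^^ k) h s = c"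
  shows "c \<ge> 0"
proof (rule ccontr)
  assume "\<not> c \<ge> 0"
  with assms(2) have "\<forall>\<^sub>F s in sequentially. (fdiff ^^ k) h s \<le> -1"
    by (auto elim: eventually_mono)
  from fdiff_pow_neg[OF this] assms(1) have "\<forall>\<^sub>F s in sequentially. False"
    by eventually_elim auto
  then show False by simp
qed

lemma numpoly_Suc_const:
  assumes "numpoly (Suc d) f"
  obtains c where "\<forall>\<^sub>F s in sequentially. (fdiff ^^ d) f s = c"
proof -
  obtain N where N: "\<And>s. s \<ge> N \<Longrightarrow> fdiff ((fdiff ^^ d) f) s = 0"
    using assms by (auto simp: eventually_sequentially numpoly_def)
  have "(fdiff ^^ d) f (N + i) = (fdiff ^^ d) f N" for i
  proof (induction i)
    case (Suc i)
    then show ?case using N[of "N + i"] unfolding fdiff_def[of "(fdiff ^^ d) f"] by simp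
  qed simp
  then have "\<forall>s\<ge>N. (fdiff ^^ d) f s = (fdiff ^^ d) f N" by (metis le_Suc_ex)
  then show ?thesis using that unfolding eventually_sequentially by blast
qed

text \<open>
  If the top difference of \<open>f\<close>, an eventual constant, were negative then \<open>f\<close> would become
  negative, and if it were positive then \<open>g - f\<close> would. So the degree of \<open>f\<close> can be lowered
  one step at a time until it reaches that of \<open>g\<close>.
\<close>

lemma numpoly_squeeze:
  assumes f: "\<forall>\<^sub>F s in sequentially. 0 \<le> f s" and fg: "\<forall>\<^sub>F s in sequentially. f s \<le> g s"
    and g: "numpoly k g" and d: "numpoly d f"
  shows "numpoly k f"
  using d
proof (induction d)
  case 0
  then show ?case by (rule numpoly_mono) simp
next
  case (Suc d)
  show ?case
  proof (cases "Suc d \<le> k")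
    case True
    then show ?thesis using Suc.prems numpoly_mono by blast
  next
    case False
    then have gd: "\<forall>\<^sub>F s in sequentially. (fdiff ^^ d) g s = 0"
      using numpoly_mono[OF g, of d] by (simp add: numpoly_def)
    obtain c where c: "\<forall>\<^sub>F s in sequentially. (fdiff ^^ d) f s = c"
      using numpoly_Suc_const Suc.prems by blast
    have "c \<ge> 0" using fdiff_pow_nonneg[OF f c] .
    moreover have "- c \<ge> 0"
    proof (rule fdiff_pow_nonneg[where h = "\<lambda>s. g s - f s" and k = d])
      show "\<forall>\<^sub>F s in sequentially. 0 \<le> g s - f s" using fg by eventually_elim simp
      show "\<forall>\<^sub>F s in sequentially. (fdiff ^^ d) (\<lambda>s. g s - f s) s = - c"
        using gd c by eventually_elim (simp add: fdiff_pow_diff)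
    qed
    ultimately have "numpoly d f" using c by (simp add: numpoly_def)
    then show ?thesis by (rule Suc.IH)
  qed
qed

definition binom_fun :: "nat \<Rightarrow> nat \<Rightarrow> int" where
  "binom_fun i s = int ((s + i) choose i)"

lemma binom_fun_0 [simp]: "binom_fun 0 s = 1" by (simp add: binom_fun_def)

lemma binom_fun_Suc_Suc: "binom_fun (Suc i) (Suc s) = binom_fun (Suc i) s + binom_fun i (Suc s)"
  by (simp add: binom_fun_def)

lemma fdiff_pow_binom: "(fdiff ^^ k) (binom_fun (k + j)) s = binom_fun j (s + k)"
proof (induction k arbitrary: s j)
  case (Suc k)
  have "(fdiff ^^ Suc k) (binom_fun (Suc k + j)) s =
     (fdiff ^^ k) (binom_fun (k + Suc j)) (Suc s) - (fdiff ^^ k) (binom_fun (k + Suc j)) s"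
    by (simp add: fdiff_def)
  then show ?case by (simp only: Suc) (simp add: binom_fun_Suc_Suc)
qed simp

lemma fdiff_pow_binom_less:
  assumes "i < k" shows "(fdiff ^^ k) (binom_fun i) s = 0"
proof -
  have "(fdiff ^^ k) (binom_fun i) = (fdiff ^^ (k - Suc i)) ((fdiff ^^ Suc i) (binom_fun i))"
    using assms by (intro funpow_split) simp
  moreover have "(fdiff ^^ Suc i) (binom_fun i) = (\<lambda>s. 0)"
    using fdiff_pow_binom[of i 0] by (auto simp: fdiff_def)
  ultimately show ?thesis by (simp add: fdiff_pow_zero)
qed

text \<open>
  Summation of the expansion of the first difference. The difference is shifted back by one
  because \<open>binom_fun i\<close> is the backward, not the forward, difference of \<open>binom_fun (Suc i)\<close>.
\<close>

lemma numpoly_binom_expansion: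
  assumes "numpoly d f"
  shows "\<exists>a. \<forall>\<^sub>F s in sequentially. f s = (\<Sum>i<d. a i * binom_fun i s)"
  using assms
proof (induction d arbitrary: f)
  case 0
  then show ?case by (simp add: numpoly_def)
next
  case (Suc d)
  have "numpoly d (\<lambda>s. fdiff f (s - 1))"
    using Suc.prems by (intro numpoly_shift_back) (simp add: numpoly_def funpow_Suc_right del: funpow.simps)
  from Suc.IH[OF this] obtain a where
    a: "\<forall>\<^sub>F s in sequentially. fdiff f (s - 1) = (\<Sum>i<d. a i * binom_fun i s)" by blast
  define g where "g s = f s - (\<Sum>i<d. a i * binom_fun (Suc i) s)" for s
  have "\<forall>\<^sub>F s in sequentially. fdiff f s = (\<Sum>i<d. a i * binom_fun i (Suc s))"
    using a by (subst (asm) eventually_sequentially_Suc[symmetric]) simp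
  then have "\<forall>\<^sub>F s in sequentially. fdiff g s = 0"
    by eventually_elim (simp add: g_def fdiff_def binom_fun_Suc_Suc algebra_simps sum.distrib)
  then have "numpoly (Suc 0) g" by (simp add: numpoly_def)
  then obtain c where "\<forall>\<^sub>F s in sequentially. (fdiff ^^ 0) g s = c" by (rule numpoly_Suc_const)
  then have c: "\<forall>\<^sub>F s in sequentially. g s = c" by simp
  let ?a = "\<lambda>i. case i of 0 \<Rightarrow> c | Suc i \<Rightarrow> a i"
  have "\<forall>\<^sub>F s in sequentially. f s = (\<Sum>i<Suc d. ?a i * binom_fun i s)"
    using c by eventually_elim (subst sum.lessThan_Suc_shift, simp add: g_def)
  then show ?case by blast
qed

text \<open>
  The polynomial with values \<open>(s + i) choose i\<close>, as a product of linear factors.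
\<close>

fun binom_poly :: "nat \<Rightarrow> rat poly" where
  "binom_poly 0 = 1"
| "binom_poly (Suc i) = binom_poly i * [:1, 1 / of_nat (Suc i):]"

lemma poly_binom_poly: "poly (binom_poly i) (of_nat s) = of_nat ((s + i) choose i)"
proof (induction i)
  case (Suc i)
  have "Suc i * ((s + Suc i) choose Suc i) = (s + Suc i) * ((s + i) choose i)"
    using Suc_times_binomial_eq[of "s + i" i] by (simp add: mult.commute)
  then have "(of_nat (Suc i) :: rat) * of_nat ((s + Suc i) choose Suc i)
     = of_nat (s + Suc i) * of_nat ((s + i) choose i)" by (metis of_nat_mult)
  then show ?case using Suc by (simp add: field_simps del: binomial_Suc_Suc)
qed simp

lemma binom_poly_degree: "Polynomial.degree (binom_poly i) = i \<and> binom_poly i \<noteq> 0"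
proof (induction i)
  case (Suc i)
  have nz: "[:1, 1 / of_nat (Suc i):] \<noteq> (0 :: rat poly)" by simp
  have "Polynomial.degree [:1, 1 / of_nat (Suc i) :: rat:] = 1" by simp
  with Suc nz show ?case unfolding binom_poly.simps by (subst degree_mult_eq) (auto simp del: mult_pCons_right)
qed simp

lemma top_coeff_binom_poly: "poly.coeff (binom_poly i) i \<noteq> 0"
  using binom_poly_degree[of i] by (metis leading_coeff_0_iff)

lemma poly_eq_eventually:
  fixes p q :: "rat poly"
  assumes "\<forall>\<^sub>F s in sequentially. poly p (of_nat s) = poly q (of_nat s)"
  shows "p = q"
proof (rule ccontr)
  assume "p \<noteq> q"
  then have "finite {x. poly (p - q) x = 0}" by (intro poly_roots_finite) simp
  obtain N where N: "\<And>s. s \<ge> N \<Longrightarrow> poly p (of_nat s) = poly q (of_nat s)"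
    using assms by (auto simp: eventually_sequentially)
  have "of_nat ` {N..} \<subseteq> {x. poly (p - q) x = 0}" using N by auto
  then have "finite (of_nat ` {N..} :: rat set)"
    using \<open>finite {x. poly (p - q) x = 0}\<close> finite_subset by blast
  then have "finite {N..}" by (rule finite_imageD) (simp add: inj_on_def)
  then show False using infinite_Ici by blast
qed

definition binom_comb :: "nat \<Rightarrow> (nat \<Rightarrow> int) \<Rightarrow> rat poly" where
  "binom_comb d a = (\<Sum>i<d. smult (of_int (a i)) (binom_poly i))"

lemma poly_binom_comb:
  "poly (binom_comb d a) (of_nat s) = (\<Sum>i<d. of_int (a i) * of_nat ((s + i) choose i))"
  by (simp add: binom_comb_def poly_sum poly_binom_poly)

lemma coeff_binom_comb_top:
  "poly.coeff (binom_comb (Suc d) a) d = of_int (a d) * poly.coeff (binom_poly d) d"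
proof -
  have "poly.coeff (binom_poly i) d = 0" if "i < d" for i
    using that binom_poly_degree[of i] by (intro coeff_eq_0) simp
  then show ?thesis using binom_poly_degree[of d]
    by (simp add: binom_comb_def coeff_sum)
qed

lemma degree_binom_comb_top: "Polynomial.degree (binom_comb (Suc d) a) \<le> d"
  unfolding binom_comb_def
  by (intro degree_sum_le) (auto intro!: order.trans[OF degree_smult_le] simp: binom_poly_degree)

lemma binom_comb_top_unique:
  assumes "\<And>s. poly (binom_comb (Suc d) a) (of_nat s) = poly (binom_comb (Suc d) b) (of_nat s)"
  shows "a d = b d"
proof -
  have "binom_comb (Suc d) a = binom_comb (Suc d) b"
    by (intro poly_eq_eventually) (simp add: assms)
  then show ?thesis using coeff_binom_comb_top[of d a] coeff_binom_comb_top[of d b]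
      top_coeff_binom_poly[of d] by simp
qed

text \<open>
  The degree \<open>k\<close> is the largest index with a nonzero coefficient in the binomial basis, or \<open>0\<close>
  for the zero polynomial; the top coefficient is recovered by the \<open>k\<close>-th difference.
\<close>

lemma numpoly_characteristic:
  assumes "numpoly d f"
  shows "\<exists>k a. (\<forall>\<^sub>F s in sequentially. poly (binom_comb (Suc k) a) (of_nat s) = of_int (f s)) \<and>
     Polynomial.degree (binom_comb (Suc k) a) = k \<and> numpoly (Suc k) f \<and>
     (\<forall>\<^sub>F s in sequentially. (fdiff ^^ k) f s = a k)"
  using assms
proof (induction d)
  case 0
  then have "\<forall>\<^sub>F s in sequentially. f s = 0" by (simp add: numpoly_def)
  then have "\<forall>\<^sub>F s in sequentially. poly (binom_comb (Suc 0) (\<lambda>_. 0)) (of_nat s) = of_int (f s)"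
    by eventually_elim (simp add: binom_comb_def)
  moreover have "Polynomial.degree (binom_comb (Suc 0) (\<lambda>_. 0)) = 0" by (simp add: binom_comb_def)
  moreover have "numpoly (Suc 0) f" using 0 numpoly_mono by blast
  moreover have "\<forall>\<^sub>F s in sequentially. (fdiff ^^ 0) f s = (\<lambda>_. 0) (0::nat)" using 0 by (simp add: numpoly_def)
  ultimately show ?case by blast
next
  case (Suc d)
  obtain a where a: "\<forall>\<^sub>F s in sequentially. f s = (\<Sum>i<Suc d. a i * binom_fun i s)"
    using numpoly_binom_expansion[OF Suc.prems] by blast
  have "(fdiff ^^ d) (\<lambda>s. \<Sum>i<Suc d. a i * binom_fun i s) s = a d" for s
    using fdiff_pow_binom[of d 0 s]
    by (simp add: fdiff_pow_sum fdiff_pow_cmult fdiff_pow_binom_less fdiff_pow_add)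
  then have top: "\<forall>\<^sub>F s in sequentially. (fdiff ^^ d) f s = a d"
    using fdiff_pow_cong[OF a, of d] by simp
  show ?case
  proof (cases "a d = 0")
    case True
    then have "numpoly d f" using top by (simp add: numpoly_def)
    then show ?thesis by (rule Suc.IH)
  next
    case False
    have "poly.coeff (binom_comb (Suc d) a) d \<noteq> 0"
      using False coeff_binom_comb_top[of d a] top_coeff_binom_poly[of d] by simp
    then have "Polynomial.degree (binom_comb (Suc d) a) = d"
      using degree_binom_comb_top[of d a] le_degree by (metis le_antisym)
    moreover have "\<forall>\<^sub>F s in sequentially. poly (binom_comb (Suc d) a) (of_nat s) = of_int (f s)"
      using a by eventually_elim (simp only: poly_binom_comb, simp add: binom_fun_def)
    ultimately show ?thesis using top Suc.prems by blast
  qed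
qed

lemma the_poly_eq:
  fixes w :: "rat poly"
  assumes "\<forall>\<^sub>F s in sequentially. poly w (of_nat s) = g s"
  shows "(THE w. \<forall>\<^sub>F s in sequentially. poly w (of_nat s) = g s) = w"
proof (rule the_equality)
  fix v :: "rat poly" assume v: "\<forall>\<^sub>F s in sequentially. poly v (of_nat s) = g s"
  show "v = w"
  proof (rule poly_eq_eventually)
    show "\<forall>\<^sub>F s in sequentially. poly v (of_nat s) = poly w (of_nat s)"
      using v assms by eventually_elim simp
  qed
qed (fact assms)

text \<open>
  The bridge from the definite descriptions to finite differences: both descriptions are
  resolved as soon as the Hilbert function is known to be a numerical polynomial.
\<close>

lemma characteristic_poly_numpoly:
  assumes f: "\<And>s. f s = int (quotient_dim fscale (free_mod_deg m n s)
       (submodule_gen m n D S \<inter> free_mod_deg m n s))"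
    and d: "numpoly d f"
  defines "k \<equiv> Polynomial.degree (characteristic_poly m n D S)"
  shows "numpoly (Suc k) f" "\<forall>\<^sub>F s in sequentially. (fdiff ^^ k) f s = typical_dim m n D S"
    "characteristic_poly m n D S = 0 \<Longrightarrow> typical_dim m n D S = 0"
proof -
  let ?w = "characteristic_poly m n D S"
  obtain l a where
    w: "\<forall>\<^sub>F s in sequentially. poly (binom_comb (Suc l) a) (of_nat s) = of_int (f s)" and
    deg: "Polynomial.degree (binom_comb (Suc l) a) = l" and l: "numpoly (Suc l) f" and
    top: "\<forall>\<^sub>F s in sequentially. (fdiff ^^ l) f s = a l"
    using numpoly_characteristic[OF d] by blast
  have weq: "?w = binom_comb (Suc l) a"
    unfolding characteristic_poly_def by (rule the_poly_eq) (use w in \<open>simp add: f\<close>)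
  have kl: "k = l" using deg weq k_def by simp
  have td: "typical_dim m n D S = a l"
    unfolding typical_dim_def Let_def weq deg
  proof (rule the_equality)
    show "\<exists>b. b l = a l \<and> (\<forall>s. poly (binom_comb (Suc l) a) (of_nat s) =
        (\<Sum>i\<le>l. of_int (b i) * of_nat ((s + i) choose i)))"
      by (rule exI[of _ a]) (simp only: poly_binom_comb lessThan_Suc_atMost, simp)
    fix c assume "\<exists>b. b l = c \<and> (\<forall>s. poly (binom_comb (Suc l) a) (of_nat s) =
        (\<Sum>i\<le>l. of_int (b i) * of_nat ((s + i) choose i)))"
    then obtain b where b: "b l = c" "\<And>s. poly (binom_comb (Suc l) a) (of_nat s) =
        poly (binom_comb (Suc l) b) (of_nat s)"
      by (auto simp: poly_binom_comb lessThan_Suc_atMost)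
    then show "c = a l" using binom_comb_top_unique[of l a b] by simp
  qed
  show "numpoly (Suc k) f" using l kl by simp
  show "\<forall>\<^sub>F s in sequentially. (fdiff ^^ k) f s = typical_dim m n D S" using top kl td by simp
  show "typical_dim m n D S = 0" if "?w = 0"
  proof -
    have "\<forall>\<^sub>F s in sequentially. f s = 0" using w that weq by simp
    then have "\<forall>\<^sub>F s in sequentially. (fdiff ^^ l) f s = (fdiff ^^ l) (\<lambda>s. 0) s"
      by (rule fdiff_pow_cong)
    then have "\<forall>\<^sub>F s in sequentially. a l = 0"
      using top by eventually_elim (simp add: fdiff_pow_zero)
    then show ?thesis by (simp add: td)
  qed
qed

section \<open>Hilbert functions of monomial up-sets\<close>

abbreviation "lookup \<equiv> Poly_Mapping.lookup"
abbreviation "keys \<equiv> Poly_Mapping.keys"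
abbreviation "single \<equiv> Poly_Mapping.single"

definition mons :: "nat set \<Rightarrow> mon set" where
  "mons V = {t. keys t \<subseteq> V}"

lemma monomials_eq: "monomials m = mons {..<m}"
  by (simp add: monomials_def mons_def)

lemma mon_ord_eq_sum: "finite A \<Longrightarrow> keys t \<subseteq> A \<Longrightarrow> mon_ord t = (\<Sum>i\<in>A. lookup t i)"
  unfolding mon_ord_def by (rule sum.mono_neutral_left) (auto simp: in_keys_iff)

lemma mon_ord_add [simp]: "mon_ord (s + t) = mon_ord s + mon_ord t"
  using keys_add[of s t]
  by (subst (1 2 3) mon_ord_eq_sum[of "keys s \<union> keys t"]) (auto simp: lookup_add sum.distrib)

lemma mon_ord_single [simp]: "mon_ord (single x k) = k"
  by (simp add: mon_ord_def)

lemma mon_ord_zero [simp]: "mon_ord 0 = 0"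
  by (simp add: mon_ord_def)

lemma lookup_le_mon_ord: "lookup t x \<le> mon_ord t"
proof (cases "x \<in> keys t")
  case True
  then show ?thesis unfolding mon_ord_def by (intro member_le_sum) auto
qed (simp add: in_keys_iff)

lemma mons_zero [simp]: "0 \<in> mons V"
  by (simp add: mons_def)

lemma mons_add: "s \<in> mons V \<Longrightarrow> t \<in> mons V \<Longrightarrow> s + t \<in> mons V"
  using keys_add[of s t] by (auto simp: mons_def)

lemma mons_single: "x \<in> V \<Longrightarrow> single x k \<in> mons V"
  by (simp add: mons_def)

lemma mons_mono: "V \<subseteq> W \<Longrightarrow> t \<in> mons V \<Longrightarrow> t \<in> mons W"
  by (auto simp: mons_def)

lemma mons_empty: "mons {} = {0}"
  by (auto simp: mons_def)

lemma mon_split: "t = Poly_Mapping.update x 0 t + single x (lookup t x)"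
  by (rule poly_mapping_eqI) (auto simp: lookup_add lookup_update lookup_single when_def)

lemma mons_update: "t \<in> mons (insert x V) \<Longrightarrow> Poly_Mapping.update x 0 t \<in> mons (V - {x})"
  by (auto simp: mons_def keys_update)

lemma mons_insert_cases:
  assumes "t \<in> mons (insert x V)"
  obtains k t' where "t' \<in> mons V" "t = t' + single x k"
  using mon_split[of t x] mons_update[OF assms] mons_mono[of "V - {x}" V] by blast

lemma mon_dvd:
  assumes "\<And>j. lookup u j \<le> lookup t j" and "t \<in> mons V"
  obtains v where "v \<in> mons V" "t = v + u"
proof
  show "t = (t - u) + u"
    by (rule poly_mapping_eqI) (simp add: lookup_add lookup_minus assms(1))
  show "t - u \<in> mons V"
    using assms(2) by (auto simp: mons_def lookup_minus in_keys_iff subset_iff)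
qed

definition up_set :: "nat set \<Rightarrow> mon set \<Rightarrow> bool" where
  "up_set V E \<longleftrightarrow> E \<subseteq> mons V \<and> (\<forall>t\<in>E. \<forall>u\<in>mons V. t + u \<in> E)"

definition slice :: "nat set \<Rightarrow> nat \<Rightarrow> mon set \<Rightarrow> nat \<Rightarrow> mon set" where
  "slice V x E k = {t \<in> mons V. t + single x k \<in> E}"

lemma up_set_slice: 
  assumes "up_set (insert x V) E"
  shows "up_set V (slice V x E k)"
proof -
  have "t + u + single x k \<in> E" if "t + single x k \<in> E" "u \<in> mons V" for t u
    using assms that mons_mono[of V "insert x V" u] unfolding up_set_def
    by (metis add.assoc add.commute subset_insertI)
  then show ?thesis by (auto simp: up_set_def slice_def mons_add)
qed

lemma slice_mono:
  assumes "up_set (insert x V) E" "k \<le> l"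
  shows "slice V x E k \<subseteq> slice V x E l"
proof
  fix t assume t: "t \<in> slice V x E k"
  have "t + single x k + single x (l - k) \<in> E"
    using assms t mons_single[of x "insert x V" "l - k"] by (auto simp: up_set_def slice_def)
  moreover have "single x k + single x (l - k) = single x l"
    using assms(2) by (simp flip: single_add)
  ultimately show "t \<in> slice V x E l" using t by (simp add: slice_def add.assoc)
qed

text \<open>
  Dickson's lemma in the form of the ascending chain condition. Slicing by the exponent \<open>k\<close> of
  one variable gives sets that increase both in \<open>i\<close> and in \<open>k\<close>. The diagonal is stable from
  some \<open>N\<close> on, which fixes all slices with \<open>i, k \<ge> N\<close>; the finitely many rows \<open>k < N\<close> are
  stable by induction.
\<close>

lemma up_set_chain_stable:
  assumes "finite V" "\<And>i. up_set V (E i)" "\<And>i j :: nat. i \<le> j \<Longrightarrow> E i \<subseteq> E j"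
  shows "\<exists>N. \<forall>i\<ge>N. E i = E N"
  using assms
proof (induction V arbitrary: E rule: finite_induct)
  case empty
  show ?case
  proof (cases "\<exists>N. 0 \<in> E N")
    case True
    then obtain N where "0 \<in> E N" ..
    then have "E i = {0}" if "i \<ge> N" for i
      using empty(1)[of i] empty(2)[OF that] by (auto simp: up_set_def mons_empty)
    then show ?thesis by (metis order_refl)
  next
    case False
    then have "E i = {}" for i using empty(1)[of i] by (auto simp: up_set_def mons_empty)
    then show ?thesis by auto
  qed
next
  case (insert x V)
  let ?S = "\<lambda>i k. slice V x (E i) k"
  have up: "up_set V (?S i k)" for i k using up_set_slice insert.prems(1) by blast
  have mono: "?S i k \<subseteq> ?S j l" if "i \<le> j" "k \<le> l" for i j k l
    using slice_mono[OF insert.prems(1)[of i] that(2)] insert.prems(2)[OF that(1)]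
    by (auto simp: slice_def)
  obtain N where N: "\<And>i. i \<ge> N \<Longrightarrow> ?S i i = ?S N N"
    using insert.IH[of "\<lambda>i. ?S i i"] up mono by meson
  have "\<exists>M. \<forall>i\<ge>M. ?S i k = ?S M k" for k
    by (rule insert.IH) (use up mono in auto)
  then obtain M where M: "\<And>k i. i \<ge> M k \<Longrightarrow> ?S i k = ?S (M k) k" by metis
  define L where "L = Max (insert N (M ` {..<N}))"
  have LN: "L \<ge> N" and LM: "k < N \<Longrightarrow> L \<ge> M k" for k by (auto simp: L_def)
  \<comment> \<open>both indices are dominated by their maximum, where the diagonal is already stable\<close>
  have big: "?S i k = ?S N N" if "i \<ge> N" "k \<ge> N" for i k
    using mono[of N i N k] mono[of i "max i k" k "max i k"] N[of "max i k"] that by auto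
  have S: "?S i k = ?S L k" if "i \<ge> L" for i k
  proof (cases "k < N")
    case True
    then show ?thesis using M[of k i] M[of k L] LM[OF True] that by simp
  next
    case False
    then show ?thesis using big[of i k] big[of L k] LN that by simp
  qed
  have "E i \<subseteq> E L" if "i \<ge> L" for i
  proof
    fix t assume t: "t \<in> E i"
    then have "t \<in> mons (insert x V)" using insert.prems(1)[of i] by (auto simp: up_set_def)
    then obtain k t' where "t' \<in> mons V" "t = t' + single x k" by (rule mons_insert_cases)
    then show "t \<in> E L" using t S[OF that, of k] by (auto simp: slice_def)
  qed
  then show ?case using insert.prems(2) by blast
qed

text \<open>
  If \<open>E\<close> is the set of leaders of a graded left ideal, these monomials represent a basis of the
  quotient in degree \<open>s\<close>.
\<close>

definition mons_of_ord :: "nat set \<Rightarrow> mon set \<Rightarrow> nat \<Rightarrow> mon set" where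
  "mons_of_ord V E s = {t \<in> mons V. t \<notin> E \<and> mon_ord t = s}"

definition hcount :: "nat set \<Rightarrow> mon set \<Rightarrow> nat \<Rightarrow> int" where
  "hcount V E s = int (card (mons_of_ord V E s))"

lemma mons_of_ord_insert:
  assumes "x \<notin> V"
  shows "mons_of_ord (insert x V) E s =
     (\<Union>k\<le>s. (\<lambda>t. t + single x k) ` mons_of_ord V (slice V x E k) (s - k))" (is "?L = ?R")
proof
  show "?L \<subseteq> ?R"
  proof
    fix t assume t: "t \<in> ?L"
    then obtain k t' where k: "t' \<in> mons V" "t = t' + single x k"
      by (auto simp: mons_of_ord_def elim: mons_insert_cases)
    then have "t' \<in> mons_of_ord V (slice V x E k) (s - k)" "k \<le> s"
      using t by (auto simp: mons_of_ord_def slice_def)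
    then show "t \<in> ?R" using k by blast
  qed
  show "?R \<subseteq> ?L"
    using mons_mono[of V "insert x V"] mons_single[of x "insert x V"]
    by (auto simp: mons_of_ord_def slice_def intro!: mons_add)
qed

lemma lookup_mons_outside: "t \<in> mons V \<Longrightarrow> x \<notin> V \<Longrightarrow> lookup t x = 0"
  by (metis in_keys_iff mons_def mem_Collect_eq subsetD)

lemma finite_mons_of_ord: "finite V \<Longrightarrow> finite (mons_of_ord V E s)"
proof (induction V arbitrary: E s rule: finite_induct)
  case empty
  then show ?case by (simp add: mons_of_ord_def mons_empty)
next
  case (insert x V)
  then show ?case by (simp add: mons_of_ord_insert)
qed

lemma hcount_insert:
  assumes "finite V" "x \<notin> V"
  shows "hcount (insert x V) E s = (\<Sum>k\<le>s. hcount V (slice V x E k) (s - k))"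
proof -
  have "card (mons_of_ord (insert x V) E s) =
    (\<Sum>k\<le>s. card ((\<lambda>t. t + single x k) ` mons_of_ord V (slice V x E k) (s - k)))"
    unfolding mons_of_ord_insert[OF assms(2)]
  proof (rule card_UN_disjoint)
    have "lookup (t + single x k) x = k" if "t \<in> mons V" for t k
      using lookup_mons_outside[OF that assms(2)] by (simp add: lookup_add)
    then show "\<forall>i\<in>{..s}. \<forall>j\<in>{..s}. i \<noteq> j \<longrightarrow>
        (\<lambda>t. t + single x i) ` mons_of_ord V (slice V x E i) (s - i) \<inter>
        (\<lambda>t. t + single x j) ` mons_of_ord V (slice V x E j) (s - j) = {}"
      by (auto simp: mons_of_ord_def) metis
  qed (auto simp: finite_mons_of_ord assms)
  also have "\<dots> = (\<Sum>k\<le>s. card (mons_of_ord V (slice V x E k) (s - k)))"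
    by (intro sum.cong card_image) (auto simp: inj_on_def)
  finally show ?thesis by (simp add: hcount_def)
qed

lemma sum_atMost_reverse: "(\<Sum>k\<le>s. f (s - k)) = (\<Sum>k\<le>s. f k)" for s :: nat
  by (rule sum.reindex_bij_witness[of _ "\<lambda>k. s - k" "\<lambda>k. s - k"]) auto

text \<open>
  Counting by slices, \<open>hcount\<close> in one more variable is a sum over the exponent \<open>k\<close> of shifted
  counts. From some \<open>K\<close> on the slices no longer change, so up to finitely many correction
  terms this is a partial sum of one numerical polynomial.
\<close>

lemma numpoly_hcount:
  assumes "finite V" "up_set V E"
  shows "numpoly (card V) (hcount V E)"
  using assms
proof (induction V arbitrary: E rule: finite_induct)
  case empty
  have "hcount {} E s = 0" if "s \<ge> 1" for s
    using that by (simp add: hcount_def mons_of_ord_def mons_empty)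
  then show ?case by (auto simp: numpoly_def eventually_sequentially)
next
  case (insert x V)
  let ?S = "slice V x E"
  obtain K where K: "\<And>k. k \<ge> K \<Longrightarrow> ?S k = ?S K"
    using up_set_chain_stable[OF insert.hyps(1), of ?S] up_set_slice slice_mono insert.prems by blast
  have np: "numpoly (card V) (hcount V (?S k))" for k
    using insert.IH up_set_slice insert.prems by blast
  have "hcount (insert x V) E s =
     (\<Sum>k<K. hcount V (?S k) (s - k) - hcount V (?S K) (s - k)) + (\<Sum>k\<le>s. hcount V (?S K) k)"
    if "s \<ge> K" for s
  proof -
    have "hcount (insert x V) E s = (\<Sum>k\<le>s. hcount V (?S k) (s - k) - hcount V (?S K) (s - k))
       + (\<Sum>k\<le>s. hcount V (?S K) (s - k))"
      by (simp add: hcount_insert insert.hyps sum_subtractf)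
    moreover have "(\<Sum>k\<le>s. hcount V (?S k) (s - k) - hcount V (?S K) (s - k)) =
       (\<Sum>k<K. hcount V (?S k) (s - k) - hcount V (?S K) (s - k))"
    proof (rule sum.mono_neutral_right)
      show "\<forall>k\<in>{..s} - {..<K}. hcount V (?S k) (s - k) - hcount V (?S K) (s - k) = 0"
      proof
        fix k assume "k \<in> {..s} - {..<K}"
        then have "?S k = ?S K" by (intro K) auto
        then show "hcount V (?S k) (s - k) - hcount V (?S K) (s - k) = 0" by simp
      qed
    qed (use that in auto)
    ultimately show ?thesis by (simp add: sum_atMost_reverse)
  qed
  then have "\<forall>\<^sub>F s in sequentially. hcount (insert x V) E s =
     (\<Sum>k<K. hcount V (?S k) (s - k) - hcount V (?S K) (s - k)) + (\<Sum>k\<le>s. hcount V (?S K) k)"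
    unfolding eventually_sequentially by blast
  moreover have "numpoly (Suc (card V)) (\<lambda>s. (\<Sum>k<K. hcount V (?S k) (s - k) - hcount V (?S K) (s - k))
     + (\<Sum>k\<le>s. hcount V (?S K) k))"
    by (intro numpoly_add numpoly_partial_sums np numpoly_sum numpoly_diff numpoly_shift_back
        numpoly_mono[OF np]) simp_all
  ultimately show ?case using insert.hyps numpoly_cong by simp
qed

lemma hcount_all: "hcount {..<Suc m} {} s = binom_fun m s"
proof (induction m arbitrary: s)
  case 0
  have "hcount (insert 0 {}) {} s = (\<Sum>k\<le>s. hcount {} {} k)"
    by (subst hcount_insert) (simp_all add: slice_def sum_atMost_reverse)
  moreover have "hcount {} {} k = (if k = 0 then 1 else 0)" for k
  proof -
    have "mons_of_ord {} {} k = (if k = 0 then {0} else {})"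
      by (auto simp: mons_of_ord_def mons_empty)
    then show ?thesis by (simp add: hcount_def)
  qed
  ultimately show ?case by (simp add: lessThan_Suc)
next
  case (Suc m)
  have "hcount {..<Suc (Suc m)} {} s = (\<Sum>k\<le>s. binom_fun m k)" for s
    by (subst lessThan_Suc, subst hcount_insert)
       (simp_all add: slice_def sum_atMost_reverse Suc)
  moreover have "(\<Sum>k\<le>s. binom_fun m k) = binom_fun (Suc m) s" for s
    by (induction s) (simp_all add: binom_fun_Suc_Suc, simp add: binom_fun_def)
  ultimately show ?case by simp
qed

lemma numpoly_hcount_all: "finite V \<Longrightarrow> numpoly (card V) (hcount V {})"
  by (rule numpoly_hcount) (simp_all add: up_set_def)

lemma card_two_fixed_exponents:
  assumes "finite V" "i \<in> V" "j \<in> V" "i \<noteq> j"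
  shows "int (card {t \<in> mons V. mon_ord t = s \<and> lookup t i = a \<and> lookup t j = b})
    \<le> hcount (V - {i, j}) {} (s - (a + b))" (is "int (card ?A) \<le> _")
proof -
  let ?f = "\<lambda>t. Poly_Mapping.update j 0 (Poly_Mapping.update i 0 t)"
  have split: "t = ?f t + single j b + single i a" if "t \<in> ?A" for t
    using that mon_split[of t i] mon_split[of "Poly_Mapping.update i 0 t" j] assms(4)
    by (simp add: lookup_update)
  have "card ?A \<le> card (mons_of_ord (V - {i, j}) {} (s - (a + b)))"
  proof (rule card_inj_on_le)
    show "inj_on ?f ?A"
    proof (rule inj_onI)
      fix t u assume "t \<in> ?A" "u \<in> ?A" and eq: "?f t = ?f u"
      from split[OF this(1)] split[OF this(2)] show "t = u" unfolding eq by (rule trans[OF _ sym])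
    qed
    show "?f ` ?A \<subseteq> mons_of_ord (V - {i, j}) {} (s - (a + b))"
    proof
      fix u assume "u \<in> ?f ` ?A"
      then obtain t where t: "t \<in> ?A" "u = ?f t" by blast
      have "mon_ord t = mon_ord u + b + a" using split[OF t(1)] t(2) by (metis mon_ord_add mon_ord_single)
      moreover have "u \<in> mons (V - {i, j})"
        using t by (auto simp: mons_def keys_update)
      ultimately show "u \<in> mons_of_ord (V - {i, j}) {} (s - (a + b))"
        using t(1) by (auto simp: mons_of_ord_def)
    qed
  qed (simp add: finite_mons_of_ord assms)
  then show ?thesis by (simp add: hcount_def)
qed

text \<open>
  Choose \<open>c i \<in> E\<close> without the variable \<open>i\<close>. A monomial outside \<open>E\<close> is not divisible by \<open>c i\<close>, so
  it has a bounded exponent at some place other than \<open>i\<close>. Applying this twice, it has two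
  bounded exponents, and there are only as many such monomials as a polynomial of degree
  \<open>card V - 3\<close> allows.
\<close>

lemma numpoly_hcount_coprime:
  assumes V: "finite V" and E: "up_set V E" and cop: "\<And>i. i \<in> V \<Longrightarrow> \<exists>u\<in>E. lookup u i = 0"
  shows "numpoly (card V - 2) (hcount V E)"
proof (cases "V = {}")
  case True
  then show ?thesis using numpoly_hcount[OF V E] by simp
next
  case False
  then obtain i0 where i0: "i0 \<in> V" by blast
  obtain c where c: "\<And>i. i \<in> V \<Longrightarrow> c i \<in> E" "\<And>i. i \<in> V \<Longrightarrow> lookup (c i) i = 0"
    using cop by metis
  \<comment> \<open>a common bound for all exponents of the chosen elements\<close>
  define N where "N = (\<Sum>i\<in>V. mon_ord (c i))"
  have N: "lookup (c i) j \<le> N" if "i \<in> V" for i j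
    using lookup_le_mon_ord[of "c i" j] member_le_sum[of i V "\<lambda>i. mon_ord (c i)"] V that
    unfolding N_def by simp
  let ?B = "\<lambda>s i j a b. {t \<in> mons V. mon_ord t = s \<and> lookup t i = a \<and> lookup t j = b}"
  let ?bound = "\<lambda>s. \<Sum>i\<in>V. \<Sum>j\<in>V - {i}. \<Sum>a<N. \<Sum>b<N. hcount (V - {i, j}) {} (s - (a + b))"
  have small: "\<exists>j\<in>V - {i}. lookup t j < N" if "t \<in> mons V" "t \<notin> E" "i \<in> V" for t i
  proof -
    have "\<not> (\<forall>j. lookup (c i) j \<le> lookup t j)"
    proof
      assume "\<forall>j. lookup (c i) j \<le> lookup t j"
      then obtain v where "v \<in> mons V" "t = v + c i" using mon_dvd[of "c i" t V] \<open>t \<in> mons V\<close> by blast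
      then have "t \<in> E" using E c(1)[OF \<open>i \<in> V\<close>] unfolding up_set_def by (metis add.commute)
      then show False using \<open>t \<notin> E\<close> by simp
    qed
    then obtain j where j: "lookup t j < lookup (c i) j" by (auto simp: not_le)
    have "j \<in> V" using j E c(1)[OF \<open>i \<in> V\<close>] lookup_mons_outside[of "c i" V j]
      by (auto simp: up_set_def)
    moreover have "j \<noteq> i" using j c(2)[OF \<open>i \<in> V\<close>] by auto
    ultimately show ?thesis using j N[OF \<open>i \<in> V\<close>, of j] by (intro bexI[of _ j]) auto
  qed
  have le: "hcount V E s \<le> ?bound s" for s
  proof -
    have sub: "mons_of_ord V E s \<subseteq> (\<Union>i\<in>V. \<Union>j\<in>V - {i}. \<Union>a\<in>{..<N}. \<Union>b\<in>{..<N}. ?B s i j a b)"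
    proof
      fix t assume t: "t \<in> mons_of_ord V E s"
      then obtain i where i: "i \<in> V" "lookup t i < N"
        using small[of t i0] i0 by (auto simp: mons_of_ord_def)
      then obtain j where "j \<in> V - {i}" "lookup t j < N"
        using small[of t i] t by (auto simp: mons_of_ord_def)
      with i t show "t \<in> (\<Union>i\<in>V. \<Union>j\<in>V - {i}. \<Union>a\<in>{..<N}. \<Union>b\<in>{..<N}. ?B s i j a b)"
        by (auto simp: mons_of_ord_def)
    qed
    have fin: "finite (?B s i j a b)" for i j a b
      by (rule finite_subset[OF _ finite_mons_of_ord[OF V, of "{}" s]]) (auto simp: mons_of_ord_def)
    have "card (mons_of_ord V E s) \<le> card (\<Union>i\<in>V. \<Union>j\<in>V - {i}. \<Union>a\<in>{..<N}. \<Union>b\<in>{..<N}. ?B s i j a b)"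
      by (intro card_mono sub) (use V fin in auto)
    also have "\<dots> \<le> (\<Sum>i\<in>V. \<Sum>j\<in>V - {i}. \<Sum>a<N. \<Sum>b<N. card (?B s i j a b))"
      using V by (intro order.trans[OF card_UN_le] sum_mono order.refl) auto
    finally have "hcount V E s \<le> (\<Sum>i\<in>V. \<Sum>j\<in>V - {i}. \<Sum>a<N. \<Sum>b<N. int (card (?B s i j a b)))"
      unfolding hcount_def by (simp flip: of_nat_sum)
    also have "\<dots> \<le> ?bound s"
      using V by (intro sum_mono card_two_fixed_exponents) auto
    finally show ?thesis .
  qed
  have np: "numpoly (card V - 2) ?bound"
  proof (intro numpoly_sum numpoly_shift_back)
    fix i j assume "i \<in> V" "j \<in> V - {i}"
    then have "card (V - {i, j}) = card V - 2" using V by (subst card_Diff_subset) auto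
    then show "numpoly (card V - 2) (hcount (V - {i, j}) {})"
      using numpoly_hcount_all[of "V - {i, j}"] V by simp
  qed
  show ?thesis
    by (rule numpoly_squeeze[OF _ _ np numpoly_hcount[OF V E]])
       (use le in \<open>simp_all add: hcount_def\<close>)
qed

text \<open>
  Dividing \<open>E\<close> by its greatest common divisor, of order \<open>t\<close>, leaves a coprime up-set, whose
  complement, shifted by \<open>t\<close>, is counted by \<open>u\<close>.
\<close>

lemma hcount_gcd:
  assumes V: "finite V" and E: "up_set V E" and ne: "E \<noteq> {}"
  obtains t u where "numpoly (card V - 2) u" "\<And>s. 0 \<le> u s"
    "\<forall>\<^sub>F s in sequentially. hcount V E s = hcount V {} s - hcount V {} (s - t) + u s"
proof -
  \<comment> \<open>the exponents of the greatest common divisor\<close>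
  define h where "h i = (LEAST k. \<exists>u\<in>E. lookup u i = k)" for i
  have h_le: "h i \<le> lookup u i" if "u \<in> E" for u i
    unfolding h_def using that by (blast intro: Least_le)
  have h_eq: "\<exists>u\<in>E. lookup u i = h i" for i
    unfolding h_def using ne LeastI_ex[of "\<lambda>k. \<exists>u\<in>E. lookup u i = k"] by blast
  have h0: "h i = 0" if "i \<notin> V" for i
    using h_eq[of i] E lookup_mons_outside that by (auto simp: up_set_def)
  then have "finite {i. h i \<noteq> 0}" using V by (metis (mono_tags, lifting) finite_subset mem_Collect_eq subsetI)
  then obtain g :: mon where g: "\<And>i. lookup g i = h i"
    using lookup_Abs_poly_mapping by metis
  have gV: "g \<in> mons V" using h0 g unfolding mons_def in_keys_iff by (metis (mono_tags, lifting) in_keys_iff mem_Collect_eq subsetI)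
  define E' where "E' = {v \<in> mons V. v + g \<in> E}"
  have E': "up_set V E'"
    using E unfolding up_set_def E'_def by (auto simp: mons_add add.assoc add.commute[of _ g])
  have div: "\<exists>v\<in>E'. u = v + g" if u: "u \<in> E" for u
  proof -
    have "u \<in> mons V" using E u by (auto simp: up_set_def)
    then obtain v where "v \<in> mons V" "u = v + g"
      using mon_dvd[of g u V] h_le[OF u] g by metis
    then show ?thesis using u by (auto simp: E'_def)
  qed
  have np: "numpoly (card V - 2) (hcount V E')"
  proof (rule numpoly_hcount_coprime[OF V E'])
    fix i obtain u where "u \<in> E" "lookup u i = h i" using h_eq by blast
    then show "\<exists>u\<in>E'. lookup u i = 0" using div[of u] g by (auto simp: lookup_add)
  qed
  have "hcount V E s = hcount V {} s - hcount V {} (s - mon_ord g) + hcount V E' (s - mon_ord g)"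
    if s: "s \<ge> mon_ord g" for s
  proof -
    let ?A = "{t \<in> E. mon_ord t = s}" and ?A' = "{t \<in> E'. mon_ord t = s - mon_ord g}"
    have "?A = (\<lambda>v. v + g) ` ?A'"
    proof
      show "?A \<subseteq> (\<lambda>v. v + g) ` ?A'" using div by fastforce
      show "(\<lambda>v. v + g) ` ?A' \<subseteq> ?A" using s by (auto simp: E'_def)
    qed
    then have "card ?A = card ?A'" by (simp add: card_image inj_on_def)
    moreover have count: "hcount V F r = hcount V {} r - int (card {t \<in> F. mon_ord t = r})"
      if "up_set V F" for F r
    proof -
      have sub: "{t \<in> F. mon_ord t = r} \<subseteq> mons_of_ord V {} r"
        using that by (auto simp: up_set_def mons_of_ord_def)
      have "mons_of_ord V F r = mons_of_ord V {} r - {t \<in> F. mon_ord t = r}"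
        by (auto simp: mons_of_ord_def)
      then show ?thesis
        using card_Diff_subset[OF finite_subset[OF sub] sub] card_mono[OF _ sub] finite_mons_of_ord[OF V]
        by (simp add: hcount_def of_nat_diff)
    qed
    ultimately show ?thesis using count[OF E, of s] count[OF E', of "s - mon_ord g"] by simp
  qed
  then have "\<forall>\<^sub>F s in sequentially. hcount V E s =
      hcount V {} s - hcount V {} (s - mon_ord g) + hcount V E' (s - mon_ord g)"
    unfolding eventually_sequentially by blast
  then show ?thesis using that[OF numpoly_shift_back[OF np]] by (auto simp: hcount_def)
qed

section \<open>Dimensions of quotient spaces and of leader sets\<close>

lemma lookup_gscale: "lookup (gscale c p) t = c * lookup p t"
  by (simp add: gscale_def map.rep_eq when_def)

lemma gscale_zero_right: "gscale c 0 = 0"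
  by (rule poly_mapping_eqI) (simp add: lookup_gscale)

lemma lookup_fscale: "lookup (fscale c f) j = gscale c (lookup f j)"
  by (simp add: fscale_def map.rep_eq when_def gscale_zero_right)

interpretation gvs: vector_space gscale
  by unfold_locales (rule poly_mapping_eqI, simp add: lookup_gscale lookup_add algebra_simps)+

interpretation fvs: vector_space fscale
  by unfold_locales
     (rule poly_mapping_eqI, simp add: lookup_fscale lookup_add gvs.scale_right_distrib gvs.scale_left_distrib)+

context vector_space
begin

lemma finite_independent_in_span:
  assumes "independent B" "B \<subseteq> span T" "finite T"
  shows "finite B"
  using independent_span_bound[OF assms(3,1,2)] by simp

text \<open>
  A basis of the subspace \<open>W\<close> together with representatives of a basis of \<open>V / W\<close> is a basis of \<open>V\<close>.
\<close>

lemma quotient_basis_dim: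
  assumes V: "subspace V" "V \<subseteq> span T" "finite T" and W: "subspace W" "W \<subseteq> V"
    and B: "quotient_basis scale V W B"
  shows "finite B" "dim V = dim W + card B"
proof -
  have BV: "B \<subseteq> V"
    and ind: "\<And>S c. finite S \<Longrightarrow> S \<subseteq> B \<Longrightarrow> (\<Sum>b\<in>S. scale (c b) b) \<in> W \<Longrightarrow> \<forall>b\<in>S. c b = 0"
    and spn: "\<And>v. v \<in> V \<Longrightarrow> \<exists>S c. finite S \<and> S \<subseteq> B \<and> v - (\<Sum>b\<in>S. scale (c b) b) \<in> W"
    using B unfolding quotient_basis_def by auto
  obtain A where A: "A \<subseteq> W" "independent A" "W \<subseteq> span A" "card A = dim W"
    using basis_exists by blast
  have indAB: "independent (A \<union> B)"
    unfolding independent_explicit_finite_subsets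
  proof (intro allI impI ballI)
    fix S u v assume S: "S \<subseteq> A \<union> B" "finite S" "(\<Sum>v\<in>S. scale (u v) v) = 0" and v: "v \<in> S"
    have dec: "(\<Sum>v\<in>S. scale (u v) v) = (\<Sum>v\<in>S \<inter> A. scale (u v) v) + (\<Sum>v\<in>S - A. scale (u v) v)"
      using S(2) by (simp add: sum.Int_Diff)
    have inW: "(\<Sum>v\<in>S \<inter> A. scale (u v) v) \<in> W"
      using A(1) W(1) by (intro subspace_sum subspace_scale) auto
    have "(\<Sum>v\<in>S - A. scale (u v) v) = - (\<Sum>v\<in>S \<inter> A. scale (u v) v)"
      using dec S(3) by (simp add: eq_neg_iff_add_eq_0 add.commute)
    then have "(\<Sum>v\<in>S - A. scale (u v) v) \<in> W" using inW W(1) subspace_neg by simp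
    then have z: "\<forall>v\<in>S - A. u v = 0" using ind[of "S - A" u] S(1,2) by auto
    then have "(\<Sum>v\<in>S \<inter> A. scale (u v) v) = 0" using dec S(3) by simp
    then have "\<forall>v\<in>S \<inter> A. u v = 0" using independentD[OF A(2), of "S \<inter> A"] S(2) by auto
    then show "u v = 0" using z v by blast
  qed
  have disj: "A \<inter> B = {}"
  proof (rule ccontr)
    assume "A \<inter> B \<noteq> {}"
    then obtain b where "b \<in> A" "b \<in> B" by blast
    then show False using ind[of "{b}" "\<lambda>_. 1"] A(1) by auto
  qed
  have "A \<union> B \<subseteq> V" using A(1) W(2) BV by blast
  then have fin: "finite (A \<union> B)" using finite_independent_in_span[OF indAB] V(2,3) by blast
  have "V \<subseteq> span (A \<union> B)"
  proof
    fix v assume "v \<in> V"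
    then obtain S c where S: "finite S" "S \<subseteq> B" "v - (\<Sum>b\<in>S. scale (c b) b) \<in> W" using spn by blast
    have "v - (\<Sum>b\<in>S. scale (c b) b) \<in> span (A \<union> B)"
      using S(3) A(3) span_mono[of A "A \<union> B"] by blast
    moreover have "(\<Sum>b\<in>S. scale (c b) b) \<in> span (A \<union> B)"
      using S(2) by (intro span_sum span_scale span_base) auto
    ultimately have "v - (\<Sum>b\<in>S. scale (c b) b) + (\<Sum>b\<in>S. scale (c b) b) \<in> span (A \<union> B)"
      by (rule span_add)
    then show "v \<in> span (A \<union> B)" by simp
  qed
  then have "card (A \<union> B) = dim V"
    using basis_card_eq_dim[OF \<open>A \<union> B \<subseteq> V\<close> _ indAB] by blast
  then show "finite B" "dim V = dim W + card B"
    using fin A(4) card_Un_disjoint[of A B] disj by auto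
qed

lemma quotient_basis_exists:
  assumes V: "subspace V" "V \<subseteq> span T" "finite T" and W: "subspace W" "W \<subseteq> V"
  shows "\<exists>B. quotient_basis scale V W B"
proof -
  obtain A where A: "A \<subseteq> W" "independent A" "W \<subseteq> span A" "card A = dim W"
    using basis_exists by blast
  have "A \<subseteq> V" using A(1) W(2) by blast
  from maximal_independent_subset_extend[OF this A(2)]
  obtain B where B: "A \<subseteq> B" "B \<subseteq> V" "independent B" "V \<subseteq> span B" by metis
  have fin: "finite B" "finite A"
    using finite_independent_in_span[OF B(3)] B(1,2) V(2,3) finite_subset by blast+
  have "quotient_basis scale V W (B - A)"
    unfolding quotient_basis_def
  proof (intro conjI allI impI ballI)
    show "B - A \<subseteq> V" using B(2) by blast
  next
    fix S c b assume S: "finite S \<and> S \<subseteq> B - A \<and> (\<Sum>b\<in>S. scale (c b) b) \<in> W" and b: "b \<in> S"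
    then have "(\<Sum>b\<in>S. scale (c b) b) \<in> span A" using A(3) by blast
    then obtain u where u: "(\<Sum>b\<in>S. scale (c b) b) = (\<Sum>v\<in>A. scale (u v) v)"
      unfolding span_finite[OF fin(2)] by blast
    let ?c = "\<lambda>v. if v \<in> A then - u v else c v"
    have "(\<Sum>v\<in>S \<union> A. scale (?c v) v) = (\<Sum>v\<in>S. scale (?c v) v) + (\<Sum>v\<in>A. scale (?c v) v)"
      using S fin by (intro sum.union_disjoint) auto
    also have "(\<Sum>v\<in>S. scale (?c v) v) = (\<Sum>b\<in>S. scale (c b) b)"
      using S by (intro sum.cong) auto
    also have "(\<Sum>v\<in>A. scale (?c v) v) = - (\<Sum>v\<in>A. scale (u v) v)"
      by (simp add: sum_negf)
    finally have "(\<Sum>v\<in>S \<union> A. scale (?c v) v) = 0" using u by simp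
    then have "?c b = 0"
      using S B(1) b fin by (intro independentD[OF B(3), of "S \<union> A"]) auto
    then show "c b = 0" using S b by auto
  next
    fix v assume "v \<in> V"
    then obtain u where u: "v = (\<Sum>b\<in>B. scale (u b) b)"
      using B(4) unfolding span_finite[OF fin(1)] by blast
    have "(\<Sum>b\<in>B. scale (u b) b) = (\<Sum>b\<in>B - A. scale (u b) b) + (\<Sum>b\<in>A. scale (u b) b)"
      by (rule sum.subset_diff[OF B(1) fin(1)])
    then have "v - (\<Sum>b\<in>B - A. scale (u b) b) = (\<Sum>b\<in>A. scale (u b) b)" using u by simp
    moreover have "(\<Sum>b\<in>A. scale (u b) b) \<in> W"
      using A(1) W(1) by (intro subspace_sum subspace_scale) auto
    ultimately show "\<exists>S c. finite S \<and> S \<subseteq> B - A \<and> v - (\<Sum>b\<in>S. scale (c b) b) \<in> W"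
      using fin by (intro exI[of _ "B - A"] exI[of _ u]) auto
  qed
  then show ?thesis by blast
qed

lemma quotient_dim_eq:
  assumes V: "subspace V" "V \<subseteq> span T" "finite T" and W: "subspace W" "W \<subseteq> V"
  shows "int (quotient_dim scale V W) = int (dim V) - int (dim W)"
  using quotient_basis_dim(2)[OF assms someI_ex[OF quotient_basis_exists[OF assms]]]
  by (simp add: quotient_dim_def)

end

text \<open>
  Rank-nullity for the isomorphism of \<open>U / {u. f u \<in> W}\<close> with \<open>(W + f U) / W\<close>. Linearity is
  only required on \<open>U\<close> because the ring multiplication is only controlled on its carrier.
\<close>

lemma dim_sum_image:
  fixes s1 :: "'k::field \<Rightarrow> 'u::ab_group_add \<Rightarrow> 'u" and s2 :: "'k \<Rightarrow> 'v::ab_group_add \<Rightarrow> 'v"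
  assumes "vector_space s1" "vector_space s2"
    and U: "module.subspace s1 U" "U \<subseteq> module.span s1 TU" "finite TU"
    and W: "module.subspace s2 W" and fin: "W \<subseteq> module.span s2 TV" "f ` U \<subseteq> module.span s2 TV" "finite TV"
    and add: "\<And>x y. x \<in> U \<Longrightarrow> y \<in> U \<Longrightarrow> f (x + y) = f x + f y"
    and scl: "\<And>c x. x \<in> U \<Longrightarrow> f (s1 c x) = s2 c (f x)"
  shows "int (vector_space.dim s2 {w + f u | w u. w \<in> W \<and> u \<in> U}) - int (vector_space.dim s2 W) =
    int (vector_space.dim s1 U) - int (vector_space.dim s1 {u \<in> U. f u \<in> W})"
    and "module.subspace s2 {w + f u | w u. w \<in> W \<and> u \<in> U}"
    and "module.subspace s1 {u \<in> U. f u \<in> W}"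
proof -
  interpret a: vector_space s1 by fact
  interpret b: vector_space s2 by fact
  let ?K = "{u \<in> U. f u \<in> W}" and ?V = "{w + f u | w u. w \<in> W \<and> u \<in> U}"
  have f0: "f 0 = 0" using scl[of 0 0] a.subspace_0[OF U(1)] by simp
  show subK: "a.subspace ?K"
    using a.subspace_0[OF U(1)] a.subspace_add[OF U(1)] a.subspace_scale[OF U(1)]
      b.subspace_0[OF W] b.subspace_add[OF W] b.subspace_scale[OF W]
    by (intro a.subspaceI) (auto simp: f0 add scl)
  show subV: "b.subspace ?V"
  proof (rule b.subspaceI)
    show "0 \<in> ?V" using a.subspace_0[OF U(1)] b.subspace_0[OF W] f0 by force
  next
    fix x y assume "x \<in> ?V" "y \<in> ?V"
    then obtain w u w' u' where "x = w + f u" "y = w' + f u'" "w \<in> W" "w' \<in> W" "u \<in> U" "u' \<in> U" by blast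
    then have "x + y = (w + w') + f (u + u')" "w + w' \<in> W" "u + u' \<in> U"
      using a.subspace_add[OF U(1)] b.subspace_add[OF W] by (auto simp: add)
    then show "x + y \<in> ?V" by blast
  next
    fix c x assume "x \<in> ?V"
    then obtain w u where "x = w + f u" "w \<in> W" "u \<in> U" by blast
    then have "s2 c x = s2 c w + f (s1 c u)" "s2 c w \<in> W" "s1 c u \<in> U"
      using a.subspace_scale[OF U(1)] b.subspace_scale[OF W] by (auto simp: scl b.scale_right_distrib)
    then show "s2 c x \<in> ?V" by blast
  qed
  have f_sum: "f (\<Sum>b\<in>S. s1 (c b) b) = (\<Sum>b\<in>S. s2 (c b) (f b))" if "finite S" "S \<subseteq> U" for S c
    using that
  proof (induction S rule: finite_induct)
    case (insert x S)
    have "(\<Sum>b\<in>S. s1 (c b) b) \<in> U"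
      using insert.prems by (intro a.subspace_sum[OF U(1)] a.subspace_scale[OF U(1)]) auto
    then show ?case
      using insert a.subspace_scale[OF U(1)] by (simp add: add scl)
  qed (simp add: f0)
  have KU: "?K \<subseteq> U" by blast
  obtain B where B: "quotient_basis s1 U ?K B" using a.quotient_basis_exists[OF U subK KU] by blast
  then have BU: "B \<subseteq> U"
    and ind: "\<And>S c. finite S \<Longrightarrow> S \<subseteq> B \<Longrightarrow> (\<Sum>b\<in>S. s1 (c b) b) \<in> ?K \<Longrightarrow> \<forall>b\<in>S. c b = 0"
    and spn: "\<And>v. v \<in> U \<Longrightarrow> \<exists>S c. finite S \<and> S \<subseteq> B \<and> v - (\<Sum>b\<in>S. s1 (c b) b) \<in> ?K"
    unfolding quotient_basis_def by auto
  have inU: "(\<Sum>b\<in>S. s1 (c b) b) \<in> U" if "S \<subseteq> B" for S c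
    using that BU by (intro a.subspace_sum[OF U(1)] a.subspace_scale[OF U(1)]) auto
  have inj: "inj_on f B"
  proof (rule inj_onI, rule ccontr)
    fix x y assume xy: "x \<in> B" "y \<in> B" "f x = f y" "x \<noteq> y"
    \<comment> \<open>the difference \<open>x - y\<close> is mapped to \<open>0\<close>\<close>
    let ?c = "\<lambda>b. if b = x then 1 else - 1 :: 'k"
    have "f (\<Sum>b\<in>{x, y}. s1 (?c b) b) = 0"
      using xy BU by (subst f_sum) auto
    then have "(\<Sum>b\<in>{x, y}. s1 (?c b) b) \<in> ?K"
      using inU[of "{x, y}" ?c] xy b.subspace_0[OF W] by simp
    then have "\<forall>b\<in>{x, y}. ?c b = 0" using ind[of "{x, y}" ?c] xy by blast
    then show False by simp
  qed
  have QB: "quotient_basis s2 ?V W (f ` B)"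
    unfolding quotient_basis_def
  proof (intro conjI allI impI ballI)
    show "f ` B \<subseteq> ?V" using BU b.subspace_0[OF W] by force
  next
    fix S c v assume S: "finite S \<and> S \<subseteq> f ` B \<and> (\<Sum>b\<in>S. s2 (c b) b) \<in> W" and v: "v \<in> S"
    then obtain S' where S': "S' \<subseteq> B" "finite S'" "S = f ` S'" by (meson finite_subset_image)
    have "inj_on f S'" using inj S'(1) inj_on_subset by blast
    then have "(\<Sum>b\<in>S. s2 (c b) b) = f (\<Sum>b\<in>S'. s1 (c (f b)) b)"
      using S' BU by (subst f_sum) (auto simp: sum.reindex)
    then have "(\<Sum>b\<in>S'. s1 (c (f b)) b) \<in> ?K" using S inU[OF S'(1), of "\<lambda>b. c (f b)"] by simp
    then have "\<forall>b\<in>S'. c (f b) = 0" using ind[of S' "\<lambda>b. c (f b)"] S' by blast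
    then show "c v = 0" using v S' by blast
  next
    fix v assume "v \<in> ?V"
    then obtain w u where wu: "v = w + f u" "w \<in> W" "u \<in> U" by blast
    then obtain S c where S: "finite S" "S \<subseteq> B" "u - (\<Sum>b\<in>S. s1 (c b) b) \<in> ?K" using spn by blast
    let ?g = "inv_into B f"
    have injS: "inj_on f S" using inj S(2) inj_on_subset by blast
    have "(\<Sum>b\<in>f ` S. s2 (c (?g b)) b) = (\<Sum>b\<in>S. s2 (c b) (f b))"
      using S(2) inj by (subst sum.reindex[OF injS]) (auto intro!: sum.cong simp: inv_into_f_f subset_iff)
    also have "\<dots> = f (\<Sum>b\<in>S. s1 (c b) b)" using S BU by (subst f_sum) auto
    finally have eq: "(\<Sum>b\<in>f ` S. s2 (c (?g b)) b) = f (\<Sum>b\<in>S. s1 (c b) b)" .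
    have "f u = f ((u - (\<Sum>b\<in>S. s1 (c b) b)) + (\<Sum>b\<in>S. s1 (c b) b))" by simp
    also have "\<dots> = f (u - (\<Sum>b\<in>S. s1 (c b) b)) + f (\<Sum>b\<in>S. s1 (c b) b)"
      using S(3) inU[OF S(2)] by (intro add) auto
    finally have "v - (\<Sum>b\<in>f ` S. s2 (c (?g b)) b) = w + f (u - (\<Sum>b\<in>S. s1 (c b) b))"
      using wu eq by simp
    then have "v - (\<Sum>b\<in>f ` S. s2 (c (?g b)) b) \<in> W"
      using wu(2) S(3) b.subspace_add[OF W] by simp
    then show "\<exists>S c. finite S \<and> S \<subseteq> f ` B \<and> v - (\<Sum>b\<in>S. s2 (c b) b) \<in> W"
      using S by (intro exI[of _ "f ` S"] exI[of _ "\<lambda>b. c (?g b)"]) auto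
  qed
  have "?V \<subseteq> b.span TV"
    using fin by (auto intro!: b.span_add)
  moreover have "W \<subseteq> ?V" using a.subspace_0[OF U(1)] f0 by force
  ultimately have "b.dim ?V = b.dim W + card (f ` B)"
    using b.quotient_basis_dim(2)[OF subV _ fin(3) W _ QB] by blast
  moreover have "a.dim U = a.dim ?K + card B" using a.quotient_basis_dim(2)[OF U subK KU B] .
  ultimately show "int (b.dim ?V) - int (b.dim W) = int (a.dim U) - int (a.dim ?K)"
    using inj by (simp add: card_image)
qed

lemma gpol_in_span:
  fixes p :: "('a::field) gpol"
  assumes "finite M" "keys p \<subseteq> M"
  shows "p \<in> gvs.span ((\<lambda>t. single t 1) ` M)"
proof -
  have "p = (\<Sum>t\<in>M. gscale (lookup p t) (single t 1))"
  proof (rule poly_mapping_eqI)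
    fix u
    have "lookup (\<Sum>t\<in>M. gscale (lookup p t) (single t 1)) u = (\<Sum>t\<in>M. if t = u then lookup p t else 0)"
      unfolding lookup_sum by (intro sum.cong) (auto simp: lookup_gscale lookup_single)
    then show "lookup p u = lookup (\<Sum>t\<in>M. gscale (lookup p t) (single t 1)) u"
      using assms by (auto simp: in_keys_iff)
  qed
  also have "\<dots> \<in> gvs.span ((\<lambda>t. single t 1) ` M)"
    by (intro gvs.span_sum gvs.span_scale gvs.span_base) auto
  finally show ?thesis .
qed

lemma linear_order_max:
  assumes "linear_order_on A r" "finite S" "S \<noteq> {}" "S \<subseteq> A"
  shows "\<exists>t\<in>S. \<forall>u\<in>S. (u, t) \<in> r"
  using assms(2-)
proof (induction S rule: finite_ne_induct)
  case (singleton x)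
  then show ?case using assms(1) by (auto simp: order_on_defs refl_on_def)
next
  case (insert x S)
  then obtain t where t: "t \<in> S" "\<forall>u\<in>S. (u, t) \<in> r" by auto
  have xt: "x \<in> A" "t \<in> A" using insert.prems t by auto
  have "(x, t) \<in> r \<or> (t, x) \<in> r" 
    using xt assms(1) by (cases "x = t") (auto simp: order_on_defs refl_on_def total_on_def)
  moreover have "trans r" "(x, x) \<in> r" using assms(1) xt by (auto simp: order_on_defs refl_on_def)
  ultimately show ?case using t by (metis insert_iff transE)
qed

lemma leader_eqI:
  assumes "linear_order_on A r" "t \<in> keys g" "\<And>u. u \<in> keys g \<Longrightarrow> (u, t) \<in> r" 
  shows "leader r g = t"
  unfolding leader_def
proof (rule the_equality)
  fix t' assume "t' \<in> keys g \<and> (\<forall>u\<in>keys g. (u, t') \<in> r)"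
  then show "t' = t" using assms by (auto simp: order_on_defs antisym_def)
qed (use assms in auto)

lemma leader_in_keys:
  assumes "linear_order_on A r" "keys g \<subseteq> A" "g \<noteq> 0"
  shows "leader r g \<in> keys g" "\<And>u. u \<in> keys g \<Longrightarrow> (u, leader r g) \<in> r"
proof -
  have "keys g \<noteq> {}" using assms(3) by simp
  then obtain t where "t \<in> keys g" "\<forall>u\<in>keys g. (u, t) \<in> r"
    using linear_order_max[OF assms(1), of "keys g"] assms(2) by auto
  moreover from this have "leader r g = t" by (intro leader_eqI[OF assms(1)]) auto
  ultimately show "leader r g \<in> keys g" "\<And>u. u \<in> keys g \<Longrightarrow> (u, leader r g) \<in> r" by auto
qed

text \<open>
  Induction on the set \<open>M\<close> of available monomials: passing to the elements without the
  largest monomial \<open>t\<close> of \<open>M\<close> lowers the dimension by one exactly if \<open>t\<close> is a leader.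
\<close>

lemma gvs_dim_eq_card_leaders:
  fixes K :: "('a::field) gpol set"
  assumes r: "linear_order_on A r" and M: "finite M" "M \<subseteq> A"
    and K: "gvs.subspace K" "\<And>p. p \<in> K \<Longrightarrow> keys p \<subseteq> M"
  shows "gvs.dim K = card (leader r ` (K - {0}))"
  using M K
proof (induction "card M" arbitrary: M K)
  case 0
  then have "K = {0}" using gvs.subspace_0[of K] by fastforce
  moreover have "gvs.dim {0 :: 'a gpol} = 0" by (rule gvs.dim_unique[of "{}"]) (simp_all add: gvs.independent_empty)
  ultimately show ?case by simp
next
  case (Suc k)
  then have "M \<noteq> {}" by auto
  then obtain t where t: "t \<in> M" "\<forall>u\<in>M. (u, t) \<in> r"
    using linear_order_max[OF r Suc.prems(1)] Suc.prems(2) by auto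
  define K' where "K' = {p \<in> K. lookup p t = 0}"
  have K': "gvs.subspace K'"
    using gvs.subspace_0[OF Suc.prems(3)] gvs.subspace_add[OF Suc.prems(3)] gvs.subspace_scale[OF Suc.prems(3)]
    by (intro gvs.subspaceI) (auto simp: K'_def lookup_add lookup_gscale)
  have K'M: "keys p \<subseteq> M - {t}" if "p \<in> K'" for p
    using that Suc.prems(4) by (auto simp: K'_def in_keys_iff)
  have IH: "gvs.dim K' = card (leader r ` (K' - {0}))"
    by (rule Suc.hyps(1)[of "M - {t}"]) (use Suc t K' K'M in auto)
  have notin: "t \<notin> leader r ` (K' - {0})"
  proof
    assume "t \<in> leader r ` (K' - {0})"
    then obtain p where "p \<in> K'" "p \<noteq> 0" "t = leader r p" by blast
    moreover from this have "leader r p \<in> keys p"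
      using leader_in_keys(1)[OF r, of p] K'M[of p] Suc.prems(2) by blast
    ultimately show False using K'M by blast
  qed
  show ?case
  proof (cases "K' = K")
    case True
    then show ?thesis using IH by simp
  next
    case False
    then obtain w where w: "w \<in> K" "lookup w t \<noteq> 0" by (auto simp: K'_def)
    have top: "leader r p = t" if "p \<in> K" "lookup p t \<noteq> 0" for p
      using that t Suc.prems(4) by (intro leader_eqI[OF r]) (auto simp: in_keys_iff[symmetric])
    have "w \<noteq> 0" using w by auto
    then have ldr: "leader r ` (K - {0}) = insert t (leader r ` (K' - {0}))"
      using top w by (auto simp: K'_def image_iff)
    obtain B where B: "B \<subseteq> K'" "gvs.independent B" "K' \<subseteq> gvs.span B" "card B = gvs.dim K'"
      using gvs.basis_exists by blast
    have spB: "gvs.span B \<subseteq> K'" using B(1) K' by (rule gvs.span_minimal)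
    then have wB: "w \<notin> gvs.span B" using w by (auto simp: K'_def)
    have "finite (leader r ` (K' - {0}))"
    proof (rule finite_subset[OF _ Suc.prems(1)])
      show "leader r ` (K' - {0}) \<subseteq> M"
        using leader_in_keys(1)[OF r] K'M Suc.prems(2) by blast
    qed
    have "B \<subseteq> gvs.span ((\<lambda>t. single t 1) ` M)"
      using B(1) K'M gpol_in_span[OF Suc.prems(1)] by blast
    then have fB: "finite B" using gvs.finite_independent_in_span[OF B(2)] Suc.prems(1) by simp
    have "gvs.dim K = card (insert w B)"
    proof (rule gvs.dim_unique)
      show "insert w B \<subseteq> K" using w B(1) by (auto simp: K'_def)
      show "gvs.independent (insert w B)" using gvs.independent_insertI[OF wB B(2)] .
      show "K \<subseteq> gvs.span (insert w B)"
      proof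
        fix p assume p: "p \<in> K"
        let ?c = "lookup p t / lookup w t"
        have "p - gscale ?c w \<in> K'"
          using w gvs.subspace_diff[OF Suc.prems(3) p gvs.subspace_scale[OF Suc.prems(3) w(1)]]
          by (auto simp: K'_def lookup_minus lookup_gscale)
        then show "p \<in> gvs.span (insert w B)" using B(3) gvs.span_breakdown_eq by blast
      qed
    qed simp
    also have "\<dots> = Suc (gvs.dim K')"
      using B(4) fB wB gvs.span_base by (subst card_insert_disjoint) auto
    finally show ?thesis
      using IH ldr notin \<open>finite (leader r ` (K' - {0}))\<close> by simp
  qed
qed

section \<open>Graded pieces of the ring and of the free module\<close>

text \<open>
  The index set \<open>J\<close> is arbitrary because a generator of degree \<open>d\<close> lives in the columns \<open>j\<close> with
  \<open>d \<le> e j\<close>, and the rank of the free module on these columns matters.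
\<close>

definition fdeg :: "nat \<Rightarrow> nat set \<Rightarrow> nat \<Rightarrow> ('a::field) fmod set" where
  "fdeg m J s = {f. keys f \<subseteq> J \<and> (\<forall>j. lookup f j \<in> gpols_of_ord m s)}"

lemma zero_in_gpols_of_ord [simp]: "0 \<in> gpols_of_ord m s"
  by (simp add: gpols_of_ord_def gpols_def)

lemma gpols_of_ord_subset: "gpols_of_ord m s \<subseteq> gpols m"
  by (auto simp: gpols_of_ord_def)

lemma gpols_of_ord_iff: "p \<in> gpols_of_ord m s \<longleftrightarrow> keys p \<subseteq> mons_of_ord {..<m} {} s"
  by (auto simp: gpols_of_ord_def gpols_def mons_of_ord_def monomials_eq)

lemma subspace_supported: "gvs.subspace {p. keys p \<subseteq> M}"
proof (rule gvs.subspaceI)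
  fix x y :: "'a gpol" assume "x \<in> {p. keys p \<subseteq> M}" "y \<in> {p. keys p \<subseteq> M}"
  then show "x + y \<in> {p. keys p \<subseteq> M}" using keys_add[of x y] by auto
qed (auto simp: in_keys_iff subset_iff lookup_gscale)

lemma subspace_gpols: "gvs.subspace (gpols m)"
  unfolding gpols_def by (rule subspace_supported)

lemma subspace_gpols_of_ord: "gvs.subspace (gpols_of_ord m s)"
  using subspace_supported[of "mons_of_ord {..<m} {} s"] by (simp add: gpols_of_ord_iff[symmetric])

lemma free_mod_deg_eq: "free_mod_deg m n s = fdeg m {..<n} s"
proof -
  have "lookup f j \<in> gpols_of_ord m s" if "keys f \<subseteq> {..<n}" "\<not> j < n" for f :: "'a fmod" and j
  proof -
    have "lookup f j = 0" using that by (auto simp: in_keys_iff subset_iff)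
    then show ?thesis by simp
  qed
  then show ?thesis using gpols_of_ord_subset unfolding free_mod_deg_def free_mod_def fdeg_def by blast
qed

lemma fdeg_subset_free_mod: "J \<subseteq> {..<n} \<Longrightarrow> fdeg m J s \<subseteq> free_mod m n"
  using gpols_of_ord_subset by (auto simp: fdeg_def free_mod_def) blast+

lemma fdeg_mono: "J \<subseteq> L \<Longrightarrow> fdeg m J s \<subseteq> fdeg m L s"
  by (auto simp: fdeg_def)

lemma subspace_fdeg: "fvs.subspace (fdeg m J s)"
proof (rule fvs.subspaceI)
  fix x y :: "'a fmod" assume "x \<in> fdeg m J s" "y \<in> fdeg m J s"
  then show "x + y \<in> fdeg m J s"
    using keys_add[of x y] by (auto simp: fdeg_def lookup_add intro: gvs.subspace_add[OF subspace_gpols_of_ord])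
qed (auto simp: fdeg_def lookup_fscale in_keys_iff subset_iff gscale_zero_right
    intro: gvs.subspace_scale[OF subspace_gpols_of_ord])

definition fbasis :: "nat \<Rightarrow> nat set \<Rightarrow> nat \<Rightarrow> ('a::field) fmod set" where
  "fbasis m J s = (\<lambda>(j, t). single j (single t 1)) ` (J \<times> mons_of_ord {..<m} {} s)"

lemma finite_fbasis: "finite J \<Longrightarrow> finite (fbasis m J s)"
  by (simp add: fbasis_def finite_mons_of_ord)

lemma fdeg_span:
  assumes "finite J"
  shows "fdeg m J s \<subseteq> fvs.span (fbasis m J s)"
proof
  fix f :: "'a fmod" assume f: "f \<in> fdeg m J s"
  let ?M = "mons_of_ord {..<m} {} s"
  have "f = (\<Sum>j\<in>J. \<Sum>t\<in>?M. fscale (lookup (lookup f j) t) (single j (single t 1)))" (is "f = ?g")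
  proof (rule poly_mapping_eqI, rule poly_mapping_eqI)
    fix i u
    have "lookup (lookup ?g i) u =
      (\<Sum>j\<in>J. \<Sum>t\<in>?M. if j = i then if t = u then lookup (lookup f j) t else 0 else 0)"
      unfolding lookup_sum
      by (intro sum.cong) (auto simp: lookup_fscale lookup_gscale lookup_single gscale_zero_right)
    also have "\<dots> = (\<Sum>j\<in>J. if j = i then \<Sum>t\<in>?M. if t = u then lookup (lookup f j) t else 0 else 0)"
      by (intro sum.cong) auto
    also have "\<dots> = lookup (lookup f i) u"
    proof (cases "i \<in> J")
      case True
      then show ?thesis using f assms finite_mons_of_ord[of "{..<m}" "{}" s]
        by (auto simp: fdeg_def gpols_of_ord_iff in_keys_iff subset_iff)
    next
      case False
      then have "lookup f i = 0" using f by (auto simp: fdeg_def in_keys_iff subset_iff)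
      then show ?thesis using False assms by simp
    qed
    finally show "lookup (lookup f i) u = lookup (lookup ?g i) u" by simp
  qed
  also have "?g \<in> fvs.span (fbasis m J s)"
    by (intro fvs.span_sum fvs.span_scale fvs.span_base) (auto simp: fbasis_def)
  finally show "f \<in> fvs.span (fbasis m J s)" .
qed

lemma fvs_dim_mono:
  assumes "finite J" "fvs.subspace W" "W \<subseteq> V" "fvs.subspace V" "V \<subseteq> fdeg m J s"
  shows "fvs.dim W \<le> fvs.dim V"
proof -
  have V: "V \<subseteq> fvs.span (fbasis m J s)" using assms fdeg_span by blast
  show ?thesis
    using fvs.quotient_basis_exists[OF assms(4) V finite_fbasis[OF assms(1)] assms(2,3)]
      fvs.quotient_basis_dim(2)[OF assms(4) V finite_fbasis[OF assms(1)] assms(2,3)] by auto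
qed

text \<open>
  The ring elements that carry a generator of degree \<open>d\<close> into degree \<open>s\<close>; below degree \<open>d\<close>
  truncated subtraction must not produce constants, hence the case distinction.
\<close>

definition multipliers :: "nat \<Rightarrow> nat \<Rightarrow> nat \<Rightarrow> ('a::field) gpol set" where
  "multipliers m d s = (if d \<le> s then gpols_of_ord m (s - d) else {0})"

text \<open>
  The part of degree \<open>s\<close> of the submodule generated by a list of pairs of a degree and an
  element of that degree. Recursion over the list mirrors the addition of generators; the head
  is the generator added last.
\<close>

primrec wspace :: "nat \<Rightarrow> ('a::field) gpol ring \<Rightarrow> (nat \<times> 'a fmod) list \<Rightarrow> nat \<Rightarrow> 'a fmod set" where
  "wspace m D [] s = {0}"
| "wspace m D (g # gs) s =
     {w + act D C (snd g) | w C. w \<in> wspace m D gs s \<and> C \<in> multipliers m (fst g) s}"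

lemma multipliers_subspace: "gvs.subspace (multipliers m d s)"
  by (simp add: multipliers_def subspace_gpols_of_ord)

lemma multipliers_subset: "multipliers m d s \<subseteq> gpols m"
  using gpols_of_ord_subset by (auto simp: multipliers_def gpols_def)

lemma zero_in_multipliers [simp]: "0 \<in> multipliers m d s"
  by (simp add: multipliers_def)

context graded_gen_poly_ring
begin

interpretation R: ring D by (rule ring)

lemma lin_ord: "linear_order_on (monomials m) r"
  using ranking by (simp add: ranking_def)

lemma mult_closed: "A \<in> gpols m \<Longrightarrow> B \<in> gpols m \<Longrightarrow> A \<otimes>\<^bsub>D\<^esub> B \<in> gpols m"
  using R.m_closed by (simp add: carrier)

lemma mult_zero_right: "A \<in> gpols m \<Longrightarrow> A \<otimes>\<^bsub>D\<^esub> 0 = 0"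
  using R.r_null by (simp add: carrier zero)

lemma mult_zero_left: "A \<in> gpols m \<Longrightarrow> 0 \<otimes>\<^bsub>D\<^esub> A = 0"
  using R.l_null by (simp add: carrier zero)

lemma mult_add_right:
  "A \<in> gpols m \<Longrightarrow> B \<in> gpols m \<Longrightarrow> C \<in> gpols m \<Longrightarrow> A \<otimes>\<^bsub>D\<^esub> (B + C) = A \<otimes>\<^bsub>D\<^esub> B + A \<otimes>\<^bsub>D\<^esub> C"
  using R.r_distr[of B C A] by (simp add: carrier add)

lemma mult_add_left:
  "A \<in> gpols m \<Longrightarrow> B \<in> gpols m \<Longrightarrow> C \<in> gpols m \<Longrightarrow> (A + B) \<otimes>\<^bsub>D\<^esub> C = A \<otimes>\<^bsub>D\<^esub> C + B \<otimes>\<^bsub>D\<^esub> C"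
  using R.l_distr[of A B C] by (simp add: carrier add)

lemma mult_assoc:
  "A \<in> gpols m \<Longrightarrow> B \<in> gpols m \<Longrightarrow> C \<in> gpols m \<Longrightarrow> (A \<otimes>\<^bsub>D\<^esub> B) \<otimes>\<^bsub>D\<^esub> C = A \<otimes>\<^bsub>D\<^esub> (B \<otimes>\<^bsub>D\<^esub> C)"
  using R.m_assoc[of A B C] by (simp add: carrier)

lemma single_in_gpols: "t \<in> monomials m \<Longrightarrow> single t c \<in> gpols m"
  by (simp add: gpols_def)

lemma zero_in_monomials: "0 \<in> monomials m"
  by (simp add: monomials_eq)

text \<open>
  By multiplicativity of the basis the monomial \<open>1\<close> is idempotent, and a nonzero idempotent is
  a left identity because there are no zero divisors.
\<close>

lemma mult_one_left:
  assumes "B \<in> gpols m" shows "single 0 1 \<otimes>\<^bsub>D\<^esub> B = B"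
proof (rule ccontr)
  let ?e = "single 0 1 :: 'a gpol"
  assume ne: "?e \<otimes>\<^bsub>D\<^esub> B \<noteq> B"
  have e: "?e \<in> gpols m" using single_in_gpols[OF zero_in_monomials] .
  have ee: "?e \<otimes>\<^bsub>D\<^esub> ?e = ?e" using mon_mult[OF zero_in_monomials zero_in_monomials] by simp
  have d: "?e \<otimes>\<^bsub>D\<^esub> B - B \<in> gpols m"
    using gvs.subspace_diff[OF subspace_gpols] mult_closed[OF e assms] assms by blast
  have "?e \<otimes>\<^bsub>D\<^esub> (?e \<otimes>\<^bsub>D\<^esub> B - B) + ?e \<otimes>\<^bsub>D\<^esub> B = ?e \<otimes>\<^bsub>D\<^esub> (?e \<otimes>\<^bsub>D\<^esub> B)"
    using mult_add_right[OF e d assms] by simp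
  also have "\<dots> = ?e \<otimes>\<^bsub>D\<^esub> B" using mult_assoc[OF e e assms] ee by simp
  finally have "?e \<otimes>\<^bsub>D\<^esub> (?e \<otimes>\<^bsub>D\<^esub> B - B) = 0" by simp
  moreover have "?e \<noteq> 0" by (metis lookup_single_eq lookup_zero zero_neq_one)
  ultimately show False using leader_mult[OF e d] ne by auto
qed

lemma mult_const: "B \<in> gpols m \<Longrightarrow> single 0 c \<otimes>\<^bsub>D\<^esub> B = gscale c B"
proof -
  assume B: "B \<in> gpols m"
  have "single 0 c = gscale c (single 0 1)"
    by (rule poly_mapping_eqI) (simp add: lookup_gscale lookup_single when_def del: single_one)
  then show ?thesis
    using scale_mult[OF single_in_gpols[OF zero_in_monomials] B, of c 1] mult_one_left[OF B] by simp
qed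

lemma lookup_act: "A \<in> gpols m \<Longrightarrow> lookup (act D A f) j = A \<otimes>\<^bsub>D\<^esub> lookup f j"
  by (simp add: act_def map.rep_eq when_def mult_zero_right)

lemma keys_act: "A \<in> gpols m \<Longrightarrow> keys (act D A f) \<subseteq> keys f"
  by (auto simp: in_keys_iff lookup_act mult_zero_right)

lemma lookup_fdeg: "f \<in> fdeg m J s \<Longrightarrow> lookup f j \<in> gpols_of_ord m s" "f \<in> fdeg m J s \<Longrightarrow> lookup f j \<in> gpols m"
  using gpols_of_ord_subset[of m s] by (auto simp: fdeg_def)

lemma lookup_free_mod: "f \<in> free_mod m n \<Longrightarrow> lookup f j \<in> gpols m"
proof (cases "j < n")
  case False
  assume "f \<in> free_mod m n"
  then have "lookup f j = 0" using False by (metis (mono_tags, lifting) free_mod_def in_keys_iff lessThan_iff mem_Collect_eq subsetD)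
  then show ?thesis by (simp add: gpols_def)
qed (simp add: free_mod_def)

lemma act_add_left:
  assumes "A \<in> gpols m" "B \<in> gpols m" "\<And>j. lookup f j \<in> gpols m"
  shows "act D (A + B) f = act D A f + act D B f"
  using assms gvs.subspace_add[OF subspace_gpols assms(1,2)]
  by (intro poly_mapping_eqI[of "act D (A + B) f"]) (simp add: lookup_act lookup_add mult_add_left)

lemma act_add_right:
  assumes "A \<in> gpols m" "\<And>j. lookup f j \<in> gpols m" "\<And>j. lookup g j \<in> gpols m"
  shows "act D A (f + g) = act D A f + act D A g"
  using assms
  by (intro poly_mapping_eqI[of "act D A (f + g)"]) (simp add: lookup_act lookup_add mult_add_right)

lemma act_scale:
  assumes "A \<in> gpols m" "\<And>j. lookup f j \<in> gpols m"
  shows "act D (gscale c A) f = fscale c (act D A f)"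
  using assms gvs.subspace_scale[OF subspace_gpols assms(1)]
  by (intro poly_mapping_eqI[of "act D (gscale c A) f"]) (simp add: lookup_act lookup_fscale scale_mult)

lemma act_assoc:
  assumes "A \<in> gpols m" "B \<in> gpols m" "\<And>j. lookup f j \<in> gpols m"
  shows "act D (A \<otimes>\<^bsub>D\<^esub> B) f = act D A (act D B f)"
  using assms
  by (intro poly_mapping_eqI[of "act D (A \<otimes>\<^bsub>D\<^esub> B) f"]) (simp add: lookup_act mult_assoc mult_closed)

lemma act_zero_left: "(\<And>j. lookup f j \<in> gpols m) \<Longrightarrow> act D 0 f = 0"
  by (intro poly_mapping_eqI[of "act D 0 f"]) (simp add: lookup_act mult_zero_left gpols_def)

lemma act_const: "(\<And>j. lookup f j \<in> gpols m) \<Longrightarrow> act D (single 0 c) f = fscale c f"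
  by (intro poly_mapping_eqI[of "act D (single 0 c) f"])
     (simp add: lookup_act lookup_fscale mult_const single_in_gpols zero_in_monomials)

lemma act_fdeg: "A \<in> gpols_of_ord m k \<Longrightarrow> f \<in> fdeg m J s \<Longrightarrow> act D A f \<in> fdeg m J (s + k)"
proof -
  assume A: "A \<in> gpols_of_ord m k" and f: "f \<in> fdeg m J s"
  have A': "A \<in> gpols m" using A gpols_of_ord_subset by blast
  have "A \<otimes>\<^bsub>D\<^esub> lookup f j \<in> gpols_of_ord m (s + k)" for j
    using graded[OF A lookup_fdeg(1)[OF f, of j]] by (simp only: add.commute)
  then show ?thesis using keys_act[OF A', of f] f by (auto simp: fdeg_def lookup_act[OF A'])
qed

text \<open>
  Multiplication by a monomial multiplies the leader, so the leaders form an up-set; in each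
  degree their number is the dimension.
\<close>

lemma graded_left_ideal_leaders:
  assumes K: "\<And>k. gvs.subspace (K k)" "\<And>k. K k \<subseteq> gpols_of_ord m k"
    and ideal: "\<And>A C k l. A \<in> gpols_of_ord m l \<Longrightarrow> C \<in> K k \<Longrightarrow> A \<otimes>\<^bsub>D\<^esub> C \<in> K (l + k)"
  defines "E \<equiv> {leader r C | k C. C \<in> K k \<and> C \<noteq> 0}"
  shows "up_set {..<m} E" "int (gvs.dim (K k)) = hcount {..<m} {} k - hcount {..<m} E k"
proof -
  have ldr: "leader r C \<in> keys C" "leader r C \<in> mons_of_ord {..<m} {} k" if "C \<in> K k" "C \<noteq> 0" for C k
  proof -
    have "keys C \<subseteq> mons_of_ord {..<m} {} k" using that K(2) gpols_of_ord_iff by blast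
    moreover from this have "keys C \<subseteq> monomials m" by (auto simp: mons_of_ord_def monomials_eq)
    ultimately show "leader r C \<in> keys C" "leader r C \<in> mons_of_ord {..<m} {} k"
      using leader_in_keys(1)[OF lin_ord] that by blast+
  qed
  show "up_set {..<m} E"
    unfolding up_set_def
  proof (intro conjI ballI)
    show "E \<subseteq> mons {..<m}" using ldr(2) by (force simp: E_def mons_of_ord_def)
  next
    fix t u assume "t \<in> E" and u: "u \<in> mons {..<m}"
    then obtain k C where C: "t = leader r C" "C \<in> K k" "C \<noteq> 0" by (auto simp: E_def)
    let ?A = "single u 1 :: 'a gpol"
    have A: "?A \<in> gpols_of_ord m (mon_ord u)" using u by (simp add: gpols_of_ord_iff mons_of_ord_def)
    have "?A \<noteq> 0" by (metis lookup_single_eq lookup_zero zero_neq_one)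
    moreover have "C \<in> gpols m" "?A \<in> gpols m" using C(2) K(2) A gpols_of_ord_subset by blast+
    moreover have "leader r ?A = u"
      using leader_in_keys(1)[OF lin_ord, of ?A] u \<open>?A \<noteq> 0\<close> by (simp add: monomials_eq)
    ultimately have "?A \<otimes>\<^bsub>D\<^esub> C \<noteq> 0" "leader r (?A \<otimes>\<^bsub>D\<^esub> C) = u + t"
      using leader_mult[of ?A C] C by auto
    then have "t + u = leader r (?A \<otimes>\<^bsub>D\<^esub> C)" by (simp only: add.commute)
    then show "t + u \<in> E" using ideal[OF A C(2)] \<open>?A \<otimes>\<^bsub>D\<^esub> C \<noteq> 0\<close> unfolding E_def by blast
  qed
  let ?M = "mons_of_ord {..<m} {} k"
  have "leader r ` (K k - {0}) = ?M - mons_of_ord {..<m} E k"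
  proof
    show "leader r ` (K k - {0}) \<subseteq> ?M - mons_of_ord {..<m} E k"
      using ldr(2) by (auto simp: E_def mons_of_ord_def)
    show "?M - mons_of_ord {..<m} E k \<subseteq> leader r ` (K k - {0})"
    proof
      fix t assume t: "t \<in> ?M - mons_of_ord {..<m} E k"
      then have "t \<in> E" by (auto simp: mons_of_ord_def)
      then obtain l C where C: "t = leader r C" "C \<in> K l" "C \<noteq> 0" by (auto simp: E_def)
      then have "l = k" using ldr(2)[OF C(2,3)] t by (auto simp: mons_of_ord_def)
      then show "t \<in> leader r ` (K k - {0})" using C by blast
    qed
  qed
  moreover have "gvs.dim (K k) = card (leader r ` (K k - {0}))"
  proof (rule gvs_dim_eq_card_leaders[OF lin_ord])
    show "?M \<subseteq> monomials m" by (auto simp: mons_of_ord_def monomials_eq)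
    show "keys p \<subseteq> ?M" if "p \<in> K k" for p using that K(2) gpols_of_ord_iff by blast
  qed (simp_all add: finite_mons_of_ord K)
  moreover have "mons_of_ord {..<m} E k \<subseteq> ?M" by (auto simp: mons_of_ord_def)
  ultimately show "int (gvs.dim (K k)) = hcount {..<m} {} k - hcount {..<m} E k"
    using card_Diff_subset[of "mons_of_ord {..<m} E k" ?M] card_mono[of ?M "mons_of_ord {..<m} E k"]
    by (simp add: finite_mons_of_ord hcount_def of_nat_diff)
qed

lemma dim_gpols_of_ord: "int (gvs.dim (gpols_of_ord m k :: 'a gpol set)) = hcount {..<m} {} k"
proof -
  let ?E = "{leader r C | k C. C \<in> (gpols_of_ord m k :: 'a gpol set) \<and> C \<noteq> 0}"
  have "t \<in> ?E" if "t \<in> mons {..<m}" for t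
  proof -
    let ?A = "single t 1 :: 'a gpol"
    have "?A \<in> gpols_of_ord m (mon_ord t)" using that by (simp add: gpols_of_ord_iff mons_of_ord_def)
    moreover have nz: "?A \<noteq> 0" by (metis lookup_single_eq lookup_zero zero_neq_one)
    moreover have "leader r ?A = t"
      using leader_in_keys(1)[OF lin_ord, of ?A] that nz by (simp add: monomials_eq)
    ultimately show ?thesis by force
  qed
  then have "mons_of_ord {..<m} ?E k = {}" unfolding mons_of_ord_def by blast
  then have "hcount {..<m} ?E k = 0" by (simp add: hcount_def)
  then show ?thesis
    using graded_left_ideal_leaders(2)[of "gpols_of_ord m" k, OF subspace_gpols_of_ord order.refl graded]
    by simp
qed

lemma gpols_of_ord_span:
  "gpols_of_ord m k \<subseteq> gvs.span ((\<lambda>t. single t 1) ` mons_of_ord {..<m} {} k)"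
  using gpol_in_span[OF finite_mons_of_ord[of "{..<m}"]] gpols_of_ord_iff by blast

lemma dim_fdeg: "finite J \<Longrightarrow> int (fvs.dim (fdeg m J s :: 'a fmod set)) = int (card J) * hcount {..<m} {} s"
proof (induction J rule: finite_induct)
  case empty
  have "fdeg m {} s = ({0} :: 'a fmod set)" by (auto simp: fdeg_def)
  moreover have "fvs.dim {0 :: 'a fmod} = 0" by (rule fvs.dim_unique[of "{}"]) (simp_all add: fvs.independent_empty)
  ultimately show ?case by simp
next
  case (insert j J)
  let ?U = "gpols_of_ord m s :: 'a gpol set" and ?W = "fdeg m J s :: 'a fmod set"
  let ?T = "(\<lambda>t. single t 1) ` mons_of_ord {..<m} {} s :: 'a gpol set"
  have fU: "single j ` ?U \<subseteq> fdeg m (insert j J) s"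
    by (auto simp: fdeg_def lookup_single when_def split: if_splits)
  have scl: "single j (gscale c x) = fscale c (single j x)" for c and x :: "'a gpol"
    by (rule poly_mapping_eqI) (simp add: lookup_fscale lookup_single when_def gscale_zero_right)
  have "int (fvs.dim {w + single j u | w u. w \<in> ?W \<and> u \<in> ?U}) - int (fvs.dim ?W) =
     int (gvs.dim ?U) - int (gvs.dim {u \<in> ?U. single j u \<in> ?W})"
  proof (rule dim_sum_image(1)[where TU = ?T and TV = "fbasis m (insert j J) s"])
    show "?W \<subseteq> fvs.span (fbasis m (insert j J) s)"
      using fdeg_span[of "insert j J" m s] fdeg_mono[of J "insert j J" m s] insert.hyps by blast
    show "single j ` ?U \<subseteq> fvs.span (fbasis m (insert j J) s)"
      using fdeg_span[of "insert j J" m s] fU insert.hyps by blast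
  qed (simp_all add: gvs.vector_space_axioms fvs.vector_space_axioms subspace_gpols_of_ord
      gpols_of_ord_span finite_mons_of_ord subspace_fdeg finite_fbasis insert.hyps single_add scl)
  moreover have "{u \<in> ?U. single j u \<in> ?W} = {0}"
    using insert.hyps by (auto simp: fdeg_def split: if_splits)
  moreover have "gvs.dim {0 :: 'a gpol} = 0" by (rule gvs.dim_unique[of "{}"]) (simp_all add: gvs.independent_empty)
  moreover have "{w + single j u | w u. w \<in> ?W \<and> u \<in> ?U} = fdeg m (insert j J) s" (is "?L = ?R")
  proof
    show "?L \<subseteq> ?R"
      using fvs.subspace_add[OF subspace_fdeg[of m "insert j J" s]] fU fdeg_mono[of J "insert j J" m s] by blast
    show "?R \<subseteq> ?L"
    proof
      fix f assume f: "f \<in> ?R"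
      let ?w = "Poly_Mapping.update j 0 f"
      have "f = ?w + single j (lookup f j)"
        by (rule poly_mapping_eqI) (simp add: lookup_add lookup_update lookup_single when_def)
      moreover have "?w \<in> ?W" using f by (auto simp: fdeg_def lookup_update keys_update)
      moreover have "lookup f j \<in> ?U" using f by (simp add: fdeg_def)
      ultimately show "f \<in> ?L" by blast
    qed
  qed
  ultimately show ?case
    using insert dim_gpols_of_ord[of s] by (simp add: algebra_simps)
qed

end

section \<open>Adding homogeneous generators one at a time\<close>

text \<open>
  The shape of the Hilbert function of a submodule up to an error of lower order: one shifted
  copy of \<open>p\<close> for each rank drop \<open>j \<in> J\<close>, caused by a generator of degree \<open>dg j\<close>, and a
  difference of two copies for each generator that leaves the rank unchanged.
\<close>

definition shift_sum :: "nat set \<Rightarrow> (nat \<Rightarrow> nat) \<Rightarrow> (nat \<times> nat) list \<Rightarrow> (nat \<Rightarrow> int) \<Rightarrow> nat \<Rightarrow> int" where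
  "shift_sum J dg ks p s =
     (\<Sum>j\<in>J. p (s - dg j)) + (\<Sum>(d, t)\<leftarrow>ks. p (s - d) - p (s - (d + t)))"

lemma shift_sum_one: "shift_sum J dg ks (\<lambda>_. 1) s = int (card J)"
  by (simp add: shift_sum_def split_def)

lemma shift_bounds:
  fixes dg :: "nat \<Rightarrow> nat" and ks :: "(nat \<times> nat) list"
  assumes "finite J" "s \<ge> (\<Sum>j\<in>J. dg j) + (\<Sum>(d, t)\<leftarrow>ks. d + t)"
  shows "j \<in> J \<Longrightarrow> dg j \<le> s" "(d, t) \<in> set ks \<Longrightarrow> d + t \<le> s"
proof -
  show "dg j \<le> s" if "j \<in> J" using member_le_sum[of j J dg] that assms by simp
  show "d + t \<le> s" if "(d, t) \<in> set ks"
    using member_le_sum_list[of "d + t" "map (\<lambda>(d, t). d + t) ks"] that assms(2) by force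
qed

lemma fdiff_pow_shift_sum:
  assumes "finite J"
  shows "\<forall>\<^sub>F s in sequentially. (fdiff ^^ k) (shift_sum J dg ks (binom_fun (k + i))) s =
    shift_sum J dg ks (\<lambda>x. binom_fun i (x + k)) s"
  using eventually_ge_at_top[of "(\<Sum>j\<in>J. dg j) + (\<Sum>(d, t)\<leftarrow>ks. d + t)"]
proof eventually_elim
  case (elim s)
  have sh: "(fdiff ^^ k) (\<lambda>s. binom_fun (k + i) (s - a)) s = binom_fun i (s - a + k)" if "a \<le> s" for a
    using that by (simp add: fdiff_pow_shift_back fdiff_pow_binom)
  have "(fdiff ^^ k) (shift_sum J dg ks (binom_fun (k + i))) s =
     (\<Sum>j\<in>J. (fdiff ^^ k) (\<lambda>s. binom_fun (k + i) (s - dg j)) s) +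
     (\<Sum>dt\<leftarrow>ks. (fdiff ^^ k) (\<lambda>s. binom_fun (k + i) (s - fst dt) - binom_fun (k + i) (s - (fst dt + snd dt))) s)"
    unfolding shift_sum_def[abs_def] fdiff_pow_add fdiff_pow_sum case_prod_beta fdiff_pow_sum_list ..
  also have "\<dots> = (\<Sum>j\<in>J. binom_fun i (s - dg j + k)) +
     (\<Sum>dt\<leftarrow>ks. binom_fun i (s - fst dt + k) - binom_fun i (s - (fst dt + snd dt) + k))"
  proof (intro arg_cong2[of _ _ _ _ plus] sum.cong refl arg_cong[of _ _ sum_list] map_cong)
    fix j assume "j \<in> J"
    then show "(fdiff ^^ k) (\<lambda>s. binom_fun (k + i) (s - dg j)) s = binom_fun i (s - dg j + k)"
      using shift_bounds(1)[OF assms elim] by (intro sh) auto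
  next
    fix dt assume "dt \<in> set ks"
    then have "fst dt + snd dt \<le> s" using shift_bounds(2)[OF assms elim, of "fst dt" "snd dt"] by simp
    then show "(fdiff ^^ k) (\<lambda>s. binom_fun (k + i) (s - fst dt) - binom_fun (k + i) (s - (fst dt + snd dt))) s =
        binom_fun i (s - fst dt + k) - binom_fun i (s - (fst dt + snd dt) + k)"
      unfolding fdiff_pow_diff by (simp only: sh add_leD1)
  qed
  also have "\<dots> = shift_sum J dg ks (\<lambda>x. binom_fun i (x + k)) s"
    by (simp add: shift_sum_def split_def)
  finally show ?case .
qed

lemma numpoly_const_lead:
  assumes "numpoly d u" "d \<le> k"
  shows "\<forall>\<^sub>F s in sequentially. (fdiff ^^ k) u s = 0"
  using numpoly_mono[OF assms] by (simp add: numpoly_def)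

context graded_gen_poly_ring
begin

text \<open>
  Rank-nullity for \<open>C \<mapsto> C h\<close>.
\<close>

lemma wspace_step:
  assumes J: "finite J" and h: "h \<in> fdeg m J d" 
    and W: "\<And>s. fvs.subspace (wspace m D gs s)" "\<And>s. wspace m D gs s \<subseteq> fdeg m J s"
  shows "fvs.subspace (wspace m D ((d, h) # gs) s)" "wspace m D ((d, h) # gs) s \<subseteq> fdeg m J s"
    "int (fvs.dim (wspace m D ((d, h) # gs) s)) - int (fvs.dim (wspace m D gs s)) =
       int (gvs.dim (multipliers m d s :: 'a gpol set)) - int (gvs.dim {C \<in> multipliers m d s. act D C h \<in> wspace m D gs s})"
    "gvs.subspace {C \<in> multipliers m d s. act D C h \<in> wspace m D gs s}"
proof -
  let ?U = "multipliers m d s :: 'a gpol set" and ?W = "wspace m D gs s" and ?f = "\<lambda>C. act D C h"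
  let ?TU = "(\<lambda>t. single t 1) ` mons_of_ord {..<m} {} (s - d) :: 'a gpol set"
  have hg: "lookup h j \<in> gpols m" for j using lookup_fdeg(2)[OF h] .
  have Ug: "C \<in> gpols m" if "C \<in> ?U" for C using that multipliers_subset by blast
  have fU: "?f ` ?U \<subseteq> fdeg m J s"
  proof
    fix x assume "x \<in> ?f ` ?U"
    then obtain C where C: "C \<in> ?U" "x = act D C h" by blast
    show "x \<in> fdeg m J s"
    proof (cases "d \<le> s")
      case True
      then show ?thesis using C act_fdeg[OF _ h, of C "s - d"] by (simp add: multipliers_def)
    next
      case False
      then show ?thesis using C act_zero_left[OF hg] fvs.subspace_0[OF subspace_fdeg] by (simp add: multipliers_def)
    qed
  qed
  have "fdeg m J s \<subseteq> fvs.span (fbasis m J s)" using fdeg_span[OF J] .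
  have 1: "?U \<subseteq> gvs.span ?TU"
    using gpols_of_ord_span gvs.span_zero by (auto simp: multipliers_def)
  note * = dim_sum_image[where U = ?U and W = ?W and f = ?f and TU = ?TU and TV = "fbasis m J s",
      OF gvs.vector_space_axioms fvs.vector_space_axioms multipliers_subspace 1 _ W(1) _ _
        finite_fbasis[OF J] act_add_left[OF Ug Ug hg] act_scale[OF Ug hg]]
  have 2: "finite ?TU" by (simp add: finite_mons_of_ord)
  have 3: "?W \<subseteq> fvs.span (fbasis m J s)" "?f ` ?U \<subseteq> fvs.span (fbasis m J s)"
    using W(2) fU fdeg_span[OF J] by blast+
  have eq: "wspace m D ((d, h) # gs) s = {w + act D C h |w C. w \<in> ?W \<and> C \<in> ?U}" by simp
  show "int (fvs.dim (wspace m D ((d, h) # gs) s)) - int (fvs.dim (wspace m D gs s)) =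
       int (gvs.dim ?U) - int (gvs.dim {C \<in> ?U. act D C h \<in> ?W})"
    unfolding eq by (rule *(1)[OF 2 3])
  show "fvs.subspace (wspace m D ((d, h) # gs) s)" unfolding eq by (rule *(2)[OF 2 3])
  show "gvs.subspace {C \<in> ?U. act D C h \<in> ?W}" by (rule *(3)[OF 2 3])
  show "wspace m D ((d, h) # gs) s \<subseteq> fdeg m J s"
    unfolding eq using W(2)[of s] fU fvs.subspace_add[OF subspace_fdeg[of m J s]] by blast
qed

lemma wspace_subspace:
  assumes "finite J" "\<And>d h. (d, h) \<in> set gs \<Longrightarrow> h \<in> fdeg m J d"
  shows "fvs.subspace (wspace m D gs s) \<and> wspace m D gs s \<subseteq> fdeg m J s"
  using assms(2)
proof (induction gs arbitrary: s)
  case Nil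
  then show ?case using fvs.subspace_0[OF subspace_fdeg] by simp
next
  case (Cons g gs)
  obtain d h where g: "g = (d, h)" by force
  have "h \<in> fdeg m J d" using Cons.prems g by simp
  moreover have "fvs.subspace (wspace m D gs s) \<and> wspace m D gs s \<subseteq> fdeg m J s" for s
    by (rule Cons.IH) (use Cons.prems in auto)
  ultimately show ?case unfolding g
    using wspace_step(1,2)[OF assms(1), of h d gs s] by blast
qed

lemma wspace_act:
  assumes "finite J" "\<And>d h. (d, h) \<in> set gs \<Longrightarrow> h \<in> fdeg m J d"
    and A: "A \<in> gpols_of_ord m k" and x: "x \<in> wspace m D gs s"
  shows "act D A x \<in> wspace m D gs (s + k)"
  using assms(2) x
proof (induction gs arbitrary: x)
  case Nil
  have "A \<in> gpols m" using A gpols_of_ord_subset by blast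
  then have "act D A 0 = 0"
    by (intro poly_mapping_eqI[of "act D A 0"]) (simp add: lookup_act mult_zero_right)
  then show ?case using Nil by simp
next
  case (Cons g gs)
  obtain d h where g: "g = (d, h)" by force
  have A': "A \<in> gpols m" using A gpols_of_ord_subset by blast
  have hJ: "h \<in> fdeg m J d" using Cons.prems(1) g by simp
  have hg: "lookup h j \<in> gpols m" for j using lookup_fdeg(2)[OF hJ] .
  obtain w C where w: "x = w + act D C h" "w \<in> wspace m D gs s" "C \<in> multipliers m d s"
    using Cons.prems(2) g by auto
  have C': "C \<in> gpols m" using w(3) multipliers_subset by blast
  have wJ: "w \<in> fdeg m J s" using wspace_subspace[OF assms(1), of gs] Cons.prems(1) w(2) by auto
  have "A \<otimes>\<^bsub>D\<^esub> C \<in> multipliers m d (s + k)"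
  proof (cases "d \<le> s")
    case True
    then have "k + (s - d) = s + k - d" by simp
    then show ?thesis using True w(3) graded[OF A, of C "s - d"] by (simp add: multipliers_def)
  next
    case False
    then show ?thesis using w(3) mult_zero_right[OF A'] by (simp add: multipliers_def)
  qed
  moreover have "act D A x = act D A w + act D (A \<otimes>\<^bsub>D\<^esub> C) h"
    using act_assoc[OF A' C' hg] act_add_right[OF A' lookup_fdeg(2)[OF wJ], of "act D C h"] w(1)
      mult_closed[OF C' hg] by (simp add: lookup_act[OF C'])
  moreover have "act D A w \<in> wspace m D gs (s + k)"
    by (rule Cons.IH) (use Cons.prems(1) w(2) in auto)
  ultimately show ?case unfolding g by auto
qed

text \<open>
  The up-set \<open>E\<close> consists of the leaders of the left ideal of all \<open>C\<close> with \<open>C h\<close> in the submodule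
  generated so far.
\<close>

lemma wspace_dim_step:
  assumes J: "finite J" and gs: "\<And>d' h'. (d', h') \<in> set ((d, h) # gs) \<Longrightarrow> h' \<in> fdeg m J d'"
  obtains E where "up_set {..<m} E"
    "\<And>s. s \<ge> d \<Longrightarrow> int (fvs.dim (wspace m D ((d, h) # gs) s)) =
       int (fvs.dim (wspace m D gs s)) + hcount {..<m} E (s - d)"
proof -
  have h: "h \<in> fdeg m J d" using gs by simp
  have hg: "lookup h j \<in> gpols m" for j using lookup_fdeg(2)[OF h] .
  have gs': "\<And>d' h'. (d', h') \<in> set gs \<Longrightarrow> h' \<in> fdeg m J d'" using gs by simp
  have W: "\<And>s. fvs.subspace (wspace m D gs s)" "\<And>s. wspace m D gs s \<subseteq> fdeg m J s"
    using wspace_subspace[OF J gs'] by auto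
  define K where "K k = {C \<in> gpols_of_ord m k. act D C h \<in> wspace m D gs (k + d)}" for k
  have mult: "multipliers m d (k + d) = gpols_of_ord m k" for k by (simp add: multipliers_def)
  have K1: "gvs.subspace (K k)" for k
    using wspace_step(4)[OF J h W, of "k + d"] by (simp add: K_def mult)
  have K2: "K k \<subseteq> gpols_of_ord m k" for k by (auto simp: K_def)
  have K3: "A \<otimes>\<^bsub>D\<^esub> C \<in> K (l + k)" if A: "A \<in> gpols_of_ord m l" and C: "C \<in> K k" for A C k l
  proof -
    have "act D (A \<otimes>\<^bsub>D\<^esub> C) h = act D A (act D C h)"
      using A C gpols_of_ord_subset hg by (intro act_assoc) (auto simp: K_def)
    moreover have "act D A (act D C h) \<in> wspace m D gs (k + d + l)"
      using C by (intro wspace_act[OF J gs' A]) (auto simp: K_def)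
    ultimately show ?thesis using graded[OF A, of C k] C by (simp add: K_def add_ac)
  qed
  let ?E = "{leader r C | k C. C \<in> K k \<and> C \<noteq> 0}"
  show ?thesis
  proof (rule that)
    show "up_set {..<m} ?E" by (rule graded_left_ideal_leaders(1)[OF K1 K2 K3])
    fix s assume "s \<ge> d"
    then obtain k where k: "s = k + d" by (metis le_add_diff_inverse2)
    have "int (gvs.dim (K k)) = hcount {..<m} {} k - hcount {..<m} ?E k"
      by (rule graded_left_ideal_leaders(2)[OF K1 K2 K3])
    then show "int (fvs.dim (wspace m D ((d, h) # gs) s)) =
       int (fvs.dim (wspace m D gs s)) + hcount {..<m} ?E (s - d)"
      using wspace_step(3)[OF J h W, of s] dim_gpols_of_ord[of k] by (simp add: k mult K_def)
  qed
qed

text \<open>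
  In a list sorted by degree the head has the smallest degree, so when it is added all generators
  involve only the columns in \<open>C = {j. d \<le> e j}\<close>. If the rank drops, comparing leading
  coefficients with the free module on \<open>C\<close> shows that \<open>J\<close> does not exhaust \<open>C\<close>.
\<close>

lemma wspace_hilbert:
  assumes m: "m = Suc k"
    and gs: "\<And>d h. (d, h) \<in> set gs \<Longrightarrow> h \<in> fdeg m {j. j < n \<and> d \<le> e j} d"
    and sorted: "sorted (map fst gs)"
  shows "\<exists>J dg ks u. J \<subseteq> {..<n} \<and> (\<forall>j\<in>J. dg j \<le> e j) \<and> fst ` set ks \<subseteq> fst ` set gs \<and>
     numpoly (m - 2) u \<and> (\<forall>s. 0 \<le> u s) \<and>
     (\<forall>\<^sub>F s in sequentially. int (fvs.dim (wspace m D gs s)) = shift_sum J dg ks (binom_fun k) s + u s)"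
  using gs sorted
proof (induction gs)
  case Nil
  have "fvs.dim {0 :: 'a fmod} = 0" by (rule fvs.dim_unique[of "{}"]) (simp_all add: fvs.independent_empty)
  then show ?case
    by (intro exI[of _ "{}"] exI[of _ "[]"] exI[of _ "\<lambda>_. 0"]) (simp add: numpoly_zero shift_sum_def)
next
  case (Cons g gs)
  obtain d h where g: "g = (d, h)" by force
  obtain J dg ks u where J: "J \<subseteq> {..<n}" "\<forall>j\<in>J. dg j \<le> e j" and ks: "fst ` set ks \<subseteq> fst ` set gs"
    and u: "numpoly (m - 2) u" "\<forall>s. 0 \<le> u s"
    and dim: "\<forall>\<^sub>F s in sequentially. int (fvs.dim (wspace m D gs s)) = shift_sum J dg ks (binom_fun k) s + u s"
    using Cons.IH Cons.prems by auto
  have finJ: "finite J" using J(1) finite_subset by blast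
  define C where "C = {j. j < n \<and> d \<le> e j}"
  have finC: "finite C" by (simp add: C_def)
  have gC: "h' \<in> fdeg m C d'" if "(d', h') \<in> set (g # gs)" for d' h'
  proof -
    have "d \<le> d'" using that Cons.prems(2) g by force
    then have "{j. j < n \<and> d' \<le> e j} \<subseteq> C" by (auto simp: C_def)
    then show ?thesis using Cons.prems(1)[OF that] fdeg_mono by blast
  qed
  obtain E where E: "up_set {..<m} E"
    "\<And>s. s \<ge> d \<Longrightarrow> int (fvs.dim (wspace m D (g # gs) s)) = int (fvs.dim (wspace m D gs s)) + hcount {..<m} E (s - d)"
    using wspace_dim_step[OF finC, of d h gs] gC unfolding g by metis
  have P: "hcount {..<m} {} = binom_fun k" using hcount_all m by auto
  have dim': "\<forall>\<^sub>F s in sequentially. int (fvs.dim (wspace m D (g # gs) s)) =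
      shift_sum J dg ks (binom_fun k) s + u s + hcount {..<m} E (s - d)"
    using dim eventually_ge_at_top[of d] by eventually_elim (simp only: E(2))
  show ?case
  proof (cases "E = {}")
    case True
    \<comment> \<open>the submodule has rank \<open>card J + 1\<close> inside a free module of rank \<open>card C\<close>\<close>
    have "card J < card C"
    proof -
      have le: "int (fvs.dim (wspace m D (g # gs) s)) \<le> int (card C) * binom_fun k s" for s
        using fvs_dim_mono[OF finC _ _ subspace_fdeg order.refl, of "wspace m D (g # gs) s" m s]
          wspace_subspace[of C "g # gs", OF finC gC] dim_fdeg[OF finC, of s] P
        by (simp del: wspace.simps)
      let ?f = "\<lambda>s. int (card C) * binom_fun k s - (shift_sum J dg ks (binom_fun k) s + u s + binom_fun k (s - d))"
      have "\<forall>\<^sub>F s in sequentially. 0 \<le> ?f s"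
        using dim'
      proof eventually_elim
        case (elim s)
        then show ?case using le[of s] by (simp add: True P del: wspace.simps)
      qed
      moreover have "\<forall>\<^sub>F s in sequentially. (fdiff ^^ k) u s = 0"
        using numpoly_const_lead[OF u(1), of k] m by simp
      then have "\<forall>\<^sub>F s in sequentially. (fdiff ^^ k) ?f s = int (card C) - int (card J) - 1"
        using fdiff_pow_shift_sum[OF finJ, of k dg ks 0] eventually_ge_at_top[of d]
      proof eventually_elim
        case (elim s)
        have "(fdiff ^^ k) (binom_fun k) s = 1" for s using fdiff_pow_binom[of k 0] by simp
        then show ?case using elim
          by (simp add: fdiff_pow_diff fdiff_pow_cmult fdiff_pow_add fdiff_pow_shift_back shift_sum_one)
      qed
      ultimately have "0 \<le> int (card C) - int (card J) - 1" by (rule fdiff_pow_nonneg)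
      then show ?thesis by simp
    qed
    then obtain j where j: "j \<in> C" "j \<notin> J" using card_mono[OF finJ, of C] by (meson not_le subsetI)
    have "shift_sum (insert j J) (dg(j := d)) ks p s = shift_sum J dg ks p s + p (s - d)" for p s
    proof -
      have "(\<Sum>i\<in>J. p (s - (dg(j := d)) i)) = (\<Sum>i\<in>J. p (s - dg i))" using j(2) by (intro sum.cong) auto
      then show ?thesis using finJ j(2) by (simp add: shift_sum_def)
    qed
    then have "\<forall>\<^sub>F s in sequentially. int (fvs.dim (wspace m D (g # gs) s)) =
        shift_sum (insert j J) (dg(j := d)) ks (binom_fun k) s + u s"
      using dim' by (auto simp: True P add_ac)
    moreover have "\<forall>i\<in>insert j J. (dg(j := d)) i \<le> e i" using J j by (auto simp: C_def)
    moreover have "insert j J \<subseteq> {..<n}" "fst ` set ks \<subseteq> fst ` set (g # gs)"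
      using J j ks by (auto simp: C_def)
    ultimately show ?thesis using u by blast
  next
    case False
    obtain t v where v: "numpoly (m - 2) v" "\<And>s. 0 \<le> v s"
      "\<forall>\<^sub>F s in sequentially. hcount {..<m} E s = hcount {..<m} {} s - hcount {..<m} {} (s - t) + v s"
      using hcount_gcd[OF finite_lessThan E(1) False] unfolding card_lessThan by blast
    have "\<forall>\<^sub>F s in sequentially. int (fvs.dim (wspace m D (g # gs) s)) =
        shift_sum J dg ((d, t) # ks) (binom_fun k) s + (u s + v (s - d))"
      using dim' eventually_shift_back[OF v(3), of d]
      by eventually_elim (simp add: P shift_sum_def)
    moreover have "numpoly (m - 2) (\<lambda>s. u s + v (s - d))"
      by (intro numpoly_add u(1) numpoly_shift_back v(1))
    moreover have "fst ` set ((d, t) # ks) \<subseteq> fst ` set (g # gs)" using ks g by auto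
    moreover have "\<forall>s. 0 \<le> u s + v (s - d)" using u(2) v(2) by simp
    ultimately show ?thesis using J by blast
  qed
qed

end

section \<open>The submodule generated by a homogeneous system\<close>

lemma subspace_free_mod: "fvs.subspace (free_mod m n)"
proof (rule fvs.subspaceI)
  fix x y :: "'a fmod" assume "x \<in> free_mod m n" "y \<in> free_mod m n"
  then show "x + y \<in> free_mod m n"
    using keys_add[of x y] by (auto simp: free_mod_def lookup_add intro: gvs.subspace_add[OF subspace_gpols])
qed (auto simp: free_mod_def lookup_fscale in_keys_iff subset_iff gscale_zero_right
    gvs.subspace_0[OF subspace_gpols] intro: gvs.subspace_scale[OF subspace_gpols])

lemma lookup_gpols_of_ord: "p \<in> gpols_of_ord m s \<Longrightarrow> mon_ord t \<noteq> s \<Longrightarrow> lookup p t = 0"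
proof -
  assume "p \<in> gpols_of_ord m s" "mon_ord t \<noteq> s"
  then have "t \<notin> keys p" by (auto simp: gpols_of_ord_def)
  then show ?thesis by (simp add: in_keys_iff)
qed

lemma gpol_expansion: "g = (\<Sum>t\<in>keys g. single t (lookup g t))"
proof (rule poly_mapping_eqI)
  fix u
  have "lookup (\<Sum>t\<in>keys g. single t (lookup g t)) u = (\<Sum>t\<in>keys g. if t = u then lookup g t else 0)"
    unfolding lookup_sum by (intro sum.cong) (auto simp: lookup_single)
  then show "lookup g u = lookup (\<Sum>t\<in>keys g. single t (lookup g t)) u"
    by (auto simp: in_keys_iff)
qed

lemma numpoly_binom: "numpoly (Suc k) (binom_fun k)"
  unfolding numpoly_def by (intro always_eventually allI fdiff_pow_binom_less) simp

lemma numpoly_cmult: "numpoly d f \<Longrightarrow> numpoly d (\<lambda>s. c * f s)"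
  unfolding numpoly_def fdiff_pow_cmult by (erule eventually_mono) simp

lemma numpoly_shift_sum: "numpoly d p \<Longrightarrow> numpoly d (shift_sum J dg ks p)"
proof -
  assume p: "numpoly d p"
  have "numpoly d (\<lambda>s. \<Sum>(d, t)\<leftarrow>ks. p (s - d) - p (s - (d + t)))"
    by (induction ks) (auto intro!: numpoly_zero numpoly_add numpoly_diff numpoly_shift_back p)
  then show ?thesis unfolding shift_sum_def[abs_def]
    by (intro numpoly_add numpoly_sum numpoly_shift_back p)
qed

context graded_gen_poly_ring
begin

lemma wspace_mono:
  assumes "\<And>j. lookup (snd g) j \<in> gpols m"
  shows "wspace m D gs s \<subseteq> wspace m D (g # gs) s"
proof
  fix w assume "w \<in> wspace m D gs s"
  moreover have "w = w + act D 0 (snd g)" using act_zero_left[OF assms] by simp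
  ultimately show "w \<in> wspace m D (g # gs) s" unfolding wspace.simps using zero_in_multipliers by blast
qed

lemma generator_in_wspace:
  assumes J: "finite J" and "\<And>d h. (d, h) \<in> set gs \<Longrightarrow> h \<in> fdeg m J d" "(d, h) \<in> set gs"
  shows "h \<in> wspace m D gs d"
  using assms(2-)
proof (induction gs)
  case (Cons g gs)
  have gg: "lookup (snd g) j \<in> gpols m" for j
    using Cons.prems(1)[of "fst g" "snd g"] lookup_fdeg(2) by force
  show ?case
  proof (cases "g = (d, h)")
    case True
    have "h = 0 + act D (single 0 1) h"
      using act_const[of h 1] gg True by simp
    moreover have "fvs.subspace (wspace m D gs d)"
      using wspace_subspace[OF J, of gs] Cons.prems(1) by auto
    then have "0 \<in> wspace m D gs d" by (rule fvs.subspace_0)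
    moreover have "single 0 1 \<in> (multipliers m d d :: 'a gpol set)"
      by (simp add: multipliers_def gpols_of_ord_iff mons_of_ord_def del: single_one)
    ultimately show ?thesis unfolding True wspace.simps fst_conv snd_conv by blast
  next
    case False
    then have "h \<in> wspace m D gs d" using Cons by auto
    then show ?thesis using wspace_mono[OF gg] by blast
  qed
qed simp

text \<open>
  The span of all pieces \<open>wspace m D gs s\<close> is a submodule containing \<open>S\<close>, and comparing the
  components of order \<open>s\<close> shows that it meets degree \<open>s\<close> only in \<open>wspace m D gs s\<close>.
\<close>

lemma submodule_gen_deg:
  assumes gs: "\<And>d h. (d, h) \<in> set gs \<Longrightarrow> h \<in> S \<and> h \<in> fdeg m {..<n} d"
    and cover: "\<And>h. h \<in> S \<Longrightarrow> \<exists>d. h \<in> wspace m D gs d"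
  shows "submodule_gen m n D S \<inter> free_mod_deg m n s = wspace m D gs s"
proof -
  have gs': "\<And>d h. (d, h) \<in> set gs \<Longrightarrow> h \<in> fdeg m {..<n} d" using gs by blast
  have W: "fvs.subspace (wspace m D gs s)" "wspace m D gs s \<subseteq> fdeg m {..<n} s" for s
    using wspace_subspace[OF _ gs'] by auto
  let ?U = "\<Union>s. wspace m D gs s"
  let ?N = "fvs.span ?U"
  have Nfree: "?N \<subseteq> free_mod m n"
    using W(2) fdeg_subset_free_mod[of "{..<n}" n] by (intro fvs.span_minimal subspace_free_mod) blast
  have hom: "act D A z \<in> ?N" if A: "A \<in> gpols m" and z: "z \<in> wspace m D gs s" for A z s
  proof -
    have zg: "lookup z j \<in> gpols m" for j using lookup_fdeg(2) W(2) z by blast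
    have "act D (\<Sum>t\<in>T. single t (lookup A t)) z \<in> ?N \<and> (\<Sum>t\<in>T. single t (lookup A t)) \<in> gpols m"
      if "finite T" "T \<subseteq> monomials m" for T
      using that
    proof (induction T rule: finite_induct)
      case empty
      then show ?case using act_zero_left[OF zg] fvs.span_zero by (simp add: gpols_def)
    next
      case (insert t T)
      have t: "single t (lookup A t) \<in> gpols_of_ord m (mon_ord t)"
        using insert.prems by (auto simp: gpols_of_ord_iff mons_of_ord_def monomials_eq)
      then have t': "single t (lookup A t) \<in> gpols m" using gpols_of_ord_subset by blast
      have "act D (single t (lookup A t)) z \<in> ?N"
        using wspace_act[OF _ gs' t z] by (intro fvs.span_base) auto
      then show ?case
        using insert act_add_left[OF t' _ zg] fvs.span_add gvs.subspace_add[OF subspace_gpols t'] by auto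
    qed
    moreover have "keys A \<subseteq> monomials m" using A by (simp add: gpols_def)
    ultimately show ?thesis using gpol_expansion[of A] finite_keys by metis
  qed
  have "left_submodule m n D ?N"
    unfolding left_submodule_def
  proof (intro conjI ballI Nfree fvs.span_zero fvs.span_add)
    fix A x assume "A \<in> carrier D" and x: "x \<in> ?N"
    then have A: "A \<in> gpols m" by (simp add: carrier)
    from x have "x \<in> ?N \<and> act D A x \<in> ?N"
    proof (induction rule: fvs.span_induct_alt)
      case base
      have "act D A 0 = 0"
        by (intro poly_mapping_eqI[of "act D A 0"]) (simp add: lookup_act[OF A] mult_zero_right[OF A])
      then show ?case by (simp add: fvs.span_zero)
    next
      case (step c a y)
      then obtain s where a: "a \<in> wspace m D gs s" by blast
      have ca: "fscale c a \<in> wspace m D gs s" using a fvs.subspace_scale[OF W(1)] by blast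
      then have caN: "fscale c a \<in> ?N" by (intro fvs.span_base) blast
      have "act D A (fscale c a + y) = act D A (fscale c a) + act D A y"
        using caN step Nfree lookup_free_mod by (intro act_add_right[OF A]) blast+
      then show ?case using hom[OF A ca] caN step fvs.span_add by auto
    qed
    then show "act D A x \<in> ?N" by simp
  qed auto
  moreover have "S \<subseteq> ?N" using cover fvs.span_base by blast
  ultimately have sub: "submodule_gen m n D S \<subseteq> ?N"
    unfolding submodule_gen_def by (simp add: hull_minimal)
  \<comment> \<open>the component of order \<open>s\<close> of an element of the span\<close>
  have agree: "\<exists>y\<in>wspace m D gs s. \<forall>j t. mon_ord t = s \<longrightarrow> lookup (lookup x j) t = lookup (lookup y j) t"
    if "x \<in> ?N" for x
    using that
  proof (induction rule: fvs.span_induct_alt)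
    case base
    then show ?case using fvs.subspace_0[OF W(1)] by blast
  next
    case (step c a y)
    then obtain l where a: "a \<in> wspace m D gs l" by blast
    obtain z where z: "z \<in> wspace m D gs s"
      "\<forall>j t. mon_ord t = s \<longrightarrow> lookup (lookup y j) t = lookup (lookup z j) t" using step by blast
    show ?case
    proof (cases "l = s")
      case True
      then have "fscale c a + z \<in> wspace m D gs s"
        using a z(1) fvs.subspace_add[OF W(1)] fvs.subspace_scale[OF W(1)] by blast
      then show ?thesis using z(2) by (intro bexI[of _ "fscale c a + z"]) (auto simp: lookup_add)
    next
      case False
      have "lookup (lookup a j) t = 0" if "mon_ord t = s" for j t
      proof -
        have "lookup a j \<in> gpols_of_ord m l" using a W(2) lookup_fdeg(1) by blast
        then show ?thesis using False that lookup_gpols_of_ord[of "lookup a j" m l t] by simp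
      qed
      then show ?thesis using z by (intro bexI[of _ z]) (auto simp: lookup_add lookup_fscale lookup_gscale)
    qed
  qed
  show ?thesis
  proof
    show "submodule_gen m n D S \<inter> free_mod_deg m n s \<subseteq> wspace m D gs s"
    proof
      fix x assume x: "x \<in> submodule_gen m n D S \<inter> free_mod_deg m n s"
      then have xs: "x \<in> fdeg m {..<n} s" by (simp add: free_mod_deg_eq)
      obtain y where y: "y \<in> wspace m D gs s"
        "\<forall>j t. mon_ord t = s \<longrightarrow> lookup (lookup x j) t = lookup (lookup y j) t"
        using agree sub x by blast
      have "x = y"
      proof (rule poly_mapping_eqI, rule poly_mapping_eqI)
        fix j t
        have "lookup x j \<in> gpols_of_ord m s" "lookup y j \<in> gpols_of_ord m s"
          using xs y(1) W(2) lookup_fdeg(1) by blast+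
        then show "lookup (lookup x j) t = lookup (lookup y j) t"
          using y(2) lookup_gpols_of_ord[of "lookup x j" m s t] lookup_gpols_of_ord[of "lookup y j" m s t]
          by (cases "mon_ord t = s") auto
      qed
      then show "x \<in> wspace m D gs s" using y by simp
    qed
    have "wspace m D gs s \<subseteq> N" if N: "left_submodule m n D N" "S \<subseteq> N" for N
      using gs
    proof (induction gs)
      case Nil
      then show ?case using N by (simp add: left_submodule_def)
    next
      case (Cons g gs)
      have "wspace m D gs s \<subseteq> N" using Cons by auto
      moreover have "act D C (snd g) \<in> N" if "C \<in> multipliers m (fst g) s" for C
      proof -
        have "C \<in> gpols m" using that multipliers_subset by blast
        moreover have "snd g \<in> N" using N(2) Cons.prems[of "fst g" "snd g"] by auto
        ultimately show ?thesis using N(1) by (simp add: left_submodule_def carrier)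
      qed
      ultimately show ?case using N(1) by (auto simp: left_submodule_def)
    qed
    then have "wspace m D gs s \<subseteq> submodule_gen m n D S"
      by (auto simp: submodule_gen_def hull_def)
    then show "wspace m D gs s \<subseteq> submodule_gen m n D S \<inter> free_mod_deg m n s"
      using W(2) by (auto simp: free_mod_deg_eq)
  qed
qed

lemma degree_le_bound:
  assumes h: "h \<in> fdeg m {..<n} d" and e: "\<forall>j<n. ord_at j h \<le> ereal (real (e j))"
  shows "h \<in> fdeg m {j. j < n \<and> d \<le> e j} d"
proof -
  have "d \<le> e j" if "j \<in> keys h" for j
  proof -
    have j: "j < n" using that h by (auto simp: fdeg_def)
    have "lookup h j \<noteq> 0" using that by (simp add: in_keys_iff)
    then obtain t where t: "t \<in> keys (lookup h j)" by fastforce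
    then have "mon_ord t = d" using lookup_fdeg(1)[OF h, of j] by (auto simp: gpols_of_ord_def)
    then have "ereal (real d) \<le> gpol_ord (lookup h j)"
      unfolding gpol_ord_def using t by (metis (mono_tags, lifting) SUP_upper)
    also have "\<dots> \<le> ereal (real (e j))" using e j by (simp add: ord_at_def)
    finally show ?thesis by simp
  qed
  then show ?thesis using h by (auto simp: fdeg_def)
qed

text \<open>
  In each of the finitely many possible degrees \<open>d\<close> the elements of \<open>S\<close> lie in a space of finite
  dimension, so a maximal independent subset is finite and spans them. Leaving out the zero
  vector guarantees that each chosen generator involves some column.
\<close>

lemma finite_homogeneous_generators:
  assumes hom: "\<forall>h\<in>S. homogeneous m n h" and e: "\<forall>h\<in>S. \<forall>j<n. ord_at j h \<le> ereal (real (e j))"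
  obtains gs where "sorted (map fst gs)"
    "\<And>d h. (d, h) \<in> set gs \<Longrightarrow> h \<in> S \<and> h \<in> fdeg m {j. j < n \<and> d \<le> e j} d \<and> (\<exists>j<n. d \<le> e j)"
    "\<And>h. h \<in> S \<Longrightarrow> \<exists>d. h \<in> wspace m D gs d"
proof -
  define Q where "Q d = {h \<in> S. h \<noteq> 0 \<and> h \<in> fdeg m {j. j < n \<and> d \<le> e j} d}" for d
  define b where "b = (\<Sum>j<n. e j)"
  have Qj: "\<exists>j<n. d \<le> e j" if "h \<in> Q d" for h d
  proof -
    have "keys h \<noteq> {}" using that by (simp add: Q_def)
    then obtain j where "j \<in> keys h" by blast
    then show ?thesis using that by (auto simp: Q_def fdeg_def)
  qed
  have "\<exists>B. B \<subseteq> Q d \<and> fvs.independent B \<and> Q d \<subseteq> fvs.span B" for d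
    using fvs.maximal_independent_subset[of "Q d"] by metis
  then obtain B where B: "\<And>d. B d \<subseteq> Q d" "\<And>d. fvs.independent (B d)" "\<And>d. Q d \<subseteq> fvs.span (B d)"
    by metis
  have fin: "finite (B d)" for d
  proof (rule fvs.finite_independent_in_span[OF B(2)])
    show "B d \<subseteq> fvs.span (fbasis m {j. j < n \<and> d \<le> e j} d)"
      using B(1)[of d] fdeg_span[of "{j. j < n \<and> d \<le> e j}" m d] by (auto simp: Q_def)
  qed (simp add: finite_fbasis)
  then have "finite (\<Union>d\<le>b. Pair d ` B d)" by simp
  from finite_list[OF this] obtain xs where xs: "set xs = (\<Union>d\<le>b. Pair d ` B d)" by (rule exE)
  define gs where "gs = sort_key fst xs"
  have set_gs: "(d, h) \<in> set gs \<longleftrightarrow> d \<le> b \<and> h \<in> B d" for d h unfolding gs_def using xs by auto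
  have gsQ: "h \<in> Q d" if "(d, h) \<in> set gs" for d h
    using that B(1)[of d] by (simp only: set_gs) blast
  have gsJ: "h \<in> fdeg m {..<n} d" if "(d, h) \<in> set gs" for d h
    using gsQ[OF that] fdeg_mono[of "{j. j < n \<and> d \<le> e j}" "{..<n}" m d] by (auto simp: Q_def)
  have W: "fvs.subspace (wspace m D gs s)" for s using wspace_subspace[OF _ gsJ] by blast
  show ?thesis
  proof (rule that)
    show "sorted (map fst gs)" by (simp add: gs_def)
    show "h \<in> S \<and> h \<in> fdeg m {j. j < n \<and> d \<le> e j} d \<and> (\<exists>j<n. d \<le> e j)" if "(d, h) \<in> set gs" for d h
      using gsQ[OF that] Qj[OF gsQ[OF that]] by (simp add: Q_def)
    fix h assume h: "h \<in> S"
    show "\<exists>d. h \<in> wspace m D gs d"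
    proof (cases "h = 0")
      case True
      then show ?thesis using fvs.subspace_0[OF W] by blast
    next
      case False
      obtain d where d: "h \<in> fdeg m {..<n} d" using hom h by (auto simp: homogeneous_def free_mod_deg_eq)
      have hQ: "h \<in> Q d" using degree_le_bound[OF d, of e] e h False by (simp add: Q_def)
      obtain j where "j < n" "d \<le> e j" using Qj[OF hQ] by blast
      then have "d \<le> b" using member_le_sum[of j "{..<n}" e] by (simp add: b_def)
      then have "B d \<subseteq> wspace m D gs d"
        using generator_in_wspace[OF _ gsJ] set_gs by blast
      then show ?thesis using fvs.span_minimal[OF _ W] hQ B(3) by blast
    qed
  qed
qed

definition hilbert_fun :: "nat \<Rightarrow> 'a fmod set \<Rightarrow> nat \<Rightarrow> int" where
  "hilbert_fun n S s = int (quotient_dim fscale (free_mod_deg m n s)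
       (submodule_gen m n D S \<inter> free_mod_deg m n s))"

lemma hilbert_fun_eq:
  assumes hom: "\<forall>h\<in>S. homogeneous m n h" and e: "\<forall>h\<in>S. \<forall>j<n. ord_at j h \<le> ereal (real (e j))"
  obtains gs where "sorted (map fst gs)"
    "\<And>d h. (d, h) \<in> set gs \<Longrightarrow> h \<in> fdeg m {j. j < n \<and> d \<le> e j} d"
    "\<And>d h. (d, h) \<in> set gs \<Longrightarrow> \<exists>j<n. d \<le> e j"
    "\<And>s. hilbert_fun n S s = int n * hcount {..<m} {} s - int (fvs.dim (wspace m D gs s))"
proof -
  obtain gs where gs: "sorted (map fst gs)"
    "\<And>d h. (d, h) \<in> set gs \<Longrightarrow> h \<in> S \<and> h \<in> fdeg m {j. j < n \<and> d \<le> e j} d \<and> (\<exists>j<n. d \<le> e j)"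
    "\<And>h. h \<in> S \<Longrightarrow> \<exists>d. h \<in> wspace m D gs d"
    using finite_homogeneous_generators[OF hom e] by blast
  have gsJ: "h \<in> fdeg m {..<n} d" if "(d, h) \<in> set gs" for d h
    using gs(2)[OF that] fdeg_mono[of "{j. j < n \<and> d \<le> e j}" "{..<n}" m d] by auto
  have eq: "submodule_gen m n D S \<inter> free_mod_deg m n s = wspace m D gs s" for s
    using gs gsJ by (intro submodule_gen_deg) auto
  have "hilbert_fun n S s = int n * hcount {..<m} {} s - int (fvs.dim (wspace m D gs s))" for s
  proof -
    have W: "fvs.subspace (wspace m D gs s)" "wspace m D gs s \<subseteq> fdeg m {..<n} s"
      using wspace_subspace[OF _ gsJ] by auto
    show ?thesis
      unfolding hilbert_fun_def eq unfolding free_mod_deg_eq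
      using fvs.quotient_dim_eq[OF subspace_fdeg fdeg_span finite_fbasis W] dim_fdeg[of "{..<n}" s] by simp
  qed
  then show ?thesis using that gs by blast
qed

lemma hilbert_fun_formula:
  assumes hom: "\<forall>h\<in>S. homogeneous m n h" and e: "\<forall>h\<in>S. \<forall>j<n. ord_at j h \<le> ereal (real (e j))"
    and m: "m = Suc k"
  obtains J dg ks u where "J \<subseteq> {..<n}" "\<And>j. j \<in> J \<Longrightarrow> dg j \<le> e j"
    "\<And>d t. (d, t) \<in> set ks \<Longrightarrow> d \<le> Max (e ` {..<n})" "numpoly (m - 2) u" "\<And>s. 0 \<le> u s"
    "\<forall>\<^sub>F s in sequentially. hilbert_fun n S s = int n * binom_fun k s - shift_sum J dg ks (binom_fun k) s - u s"
proof -
  obtain gs where gs: "sorted (map fst gs)"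
    "\<And>d h. (d, h) \<in> set gs \<Longrightarrow> h \<in> fdeg m {j. j < n \<and> d \<le> e j} d"
    "\<And>d h. (d, h) \<in> set gs \<Longrightarrow> \<exists>j<n. d \<le> e j"
    and hf: "\<And>s. hilbert_fun n S s = int n * hcount {..<m} {} s - int (fvs.dim (wspace m D gs s))"
    using hilbert_fun_eq[OF hom e] by blast
  have P: "hcount {..<m} {} s = binom_fun k s" for s using hcount_all m by simp
  obtain J dg ks u where J: "J \<subseteq> {..<n}" "\<forall>j\<in>J. dg j \<le> e j" "fst ` set ks \<subseteq> fst ` set gs"
     "numpoly (m - 2) u" "\<forall>s. 0 \<le> u s"
     "\<forall>\<^sub>F s in sequentially. int (fvs.dim (wspace m D gs s)) = shift_sum J dg ks (binom_fun k) s + u s"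
    using wspace_hilbert[OF m gs(2,1)] by blast
  have "d \<le> Max (e ` {..<n})" if "(d, t) \<in> set ks" for d t
  proof -
    have "d \<in> fst ` set gs" using J(3) that by force
    then obtain h where "(d, h) \<in> set gs" by auto
    then obtain j where "j < n" and "d \<le> e j" using gs(3) by blast
    have "e j \<le> Max (e ` {..<n})" by (rule Max_ge) (use \<open>j < n\<close> in auto)
    with \<open>d \<le> e j\<close> show ?thesis by (rule order.trans)
  qed
  moreover have "\<forall>\<^sub>F s in sequentially. hilbert_fun n S s =
      int n * binom_fun k s - shift_sum J dg ks (binom_fun k) s - u s"
    using J(6) by eventually_elim (simp add: hf P)
  ultimately show ?thesis using that J by blast
qed

end

section \<open>Reading off the typical dimension\<close>

text \<open>
  The coefficient that decides codimension 1.
\<close>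

lemma shift_sum_deficit_linear:
  assumes "finite J"
  shows "\<forall>\<^sub>F s in sequentially. int (card J) * binom_fun 1 (s + k) - shift_sum J dg ks (\<lambda>x. binom_fun 1 (x + k)) s
     = (\<Sum>j\<in>J. int (dg j)) - (\<Sum>(d, t)\<leftarrow>ks. int t)"
  using eventually_ge_at_top[of "(\<Sum>j\<in>J. dg j) + (\<Sum>(d, t)\<leftarrow>ks. d + t)"]
proof eventually_elim
  case (elim s)
  have b: "binom_fun (Suc 0) x = int x + 1" for x by (simp add: binom_fun_def)
  have "(\<Sum>j\<in>J. binom_fun 1 (s - dg j + k)) = (\<Sum>j\<in>J. binom_fun 1 (s + k) - int (dg j))"
  proof (rule sum.cong[OF refl])
    fix j assume "j \<in> J"
    then have "int (s - dg j + k) = int s + int k - int (dg j)"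
      using shift_bounds(1)[OF assms elim \<open>j \<in> J\<close>] by (simp add: of_nat_diff)
    then show "binom_fun 1 (s - dg j + k) = binom_fun 1 (s + k) - int (dg j)" by (simp add: b)
  qed
  moreover have "(\<Sum>(d, t)\<leftarrow>ks. binom_fun 1 (s - d + k) - binom_fun 1 (s - (d + t) + k)) = (\<Sum>(d, t)\<leftarrow>ks. int t)"
  proof (intro arg_cong[of _ _ sum_list] map_cong refl, clarify)
    fix d t assume "(d, t) \<in> set ks"
    then have "int (s - d + k) = int s + int k - int d" "int (s - (d + t) + k) = int s + int k - int (d + t)"
      using shift_bounds(2)[OF assms elim, of d t] by (simp_all add: of_nat_diff)
    then show "binom_fun 1 (s - d + k) - binom_fun 1 (s - (d + t) + k) = int t"
      unfolding One_nat_def b by simp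
  qed
  ultimately show ?case by (simp add: shift_sum_def sum_subtractf)
qed

text \<open>
  The coefficient that decides codimension 2, doubled to avoid division. With \<open>y = s + k\<close>, a
  shift by \<open>a\<close> changes \<open>(y + 1) (y + 2)\<close> by \<open>a (2 y + 3) - a\<^sup>2\<close>; the parts depending on \<open>y\<close> cancel
  by the assumption.
\<close>

lemma shift_sum_deficit_quadratic:
  assumes "finite J" and eq: "(\<Sum>j\<in>J. int (dg j)) = (\<Sum>(d, t)\<leftarrow>ks. int t)"
  shows "\<forall>\<^sub>F s in sequentially.
     2 * (int (card J) * binom_fun 2 (s + k) - shift_sum J dg ks (\<lambda>x. binom_fun 2 (x + k)) s)
     = (\<Sum>(d, t)\<leftarrow>ks. 2 * int d * int t + (int t)\<^sup>2) - (\<Sum>j\<in>J. (int (dg j))\<^sup>2)"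
  using eventually_ge_at_top[of "(\<Sum>j\<in>J. dg j) + (\<Sum>(d, t)\<leftarrow>ks. d + t)"]
proof eventually_elim
  case (elim s)
  have b: "2 * binom_fun 2 x = (int x + 1) * (int x + 2)" for x
  proof (induction x)
    case (Suc x)
    have "binom_fun 2 (Suc x) = binom_fun 2 x + binom_fun 1 (Suc x)"
      using binom_fun_Suc_Suc[of 1 x] by (simp add: numeral_2_eq_2)
    moreover have "binom_fun 1 (Suc x) = int x + 2" by (simp add: binom_fun_def)
    ultimately show ?case using Suc by (simp add: algebra_simps)
  qed (simp add: binom_fun_def numeral_2_eq_2)
  define y where "y = int s + int k"
  have B: "2 * binom_fun 2 (s - a + k) = (y + 1) * (y + 2) - int a * (2 * y + 3) + (int a)\<^sup>2"
    if "a \<le> s" for a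
  proof -
    have "int (s - a + k) = y - int a" using that by (simp add: y_def of_nat_diff)
    then have "2 * binom_fun 2 (s - a + k) = (y - int a + 1) * (y - int a + 2)"
      by (simp only: b)
    then show ?thesis by (simp add: algebra_simps power2_eq_square)
  qed
  have "2 * (\<Sum>j\<in>J. binom_fun 2 (s - dg j + k)) =
     (\<Sum>j\<in>J. (y + 1) * (y + 2) - int (dg j) * (2 * y + 3) + (int (dg j))\<^sup>2)"
    unfolding sum_distrib_left using shift_bounds(1)[OF assms(1) elim]
    by (intro sum.cong refl B) blast
  also have "\<dots> = int (card J) * (2 * binom_fun 2 (s + k)) - (\<Sum>j\<in>J. int (dg j)) * (2 * y + 3) + (\<Sum>j\<in>J. (int (dg j))\<^sup>2)"
    by (simp add: sum.distrib sum_subtractf sum_distrib_right b y_def)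
  finally have 1: "2 * (\<Sum>j\<in>J. binom_fun 2 (s - dg j + k)) = \<dots>" .
  have "2 * (\<Sum>(d, t)\<leftarrow>ks. binom_fun 2 (s - d + k) - binom_fun 2 (s - (d + t) + k)) =
     (\<Sum>(d, t)\<leftarrow>ks. 2 * (binom_fun 2 (s - d + k) - binom_fun 2 (s - (d + t) + k)))"
    by (simp only: sum_list_const_mult split_def)
  also have "\<dots> = (\<Sum>(d, t)\<leftarrow>ks. int t * (2 * y + 3) - (2 * int d * int t + (int t)\<^sup>2))"
  proof (intro arg_cong[of _ _ sum_list] map_cong refl, clarify)
    fix d t assume "(d, t) \<in> set ks"
    then have "d \<le> s" "d + t \<le> s" using shift_bounds(2)[OF assms(1) elim, of d t] by simp_all
    then show "2 * (binom_fun 2 (s - d + k) - binom_fun 2 (s - (d + t) + k)) =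
        int t * (2 * y + 3) - (2 * int d * int t + (int t)\<^sup>2)"
      unfolding right_diff_distrib[of 2] by (simp only: B) (simp add: algebra_simps power2_eq_square)
  qed
  also have "\<dots> = (\<Sum>(d, t)\<leftarrow>ks. int t) * (2 * y + 3) - (\<Sum>(d, t)\<leftarrow>ks. 2 * int d * int t + (int t)\<^sup>2)"
    by (simp add: split_def sum_list_subtractf sum_list_mult_const)
  finally have 2: "2 * (\<Sum>(d, t)\<leftarrow>ks. binom_fun 2 (s - d + k) - binom_fun 2 (s - (d + t) + k)) = \<dots>" .
  show ?case using 1 2 eq unfolding shift_sum_def by (simp add: algebra_simps)
qed

lemma two_pair_sum:
  fixes e :: "nat \<Rightarrow> nat"
  shows "2 * int (\<Sum>j<n. \<Sum>i<j. e i * e j) = (\<Sum>i<n. int (e i))\<^sup>2 - (\<Sum>i<n. (int (e i))\<^sup>2)"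
proof (induction n)
  case (Suc n)
  have "int (\<Sum>i<n. e i * e n) = (\<Sum>i<n. int (e i)) * int (e n)"
    by (simp add: sum_distrib_right)
  then show ?case using Suc by (simp add: power2_eq_square algebra_simps)
qed simp

text \<open>
  Both sides are twice the sum of the products of distinct pairs.
\<close>

lemma square_sum_diff_mono:
  fixes a b :: "nat \<Rightarrow> int"
  assumes "\<And>i. i < n \<Longrightarrow> 0 \<le> a i" "\<And>i. i < n \<Longrightarrow> a i \<le> b i"
  shows "(\<Sum>i<n. a i)\<^sup>2 - (\<Sum>i<n. (a i)\<^sup>2) \<le> (\<Sum>i<n. b i)\<^sup>2 - (\<Sum>i<n. (b i)\<^sup>2)"
  using assms
proof (induction n)
  case (Suc n)
  have "(\<Sum>i<n. a i) * a n \<le> (\<Sum>i<n. b i) * b n"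
    using Suc.prems by (intro mult_mono sum_mono sum_nonneg) (auto intro: order.trans less_SucI)
  moreover have "(\<Sum>i<n. a i)\<^sup>2 - (\<Sum>i<n. (a i)\<^sup>2) \<le> (\<Sum>i<n. b i)\<^sup>2 - (\<Sum>i<n. (b i)\<^sup>2)"
    using Suc by auto
  ultimately show ?case by (simp add: power2_eq_square algebra_simps)
qed simp

lemma sum_list_squares_le:
  "(\<Sum>(d, t)\<leftarrow>ks. (int t)\<^sup>2) \<le> (\<Sum>(d, t)\<leftarrow>ks. int t)\<^sup>2" for ks :: "(nat \<times> nat) list"
proof (induction ks)
  case (Cons p ks)
  obtain d t where p: "p = (d, t)" by force
  have "0 \<le> int t * (\<Sum>(d, t)\<leftarrow>ks. int t)" by (intro mult_nonneg_nonneg sum_list_nonneg) auto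
  then show ?case using Cons by (simp add: p power2_eq_square algebra_simps)
qed simp

lemma codim2_bound_estimate:
  fixes dg e :: "nat \<Rightarrow> nat" and ks :: "(nat \<times> nat) list"
  assumes dg: "\<And>j. j < n \<Longrightarrow> dg j \<le> e j" and ks: "\<And>d t. (d, t) \<in> set ks \<Longrightarrow> d \<le> Max (e ` {..<n})"
    and eq: "(\<Sum>j<n. int (dg j)) = (\<Sum>(d, t)\<leftarrow>ks. int t)"
  shows "(\<Sum>(d, t)\<leftarrow>ks. 2 * int d * int t + (int t)\<^sup>2) - (\<Sum>j<n. (int (dg j))\<^sup>2) \<le> 2 * int (codim2_bound n e)"
proof -
  let ?M = "Max (e ` {..<n})" and ?S = "\<Sum>j<n. int (dg j)"
  have "(\<Sum>(d, t)\<leftarrow>ks. 2 * int d * int t) \<le> (\<Sum>(d, t)\<leftarrow>ks. 2 * int ?M * int t)"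
    using ks by (intro sum_list_mono) (auto intro!: mult_right_mono)
  also have "\<dots> = 2 * int ?M * ?S"
    unfolding eq by (simp add: split_def sum_list_const_mult)
  finally have 1: "(\<Sum>(d, t)\<leftarrow>ks. 2 * int d * int t) \<le> 2 * int ?M * ?S" .
  have 2: "(\<Sum>(d, t)\<leftarrow>ks. 2 * int d * int t + (int t)\<^sup>2) =
     (\<Sum>(d, t)\<leftarrow>ks. 2 * int d * int t) + (\<Sum>(d, t)\<leftarrow>ks. (int t)\<^sup>2)"
    by (simp add: split_def sum_list_addf)
  have 3: "?S\<^sup>2 - (\<Sum>j<n. (int (dg j))\<^sup>2) \<le> (\<Sum>j<n. int (e j))\<^sup>2 - (\<Sum>j<n. (int (e j))\<^sup>2)"
    using dg by (intro square_sum_diff_mono) auto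
  have 4: "2 * int ?M * ?S \<le> 2 * int ?M * (\<Sum>j<n. int (e j))"
    using dg by (intro mult_left_mono sum_mono) auto
  have "2 * int (codim2_bound n e) =
      2 * int ?M * (\<Sum>j<n. int (e j)) + ((\<Sum>j<n. int (e j))\<^sup>2 - (\<Sum>j<n. (int (e j))\<^sup>2))"
    unfolding two_pair_sum[symmetric] by (simp add: codim2_bound_def algebra_simps)
  then show ?thesis using 1 2 3 4 sum_list_squares_le[of ks] unfolding eq by linarith
qed

text \<open>
  With \<open>p\<close> a place where the maximum is attained and \<open>T\<close> the sum of the \<open>e j\<close>, this is
  \<open>0 \<le> (T - e p)\<^sup>2\<close> together with \<open>(e p)\<^sup>2 \<le> (\<Sum>j. (e j)\<^sup>2)\<close>.
\<close>

lemma codim2_bound_le_square: "codim2_bound n e \<le> (\<Sum>j<n. e j)\<^sup>2"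
proof (cases "n = 0")
  case True
  then show ?thesis by (simp add: codim2_bound_def)
next
  case False
  let ?T = "\<Sum>j<n. int (e j)" and ?Q = "\<Sum>j<n. (int (e j))\<^sup>2"
  have "Max (e ` {..<n}) \<in> e ` {..<n}" using False by (intro Max_in) auto
  then obtain p where p: "p < n" "Max (e ` {..<n}) = e p" by auto
  have "(int (e p))\<^sup>2 \<le> ?Q" using p(1) by (intro member_le_sum) auto
  moreover have "0 \<le> (?T - int (e p))\<^sup>2" by simp
  ultimately have "2 * int (e p) * ?T \<le> ?T\<^sup>2 + ?Q" by (simp add: power2_eq_square algebra_simps)
  moreover have "2 * int (codim2_bound n e) = 2 * int (e p) * ?T + (?T\<^sup>2 - ?Q)"
    unfolding two_pair_sum[symmetric] by (simp add: codim2_bound_def p(2) algebra_simps)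
  ultimately have "int (codim2_bound n e) \<le> ?T\<^sup>2" by simp
  also have "?T\<^sup>2 = int ((\<Sum>j<n. e j)\<^sup>2)" by simp
  finally show ?thesis by (simp only: of_nat_le_iff)
qed

context graded_gen_poly_ring
begin

lemma numpoly_hilbert_fun:
  assumes hom: "\<forall>h\<in>S. homogeneous m n h" and e: "\<forall>h\<in>S. \<forall>j<n. ord_at j h \<le> ereal (real (e j))"
  shows "numpoly m (hilbert_fun n S)"
proof (cases m)
  case 0
  obtain gs where hf: "\<And>s. hilbert_fun n S s = int n * hcount {..<m} {} s - int (fvs.dim (wspace m D gs s))"
    by (rule hilbert_fun_eq[OF hom e]) (rule that)
  have "hilbert_fun n S s = 0" if "s \<ge> 1" for s
  proof -
    have "hcount {..<m} {} s = 0" using that 0 by (simp add: hcount_def mons_of_ord_def mons_empty)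
    then have "hilbert_fun n S s \<le> 0" using hf[of s] by simp
    then show ?thesis by (simp add: hilbert_fun_def)
  qed
  then show ?thesis using 0 unfolding numpoly_def eventually_sequentially by auto
next
  case (Suc k)
  obtain J dg ks u where u: "numpoly (m - 2) u" and
    f: "\<forall>\<^sub>F s in sequentially. hilbert_fun n S s = int n * binom_fun k s - shift_sum J dg ks (binom_fun k) s - u s"
    by (rule hilbert_fun_formula[OF hom e Suc]) (rule that)
  have "numpoly m (\<lambda>s. int n * binom_fun k s - shift_sum J dg ks (binom_fun k) s - u s)"
    using numpoly_binom[of k] Suc numpoly_mono[OF u, of m]
    by (intro numpoly_diff numpoly_cmult numpoly_shift_sum) auto
  then show ?thesis by (rule numpoly_cong[OF f])
qed

text \<open>
  For \<open>m = Suc (k + i)\<close> the \<open>k\<close>-th difference of the Hilbert function is a polynomial of degree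
  at most \<open>i\<close>. It vanishes if \<open>k\<close> exceeds the generalized type, and equals the typical
  dimension if \<open>k\<close> is the type, so codimension \<open>c\<close> provides the values \<open>i = 0, \<dots>, c\<close>. The
  error term \<open>u\<close> contributes a nonnegative constant for \<open>i = 2\<close> and nothing for \<open>i < 2\<close>. If the
  characteristic polynomial is zero, so is the typical dimension.
\<close>

lemma typical_dim_bounds:
  assumes hom: "\<forall>h\<in>S. homogeneous m n h" and e: "\<forall>h\<in>S. \<forall>j<n. ord_at j h \<le> ereal (real (e j))"
  shows "gen_codim m n D S = 0 \<Longrightarrow> typical_dim m n D S \<le> int n"
    and "gen_codim m n D S = 1 \<Longrightarrow> typical_dim m n D S \<le> int (\<Sum>j<n. e j)"
    and "gen_codim m n D S = 2 \<Longrightarrow> typical_dim m n D S \<le> int (codim2_bound n e)"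
proof -
  let ?w = "characteristic_poly m n D S" and ?f = "hilbert_fun n S" and ?td = "typical_dim m n D S"
  define q where "q = Polynomial.degree ?w"
  note char = characteristic_poly_numpoly[OF hilbert_fun_def numpoly_hilbert_fun[OF hom e], folded q_def]
  have deg: "m = q + 1 + c" if "gen_codim m n D S = int c" "?w \<noteq> 0" for c
    using that by (simp add: gen_codim_def gen_type_def Let_def q_def)
  have zero: "?td = 0" if "?w = 0" using char(3) that .
  have main: "\<exists>J dg ks. finite J \<and> J \<subseteq> {..<n} \<and> (\<forall>j\<in>J. dg j \<le> e j) \<and> (\<forall>d t. (d, t) \<in> set ks \<longrightarrow> d \<le> Max (e ` {..<n})) \<and>
     (\<forall>k i. m = Suc (k + i) \<longrightarrow> i \<le> 2 \<longrightarrow> (\<exists>v\<ge>0. (i < 2 \<longrightarrow> v = 0) \<and> (\<forall>\<^sub>F s in sequentially.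
       (fdiff ^^ k) ?f s = int n * binom_fun i (s + k) - shift_sum J dg ks (\<lambda>x. binom_fun i (x + k)) s - v)))"
    if "m = Suc k0" for k0
  proof -
    obtain J dg ks u where J: "J \<subseteq> {..<n}" "\<And>j. j \<in> J \<Longrightarrow> dg j \<le> e j"
      "\<And>d t. (d, t) \<in> set ks \<Longrightarrow> d \<le> Max (e ` {..<n})" and u: "numpoly (m - 2) u" "\<And>s. 0 \<le> u s"
      and f: "\<forall>\<^sub>F s in sequentially. ?f s = int n * binom_fun k0 s - shift_sum J dg ks (binom_fun k0) s - u s"
      by (rule hilbert_fun_formula[OF hom e \<open>m = Suc k0\<close>]) (rule that)
    have fin: "finite J" using J(1) finite_subset by blast
    have "\<exists>v\<ge>0. (i < 2 \<longrightarrow> v = 0) \<and> (\<forall>\<^sub>F s in sequentially.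
       (fdiff ^^ k) ?f s = int n * binom_fun i (s + k) - shift_sum J dg ks (\<lambda>x. binom_fun i (x + k)) s - v)"
      if ki: "m = Suc (k + i)" "i \<le> 2" for k i
    proof -
      have k0: "k0 = k + i" using ki \<open>m = Suc k0\<close> by simp
      have "numpoly (Suc k) u" by (rule numpoly_mono[OF u(1)]) (use ki in simp)
      then obtain c where c: "\<forall>\<^sub>F s in sequentially. (fdiff ^^ k) u s = c" by (rule numpoly_Suc_const)
      have "0 \<le> c" by (rule fdiff_pow_nonneg[OF _ c]) (simp add: u(2))
      moreover have "c = 0" if "i < 2"
      proof -
        have "\<forall>\<^sub>F s in sequentially. (fdiff ^^ k) u s = 0"
          by (rule numpoly_const_lead[OF u(1)]) (use that ki in simp)
        then have "\<forall>\<^sub>F s::nat in sequentially. c = 0" using c by eventually_elim simp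
        then show ?thesis by simp
      qed
      moreover have "\<forall>\<^sub>F s in sequentially. (fdiff ^^ k) ?f s =
          int n * binom_fun i (s + k) - shift_sum J dg ks (\<lambda>x. binom_fun i (x + k)) s - c"
        using fdiff_pow_cong[OF f, of k] c fdiff_pow_shift_sum[OF fin, of k dg ks i]
        by eventually_elim (simp add: fdiff_pow_diff fdiff_pow_cmult fdiff_pow_binom k0)
      ultimately show ?thesis by blast
    qed
    note lead = this
    show ?thesis
      by (intro exI[of _ J] exI[of _ dg] exI[of _ ks] conjI ballI allI impI fin J lead)
  qed
  show "?td \<le> int n" if c: "gen_codim m n D S = 0"
  proof (cases "?w = 0")
    case False
    then have m: "m = Suc (q + 0)" using deg[of 0] c by simp
    obtain J dg ks where
      *: "\<forall>k i. m = Suc (k + i) \<longrightarrow> i \<le> 2 \<longrightarrow> (\<exists>v\<ge>0. (i < 2 \<longrightarrow> v = 0) \<and> (\<forall>\<^sub>F s in sequentially.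
       (fdiff ^^ k) ?f s = int n * binom_fun i (s + k) - shift_sum J dg ks (\<lambda>x. binom_fun i (x + k)) s - v))"
      using main[OF m] by (elim exE conjE) (rule that)
    have "\<forall>\<^sub>F s in sequentially. (fdiff ^^ q) ?f s = int n - int (card J)"
      using *[rule_format, OF m] by (auto simp: shift_sum_one)
    with char(2) have "\<forall>\<^sub>F s::nat in sequentially. ?td = int n - int (card J)"
      by eventually_elim simp
    then show ?thesis by simp
  qed (simp add: zero)
  show "?td \<le> int (\<Sum>j<n. e j)" if c: "gen_codim m n D S = 1"
  proof (cases "?w = 0")
    case False
    then have m: "m = Suc (q + 1)" "m = Suc (Suc q + 0)" using deg[of 1] c by simp_all
    obtain J dg ks where J: "finite J" "J \<subseteq> {..<n}" "\<forall>j\<in>J. dg j \<le> e j" and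
      *: "\<forall>k i. m = Suc (k + i) \<longrightarrow> i \<le> 2 \<longrightarrow> (\<exists>v\<ge>0. (i < 2 \<longrightarrow> v = 0) \<and> (\<forall>\<^sub>F s in sequentially.
       (fdiff ^^ k) ?f s = int n * binom_fun i (s + k) - shift_sum J dg ks (\<lambda>x. binom_fun i (x + k)) s - v))"
      using main[OF m(1)] by (elim exE conjE) (rule that)
    have "\<forall>\<^sub>F s in sequentially. (fdiff ^^ Suc q) ?f s = int n - int (card J)"
      using *[rule_format, OF m(2)] by (auto simp: shift_sum_one simp del: funpow.simps)
    moreover have "\<forall>\<^sub>F s in sequentially. (fdiff ^^ Suc q) ?f s = 0"
      using char(1) by (simp add: numpoly_def)
    ultimately have "\<forall>\<^sub>F s::nat in sequentially. int n - int (card J) = 0" by eventually_elim simp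
    then have "card J = card {..<n}" by simp
    then have Jn: "J = {..<n}" using card_subset_eq[OF _ J(2)] by simp
    have "\<forall>\<^sub>F s in sequentially. (fdiff ^^ q) ?f s =
        int n * binom_fun 1 (s + q) - shift_sum {..<n} dg ks (\<lambda>x. binom_fun 1 (x + q)) s"
      using *[rule_format, OF m(1)] Jn by auto
    then have "\<forall>\<^sub>F s::nat in sequentially. ?td = (\<Sum>j<n. int (dg j)) - (\<Sum>(d, t)\<leftarrow>ks. int t)"
      using char(2) shift_sum_deficit_linear[of "{..<n}" q dg ks, OF finite_lessThan]
      by eventually_elim simp
    then have "?td = (\<Sum>j<n. int (dg j)) - (\<Sum>(d, t)\<leftarrow>ks. int t)" by simp
    moreover have "0 \<le> (\<Sum>(d, t)\<leftarrow>ks. int t)" by (intro sum_list_nonneg) auto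
    moreover have "(\<Sum>j<n. int (dg j)) \<le> (\<Sum>j<n. int (e j))" using J(3) Jn by (intro sum_mono) auto
    ultimately show ?thesis by simp
  qed (simp add: zero sum_nonneg)
  show "?td \<le> int (codim2_bound n e)" if c: "gen_codim m n D S = 2"
  proof (cases "?w = 0")
    case False
    then have m: "m = Suc (q + 2)" "m = Suc (Suc q + 1)" "m = Suc (Suc (Suc q) + 0)"
      using deg[of 2] c by simp_all
    obtain J dg ks where J: "finite J" "J \<subseteq> {..<n}" "\<forall>j\<in>J. dg j \<le> e j"
      "\<forall>d t. (d, t) \<in> set ks \<longrightarrow> d \<le> Max (e ` {..<n})" and
      *: "\<forall>k i. m = Suc (k + i) \<longrightarrow> i \<le> 2 \<longrightarrow> (\<exists>v\<ge>0. (i < 2 \<longrightarrow> v = 0) \<and> (\<forall>\<^sub>F s in sequentially.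
       (fdiff ^^ k) ?f s = int n * binom_fun i (s + k) - shift_sum J dg ks (\<lambda>x. binom_fun i (x + k)) s - v))"
      using main[OF m(1)] by (elim exE conjE) (rule that)
    have "\<forall>\<^sub>F s in sequentially. (fdiff ^^ Suc (Suc q)) ?f s = int n - int (card J)"
      using *[rule_format, OF m(3)] by (auto simp: shift_sum_one simp del: funpow.simps)
    moreover have "\<forall>\<^sub>F s in sequentially. (fdiff ^^ Suc (Suc q)) ?f s = 0"
      using numpoly_mono[OF char(1), of "Suc (Suc q)"] by (simp add: numpoly_def)
    ultimately have "\<forall>\<^sub>F s::nat in sequentially. int n - int (card J) = 0" by eventually_elim simp
    then have "card J = card {..<n}" by simp
    then have Jn: "J = {..<n}" using card_subset_eq[OF _ J(2)] by simp
    have "\<forall>\<^sub>F s in sequentially. (fdiff ^^ Suc q) ?f s =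
        int n * binom_fun 1 (s + Suc q) - shift_sum {..<n} dg ks (\<lambda>x. binom_fun 1 (x + Suc q)) s"
      using *[rule_format, OF m(2)] Jn by (auto simp del: funpow.simps add_Suc_right)
    moreover have "\<forall>\<^sub>F s in sequentially. (fdiff ^^ Suc q) ?f s = 0"
      using char(1) by (simp add: numpoly_def)
    ultimately have "\<forall>\<^sub>F s::nat in sequentially. (\<Sum>j<n. int (dg j)) - (\<Sum>(d, t)\<leftarrow>ks. int t) = 0"
      using shift_sum_deficit_linear[of "{..<n}" "Suc q" dg ks, OF finite_lessThan]
      by eventually_elim simp
    then have eq: "(\<Sum>j<n. int (dg j)) = (\<Sum>(d, t)\<leftarrow>ks. int t)" by simp
    obtain v where v: "v \<ge> 0" "\<forall>\<^sub>F s in sequentially. (fdiff ^^ q) ?f s =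
        int n * binom_fun 2 (s + q) - shift_sum {..<n} dg ks (\<lambda>x. binom_fun 2 (x + q)) s - v"
      using *[rule_format, OF m(1)] Jn by auto
    have "\<forall>\<^sub>F s::nat in sequentially. 2 * (?td + v) =
        (\<Sum>(d, t)\<leftarrow>ks. 2 * int d * int t + (int t)\<^sup>2) - (\<Sum>j<n. (int (dg j))\<^sup>2)"
      using char(2) v(2) shift_sum_deficit_quadratic[OF finite_lessThan eq, of q]
      by eventually_elim simp
    then have "2 * (?td + v) = (\<Sum>(d, t)\<leftarrow>ks. 2 * int d * int t + (int t)\<^sup>2) - (\<Sum>j<n. (int (dg j))\<^sup>2)"
      by simp
    also have "\<dots> \<le> 2 * int (codim2_bound n e)"
      using J(3,4) Jn eq by (intro codim2_bound_estimate) auto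
    finally show ?thesis using v(1) by simp
  qed (simp add: zero)
qed

end

section \<open>A system attaining the bound in codimension 2\<close>

definition deg_lex :: "nat \<Rightarrow> mon rel" where
  "deg_lex m = {(s, t). s \<in> monomials m \<and> t \<in> monomials m \<and>
     (mon_ord s < mon_ord t \<or> mon_ord s = mon_ord t \<and> s \<le> t)}"

lemma ranking_deg_lex: "ranking m (deg_lex m)"
proof -
  have "linear_order_on (monomials m) (deg_lex m)"
    unfolding order_on_defs
    by (auto simp: deg_lex_def refl_on_def trans_def antisym_def total_on_def)
  moreover have "(0 :: mon) \<le> t" for t
  proof (cases "t = 0")
    case False
    then have "keys t \<noteq> {}" by simp
    define k where "k = Min (keys t)"
    have "k \<in> keys t" using \<open>keys t \<noteq> {}\<close> by (simp add: k_def)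
    moreover have "lookup t j = 0" if "j < k" for j
    proof (rule ccontr)
      assume "lookup t j \<noteq> 0"
      then have "k \<le> j" unfolding k_def by (intro Min_le) (simp_all add: in_keys_iff)
      then show False using that by simp
    qed
    ultimately have "(0 :: mon) < t"
      by (auto simp: less_poly_mapping.rep_eq less_fun_def in_keys_iff intro!: exI[of _ k])
    then show ?thesis by simp
  qed simp
  ultimately show ?thesis
    unfolding ranking_def
    by (auto simp: deg_lex_def monomials_eq mons_add)
qed

lemma orderly_deg_lex: "orderly m (deg_lex m)"
  by (auto simp: orderly_def deg_lex_def)

lemma ranking_add:
  assumes r: "ranking m r" and s: "s \<in> monomials m" "a \<in> monomials m" "(s, a) \<in> r"
    and t: "t \<in> monomials m" "b \<in> monomials m" "(t, b) \<in> r"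
  shows "(s + t, a + b) \<in> r" "s + t = a + b \<Longrightarrow> s = a \<and> t = b"
proof -
  have lin: "linear_order_on (monomials m) r" using r by (simp add: ranking_def)
  then have tr: "trans r" and an: "antisym r" and rf: "\<And>x. x \<in> monomials m \<Longrightarrow> (x, x) \<in> r"
    by (auto simp: order_on_defs refl_on_def)
  have cl: "x + y \<in> monomials m" if "x \<in> monomials m" "y \<in> monomials m" for x y
    using that by (simp add: monomials_eq mons_add)
  have mono: "(u + x, u + y) \<in> r \<and> (u + x = u + y \<longrightarrow> x = y)"
    if "u \<in> monomials m" "x \<in> monomials m" "y \<in> monomials m" "(x, y) \<in> r" for u x y
    using r that rf[OF cl] unfolding ranking_def by (cases "x = y") auto
  have 1: "(t + s, t + a) \<in> r" using mono s t by blast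
  have 2: "(a + t, a + b) \<in> r" using mono s t by blast
  show "(s + t, a + b) \<in> r" using 1 2 tr by (metis add.commute transD)
  show "s = a \<and> t = b" if eq: "s + t = a + b"
  proof -
    have "a + t = a + b" using 1 2 eq an by (metis add.commute antisymD)
    then show ?thesis using eq by simp
  qed
qed

definition comm_gpol_ring :: "nat \<Rightarrow> ('a::field) gpol ring" where
  "comm_gpol_ring m = \<lparr>carrier = gpols m, mult = (*), one = 1, zero = 0, add = (+)\<rparr>"

lemma gpols_add: "A \<in> gpols m \<Longrightarrow> B \<in> gpols m \<Longrightarrow> A + B \<in> gpols m"
  by (rule gvs.subspace_add[OF subspace_gpols])

lemma gpols_mult: "A \<in> gpols m \<Longrightarrow> B \<in> gpols m \<Longrightarrow> A * B \<in> gpols m"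
  using keys_mult[of A B] by (force simp: gpols_def monomials_eq intro: mons_add)

lemma ring_comm_gpol_ring: "ring (comm_gpol_ring m :: ('a::field) gpol ring)"
proof (rule ringI)
  have neg: "- A \<in> gpols m" if "A \<in> gpols m" for A :: "'a gpol"
    using that by (rule gvs.subspace_neg[OF subspace_gpols])
  show "abelian_group (comm_gpol_ring m :: 'a gpol ring)"
    by (rule abelian_groupI)
       (auto simp: comm_gpol_ring_def gpols_add add_ac gvs.subspace_0[OF subspace_gpols]
         intro: bexI[OF _ neg])
  have "(1 :: 'a gpol) \<in> gpols m" by (simp add: gpols_def monomials_eq)
  then show "monoid (comm_gpol_ring m :: 'a gpol ring)"
    by (intro monoidI) (auto simp: comm_gpol_ring_def gpols_mult mult_ac)
qed (auto simp: comm_gpol_ring_def algebra_simps)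

text \<open>
  The product of the leading terms cannot cancel: two monomials below the leaders have the
  product of the leaders as their product only if they are the leaders.
\<close>

lemma leader_mult_comm:
  fixes A B :: "('a::field) gpol"
  assumes r: "ranking m r" and A: "A \<in> gpols m" "A \<noteq> 0" and B: "B \<in> gpols m" "B \<noteq> 0"
  shows "A * B \<noteq> 0 \<and> leader r (A * B) = leader r A + leader r B"
proof -
  have lin: "linear_order_on (monomials m) r" using r by (simp add: ranking_def)
  let ?a = "leader r A" and ?b = "leader r B"
  have kA: "keys A \<subseteq> monomials m" and kB: "keys B \<subseteq> monomials m" using A B by (simp_all add: gpols_def)
  note a = leader_in_keys[OF lin kA A(2)] and b = leader_in_keys[OF lin kB B(2)]
  have le: "(s + t, ?a + ?b) \<in> r" "s + t = ?a + ?b \<longleftrightarrow> s = ?a \<and> t = ?b"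
    if "s \<in> keys A" "t \<in> keys B" for s t
    using ranking_add[OF r, of s ?a t ?b] that a b kA kB by blast+
  have "A * B = (\<Sum>s\<in>keys A. \<Sum>t\<in>keys B. single (s + t) (lookup A s * lookup B t))"
    unfolding mult_single[symmetric] sum_product[symmetric]
    by (rule arg_cong2[of _ _ _ _ "(*)"]) (rule gpol_expansion)+
  then have "lookup (A * B) (?a + ?b) =
      (\<Sum>s\<in>keys A. \<Sum>t\<in>keys B. if s + t = ?a + ?b then lookup A s * lookup B t else 0)"
    by (simp add: lookup_sum lookup_single when_def)
  also have "\<dots> = (\<Sum>s\<in>keys A. \<Sum>t\<in>keys B. if s = ?a then if t = ?b then lookup A s * lookup B t else 0 else 0)"
    by (intro sum.cong refl) (simp add: le)
  also have "\<dots> = (\<Sum>s\<in>keys A. if s = ?a then \<Sum>t\<in>keys B. if t = ?b then lookup A s * lookup B t else 0 else 0)"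
    by (intro sum.cong) auto
  also have "\<dots> = lookup A ?a * lookup B ?b"
    using a(1) b(1) by simp
  finally have top: "?a + ?b \<in> keys (A * B)"
    using a(1) b(1) by (simp add: in_keys_iff)
  moreover have "leader r (A * B) = ?a + ?b"
  proof (rule leader_eqI[OF lin top])
    fix u assume "u \<in> keys (A * B)"
    then obtain s t where "s \<in> keys A" "t \<in> keys B" "u = s + t" using keys_mult[of A B] by blast
    then show "(u, ?a + ?b) \<in> r" using le(1) by simp
  qed
  ultimately show ?thesis by auto
qed

lemma graded_comm_gpol_ring:
  "graded_gen_poly_ring m (deg_lex m) (comm_gpol_ring m :: ('a::field) gpol ring)"
proof (intro graded_gen_poly_ring.intro gen_poly_ring.intro graded_gen_poly_ring_axioms.intro)
  show "gscale c A \<otimes>\<^bsub>comm_gpol_ring m\<^esub> B = gscale c (A \<otimes>\<^bsub>comm_gpol_ring m\<^esub> B)"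
    for c and A B :: "'a gpol"
    by (simp add: comm_gpol_ring_def gscale_def mult_map_scale_conv_mult mult.assoc)
  show "A \<otimes>\<^bsub>comm_gpol_ring m\<^esub> B \<in> gpols_of_ord m (s + s')"
    if "A \<in> gpols_of_ord m s" "B \<in> gpols_of_ord m s'" for s s' and A B :: "'a gpol"
    using that keys_mult[of A B] gpols_mult[of A m B]
    by (auto simp: comm_gpol_ring_def gpols_of_ord_def)
  show "A \<otimes>\<^bsub>comm_gpol_ring m\<^esub> B \<noteq> 0 \<and>
      leader (deg_lex m) (A \<otimes>\<^bsub>comm_gpol_ring m\<^esub> B) = leader (deg_lex m) A + leader (deg_lex m) B"
    if "A \<in> gpols m" "B \<in> gpols m" "A \<noteq> 0" "B \<noteq> 0" for A B :: "'a gpol"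
    using leader_mult_comm[OF ranking_deg_lex that(1,3,2,4)] by (simp add: comm_gpol_ring_def)
  show "ring (comm_gpol_ring m :: 'a gpol ring)" by (rule ring_comm_gpol_ring)
qed (simp_all add: ranking_deg_lex orderly_deg_lex comm_gpol_ring_def mult_single)

text \<open>
  In three variables, the quotient by the variables with index \<open>0\<close> and \<open>1\<close> is the polynomial ring
  in the variable with index \<open>2\<close>. It has dimension one in each degree, so the type is \<open>0\<close> and the
  typical dimension \<open>1\<close>.
\<close>

definition line_gen :: "nat \<Rightarrow> ('a::field) fmod" where
  "line_gen i = single 0 (single (single i 1) 1)"

definition line_sub :: "('a::field) fmod set" where
  "line_sub = {f \<in> free_mod 3 1. \<forall>k. lookup (lookup f 0) (single 2 k) = 0}"

abbreviation "line_ring \<equiv> comm_gpol_ring 3"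

interpretation line: graded_gen_poly_ring 3 "deg_lex 3" "line_ring :: ('a::field) gpol ring"
  by (rule graded_comm_gpol_ring)

lemma subspace_line_sub: "fvs.subspace line_sub"
  using fvs.subspace_0[OF subspace_free_mod] fvs.subspace_add[OF subspace_free_mod]
    fvs.subspace_scale[OF subspace_free_mod]
  by (intro fvs.subspaceI) (auto simp: line_sub_def lookup_add lookup_fscale lookup_gscale)

lemma line_gen_in: "i < 2 \<Longrightarrow> line_gen i \<in> free_mod_deg 3 1 1 \<inter> line_sub"
proof -
  assume i: "i < 2"
  have "single i 1 \<in> mons {..<3}" using i by (intro mons_single) simp
  moreover have "single i (1::nat) \<noteq> single 2 k" for k
    using i by (metis lookup_single_eq lookup_single_not_eq less_irrefl zero_neq_one)
  ultimately show ?thesis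
    using fdeg_subset_free_mod[of "{..<1}" 1 3 1]
    by (auto simp: line_gen_def line_sub_def free_mod_deg_eq fdeg_def gpols_of_ord_iff mons_of_ord_def
        lookup_single when_def split: if_splits)
qed

text \<open>
  A monomial that is not a power of the variable with index \<open>2\<close> is divisible by one of the
  other two variables.
\<close>

lemma line_submodule_gen:
  "submodule_gen 3 1 (line_ring :: ('a::field) gpol ring) (line_gen ` {..<2}) \<inter> free_mod_deg 3 1 s =
     line_sub \<inter> free_mod_deg 3 1 s"
proof
  have act: "lookup (act (line_ring :: 'a gpol ring) g f) j = g * lookup f j" if "g \<in> gpols 3" for g f j
    using line.lookup_act[OF that] by (simp add: comm_gpol_ring_def)
  have "left_submodule 3 1 (line_ring :: 'a gpol ring) line_sub"
    unfolding left_submodule_def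
  proof (intro conjI ballI)
    fix g and f :: "'a fmod" assume g: "g \<in> carrier (line_ring :: 'a gpol ring)" and f: "f \<in> line_sub"
    have g': "g \<in> gpols 3" using g by (simp add: line.carrier)
    have "lookup (g * lookup f 0) (single 2 k) = 0" for k
    proof (rule ccontr)
      assume "lookup (g * lookup f 0) (single 2 k) \<noteq> 0"
      then obtain a b where ab: "b \<in> keys (lookup f 0)" "single 2 k = a + b"
        using keys_mult[of g "lookup f 0"] by (auto simp: in_keys_iff[symmetric])
      have "lookup b i = 0" if "i \<noteq> 2" for i
        using arg_cong[OF ab(2), of "\<lambda>t. lookup t i"] that by (simp add: lookup_add lookup_single when_def)
      then have "b = single 2 (lookup b 2)"
        by (intro poly_mapping_eqI) (auto simp: lookup_single when_def)
      moreover have "lookup (lookup f 0) (single 2 l) = 0" for l using f by (simp add: line_sub_def)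
      ultimately show False using ab(1) by (metis in_keys_iff)
    qed
    moreover have "act line_ring g f \<in> free_mod 3 1"
      using f g' line.keys_act[OF g', of f] gpols_mult[OF g']
      by (auto simp: line_sub_def free_mod_def act)
    ultimately show "act line_ring g f \<in> line_sub" by (simp add: line_sub_def act g')
  qed (use fvs.subspace_0[OF subspace_line_sub] fvs.subspace_add[OF subspace_line_sub]
      in \<open>auto simp: line_sub_def\<close>)
  moreover have "line_gen ` {..<2} \<subseteq> (line_sub :: 'a fmod set)" using line_gen_in by blast
  ultimately have "submodule_gen 3 1 (line_ring :: 'a gpol ring) (line_gen ` {..<2}) \<subseteq> line_sub"
    unfolding submodule_gen_def by (simp add: hull_minimal)
  then show "submodule_gen 3 1 (line_ring :: 'a gpol ring) (line_gen ` {..<2}) \<inter> free_mod_deg 3 1 s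
      \<subseteq> line_sub \<inter> free_mod_deg 3 1 s" by blast
  have "f \<in> N" if f: "f \<in> line_sub" and N: "left_submodule 3 1 (line_ring :: 'a gpol ring) N" "line_gen ` {..<2} \<subseteq> N" for f N
  proof -
    let ?p = "lookup f 0"
    have fm: "f \<in> free_mod 3 1" using f by (simp add: line_sub_def)
    have pm: "keys ?p \<subseteq> mons {..<3}" using fm by (simp add: free_mod_def gpols_def monomials_eq)
    have mon: "single 0 (single t (lookup ?p t)) \<in> N" if t: "t \<in> keys ?p" for t
    proof -
      have "lookup ?p (single 2 (lookup t 2)) = 0" using f by (simp add: line_sub_def)
      then have "t \<noteq> single 2 (lookup t 2)" using t by (metis in_keys_iff)
      moreover have "lookup t i = 0" if "i \<ge> 3" for i
        using pm t that by (intro lookup_mons_outside[of t "{..<3}"]) auto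
      then have "t = single 2 (lookup t 2)" if "\<forall>i<2. lookup t i = 0"
      proof (intro poly_mapping_eqI)
        fix i :: nat
        consider "i < 2" | "i = 2" | "i \<ge> 3" by linarith
        then show "lookup t i = lookup (single 2 (lookup t 2)) i"
          using that \<open>\<And>i. i \<ge> 3 \<Longrightarrow> lookup t i = 0\<close> by cases (auto simp: lookup_single)
      qed
      ultimately obtain i where i: "i < 2" "lookup t i \<noteq> 0" by blast
      have "lookup (single i 1) j \<le> lookup t j" for j using i(2) by (auto simp: lookup_single when_def)
      then obtain v where v: "v \<in> mons {..<3}" "t = v + single i 1" using mon_dvd pm t by blast
      let ?g = "single v (lookup ?p t)"
      have g: "?g \<in> gpols 3" using v by (simp add: gpols_def monomials_eq)
      have "single v c * single (single i 1) 1 = single t c" for c :: 'a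
        by (simp add: mult_single v(2))
      then have "act (line_ring :: 'a gpol ring) ?g (line_gen i) = single 0 (single t (lookup ?p t))"
        by (intro poly_mapping_eqI[of "act line_ring ?g (line_gen i)"])
           (simp add: act[OF g] line_gen_def lookup_single when_def)
      moreover have "act (line_ring :: 'a gpol ring) ?g (line_gen i) \<in> N"
        using N i g by (auto simp: left_submodule_def line.carrier)
      ultimately show ?thesis by simp
    qed
    have sumN: "(\<Sum>t\<in>T. single 0 (single t (lookup ?p t))) \<in> N" if "finite T" "T \<subseteq> keys ?p" for T
      using that
    proof (induction T rule: finite_induct)
      case empty
      then show ?case using N(1) by (simp add: left_submodule_def)
    next
      case (insert t T)
      then show ?case using N(1) mon[of t] by (auto simp: left_submodule_def)
    qed
    have "f = (\<Sum>t\<in>keys ?p. single 0 (single t (lookup ?p t)))"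
    proof (rule poly_mapping_eqI)
      fix j
      show "lookup f j = lookup (\<Sum>t\<in>keys ?p. single 0 (single t (lookup ?p t))) j"
      proof (cases "j = 0")
        case True
        then show ?thesis using gpol_expansion[of ?p] by (simp add: lookup_sum)
      next
        case False
        then have "lookup f j = 0" using fm by (auto simp: free_mod_def in_keys_iff subset_iff)
        then show ?thesis using False by (simp add: lookup_sum lookup_single when_def)
      qed
    qed
    also have "\<dots> \<in> N" by (rule sumN) simp_all
    finally show ?thesis .
  qed
  then show "line_sub \<inter> free_mod_deg 3 1 s \<subseteq>
      submodule_gen 3 1 (line_ring :: 'a gpol ring) (line_gen ` {..<2}) \<inter> free_mod_deg 3 1 s"
    by (auto simp: submodule_gen_def hull_def)
qed

lemma line_quotient_dim:
  "quotient_dim fscale (free_mod_deg 3 1 s) (submodule_gen 3 1 (line_ring :: ('a::field) gpol ring)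
     (line_gen ` {..<2}) \<inter> free_mod_deg 3 1 s) = 1"
proof -
  let ?V = "fdeg 3 {..<1} s :: 'a fmod set" and ?W = "line_sub \<inter> fdeg 3 {..<1} s :: 'a fmod set"
  let ?b = "single 0 (single (single 2 s) 1) :: 'a fmod"
  have W: "fvs.subspace ?W" using subspace_line_sub subspace_fdeg by (rule fvs.subspace_inter)
  have bV: "?b \<in> ?V"
    using mons_single[of 2 "{..<3}" s]
    by (auto simp: fdeg_def gpols_of_ord_iff mons_of_ord_def lookup_single when_def split: if_splits)
  have "quotient_basis fscale ?V ?W {?b}"
    unfolding quotient_basis_def
  proof (intro conjI allI impI ballI)
    fix S c b assume S: "finite S \<and> S \<subseteq> {?b} \<and> (\<Sum>b\<in>S. fscale (c b) b) \<in> ?W" and b: "b \<in> S"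
    then have "S = {?b}" "b = ?b" by auto
    then have "lookup (lookup (fscale (c ?b) ?b) 0) (single 2 s) = 0" using S by (simp add: line_sub_def)
    then show "c b = 0" using \<open>b = ?b\<close> by (simp add: lookup_fscale lookup_gscale)
  next
    fix v assume v: "v \<in> ?V"
    let ?c = "lookup (lookup v 0) (single 2 s)"
    let ?w = "v - fscale ?c ?b"
    have wV: "?w \<in> ?V" using fvs.subspace_diff[OF subspace_fdeg v fvs.subspace_scale[OF subspace_fdeg bV]] .
    have "lookup (lookup ?w 0) (single 2 k) = 0" for k
    proof (cases "k = s")
      case True
      then show ?thesis by (simp add: lookup_minus lookup_fscale lookup_gscale)
    next
      case False
      have "lookup ?w 0 \<in> gpols_of_ord 3 s" using wV by (simp add: fdeg_def)
      then show ?thesis using lookup_gpols_of_ord False by (metis mon_ord_single)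
    qed
    then have "?w \<in> ?W" using wV fdeg_subset_free_mod[of "{..<1}" 1 3 s] by (auto simp: line_sub_def)
    then show "\<exists>S c. finite S \<and> S \<subseteq> {?b} \<and> v - (\<Sum>b\<in>S. fscale (c b) b) \<in> ?W"
      by (intro exI[of _ "{?b}"] exI[of _ "\<lambda>_. ?c"]) simp
  qed (use bV in simp)
  from fvs.quotient_basis_dim(2)[OF subspace_fdeg fdeg_span[OF finite_lessThan]
      finite_fbasis[OF finite_lessThan] W Int_lower2 this]
  have "fvs.dim ?V = fvs.dim ?W + 1" by simp
  moreover have "int (quotient_dim fscale ?V ?W) = int (fvs.dim ?V) - int (fvs.dim ?W)"
    by (rule fvs.quotient_dim_eq[OF subspace_fdeg fdeg_span[OF finite_lessThan]
      finite_fbasis[OF finite_lessThan] W Int_lower2])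
  ultimately show ?thesis unfolding line_submodule_gen unfolding free_mod_deg_eq by simp
qed

lemma line_characteristic:
  fixes D :: "('a::field) gpol ring"
  defines "D \<equiv> line_ring"
  shows "characteristic_poly 3 1 D (line_gen ` {..<2}) = 1"
    "gen_codim 3 1 D (line_gen ` {..<2}) = 2" "typical_dim 3 1 D (line_gen ` {..<2}) = 1"
proof -
  show w: "characteristic_poly 3 1 D (line_gen ` {..<2}) = 1"
    unfolding characteristic_poly_def D_def line_quotient_dim by (rule the_poly_eq) simp
  show "gen_codim 3 1 D (line_gen ` {..<2}) = 2" unfolding gen_codim_def gen_type_def w by simp
  show "typical_dim 3 1 D (line_gen ` {..<2}) = 1"
    unfolding typical_dim_def Let_def w
    by (rule the_equality) (auto intro: exI[of _ "\<lambda>_. 1"])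
qed

lemma codim2_bound_attained:
  "\<exists>m r (D :: ('a::field) gpol ring) n \<Sigma> e.
       graded_gen_poly_ring m r D \<and>
       (\<forall>h\<in>\<Sigma>. homogeneous m n h) \<and>
       (\<forall>h\<in>\<Sigma>. \<forall>j<n. ord_at j h \<le> ereal (real (e j))) \<and>
       characteristic_poly m n D \<Sigma> \<noteq> 0 \<and>
       gen_codim m n D \<Sigma> = 2 \<and>
       typical_dim m n D \<Sigma> = int (codim2_bound n e)"
proof (intro exI conjI)
  let ?D = "line_ring :: 'a gpol ring"
  show "graded_gen_poly_ring 3 (deg_lex 3) ?D" by (rule graded_comm_gpol_ring)
  show "\<forall>h\<in>line_gen ` {..<2}. homogeneous 3 1 (h :: 'a fmod)"
    using line_gen_in by (auto simp: homogeneous_def)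
  show "\<forall>h\<in>line_gen ` {..<2}. \<forall>j<1. ord_at j (h :: 'a fmod) \<le> ereal (real ((\<lambda>_. 1) j))"
    by (auto simp: ord_at_def gpol_ord_def line_gen_def)
  show "characteristic_poly 3 1 ?D (line_gen ` {..<2}) \<noteq> 0" unfolding line_characteristic by simp
  show "gen_codim 3 1 ?D (line_gen ` {..<2}) = 2" by (rule line_characteristic)
  have "codim2_bound 1 (\<lambda>_. 1) = 1" by (simp add: codim2_bound_def lessThan_Suc)
  then show "typical_dim 3 1 ?D (line_gen ` {..<2}) = int (codim2_bound 1 (\<lambda>_. 1))"
    by (simp only: line_characteristic)
qed

theorem theorem3:
  shows
   "(\<forall>m r (D :: ('a::field) gpol ring) n \<Sigma> e.
       graded_gen_poly_ring m r D \<and>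
       (\<forall>h\<in>\<Sigma>. homogeneous m n h) \<and>
       (\<forall>h\<in>\<Sigma>. \<forall>j<n. ord_at j h \<le> ereal (real (e j)))
       \<longrightarrow>
       (gen_codim m n D \<Sigma> = 0 \<longrightarrow> typical_dim m n D \<Sigma> \<le> int n) \<and>
       (gen_codim m n D \<Sigma> = 1 \<longrightarrow> typical_dim m n D \<Sigma> \<le> int (\<Sum>j<n. e j)) \<and>
       (gen_codim m n D \<Sigma> = 2 \<longrightarrow>
          typical_dim m n D \<Sigma> \<le> int (codim2_bound n e) \<and>
          codim2_bound n e \<le> (\<Sum>j<n. e j)\<^sup>2))
    \<and>
    (\<exists>m r (D :: 'a gpol ring) n \<Sigma> e.
       graded_gen_poly_ring m r D \<and>
       (\<forall>h\<in>\<Sigma>. homogeneous m n h) \<and>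
       (\<forall>h\<in>\<Sigma>. \<forall>j<n. ord_at j h \<le> ereal (real (e j))) \<and>
       characteristic_poly m n D \<Sigma> \<noteq> 0 \<and>
       gen_codim m n D \<Sigma> = 2 \<and>
       typical_dim m n D \<Sigma> = int (codim2_bound n e))"
proof (rule conjI, intro allI impI, elim conjE)
  fix m r n e and D :: "'a gpol ring" and \<Sigma> :: "'a fmod set"
  assume "graded_gen_poly_ring m r D" and \<Sigma>: "\<forall>h\<in>\<Sigma>. homogeneous m n h"
    "\<forall>h\<in>\<Sigma>. \<forall>j<n. ord_at j h \<le> ereal (real (e j))"
  then interpret graded_gen_poly_ring m r D by simp
  show "(gen_codim m n D \<Sigma> = 0 \<longrightarrow> typical_dim m n D \<Sigma> \<le> int n) \<and>
       (gen_codim m n D \<Sigma> = 1 \<longrightarrow> typical_dim m n D \<Sigma> \<le> int (\<Sum>j<n. e j)) \<and>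
       (gen_codim m n D \<Sigma> = 2 \<longrightarrow>
          typical_dim m n D \<Sigma> \<le> int (codim2_bound n e) \<and>
          codim2_bound n e \<le> (\<Sum>j<n. e j)\<^sup>2)"
    using typical_dim_bounds[OF \<Sigma>] codim2_bound_le_square by blast
qed (rule codim2_bound_attained)

end
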